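(* Let $\Lambda$ be a left and right noetherian ring, let $M$ be in $\mathrm{mod}\,\Lambda$ and let $k$ be a positive integer. If $\mathrm{s.grade}\,\mathrm{Ext}^{t+1}_{\Lambda}(M,\Lambda)\ge t$ for any $1\le t\le k-1$, then $M$ has a $\mathbb{W}^{t}$-approximation presentation for any $1\le t\le k$.
   Context: $\mathrm{mod}\,\Lambda$ (resp. $\mathrm{mod}\,\Lambda^{op}$) is the category of finitely generated left (resp. right) $\Lambda$-modules. For a finitely generated (left or right) module $X$ and a non-negative integer $i$, $\mathrm{grade}\,X\ge i$ means $\mathrm{Ext}^{j}_{\Lambda}(X,\Lambda)=0$ for all $0\le j<i$; $\mathrm{s.grade}\,X\ge i$ (strong grade at least $i$) means $\mathrm{grade}\,Y\ge i$ for every submodule $Y$ of $X$. For $t\geq 1$, $\mathbb{W}^{t}$ is the full subcategory of $\mathrm{mod}\,\Lambda$ consisting of the modules $M$ with $\mathrm{Ext}^{i}_{\Lambda}(M,\Lambda)=0$ for all $1\le i\le t$. A right $\mathbb{W}^{t}$-approximation of $M$ is a morphism $E\to M$ with $E\in\mathbb{W}^{t}$ such that $\mathrm{Hom}_{\Lambda}(X,E)\to\mathrm{Hom}_{\Lambda}(X,M)\to 0$ is exact for all $X\in\mathbb{W}^{t}$. A $\mathbb{W}^{t}$-approximation presentation of $M$ is an exact sequence $0\to K_t(M)\to E_t(M)\to M\to 0$ in $\mathrm{mod}\,\Lambda$ such that $E_t(M)\to M$ is a right $\mathbb{W}^{t}$-approximation of $M$ and the projective dimension of $K_t(M)$ is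 at most $t-1$. *)

theory Defs
  imports "HOL-Algebra.Module" "HOL-Algebra.AbelCoset"
begin

text \<open>
  The locale \<open>module\<close> of HOL-Algebra requires a commutative ring. Its record type and its locale
  \<open>submodule\<close> do not, and are reused here for left modules over an arbitrary ring. The ring
  multiplication and unit that a module record inherits from \<open>ring\<close> carry no meaning and are
  never referred to. A right \<open>R\<close>-module is a left module over \<open>op_ring R\<close>.
\<close>

locale left_module = R?: ring R + M?: abelian_group M
  for R :: "('a, 'c) ring_scheme" (structure) and M :: "('a, 'b) module" (structure) +
  assumes smult_closed [simp, intro]:
      "\<lbrakk>a \<in> carrier R; x \<in> carrier M\<rbrakk> \<Longrightarrow> a \<odot>\<^bsub>M\<^esub> x \<in> carrier M"
    and smult_l_distr:
      "\<lbrakk>a \<in> carrier R; b \<in> carrier R; x \<in> carrier M\<rbrakk> \<Longrightarrow>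
      (a \<oplus> b) \<odot>\<^bsub>M\<^esub> x = a \<odot>\<^bsub>M\<^esub> x \<oplus>\<^bsub>M\<^esub> b \<odot>\<^bsub>M\<^esub> x"
    and smult_r_distr:
      "\<lbrakk>a \<in> carrier R; x \<in> carrier M; y \<in> carrier M\<rbrakk> \<Longrightarrow>
      a \<odot>\<^bsub>M\<^esub> (x \<oplus>\<^bsub>M\<^esub> y) = a \<odot>\<^bsub>M\<^esub> x \<oplus>\<^bsub>M\<^esub> a \<odot>\<^bsub>M\<^esub> y"
    and smult_assoc1:
      "\<lbrakk>a \<in> carrier R; b \<in> carrier R; x \<in> carrier M\<rbrakk> \<Longrightarrow>
      (a \<otimes> b) \<odot>\<^bsub>M\<^esub> x = a \<odot>\<^bsub>M\<^esub> (b \<odot>\<^bsub>M\<^esub> x)"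
    and smult_one [simp]:
      "x \<in> carrier M \<Longrightarrow> \<one> \<odot>\<^bsub>M\<^esub> x = x"

definition op_ring :: "('a, 'c) ring_scheme \<Rightarrow> ('a, 'c) ring_scheme" where
  "op_ring R = R\<lparr>mult := \<lambda>x y. y \<otimes>\<^bsub>R\<^esub> x\<rparr>"

definition regular_module :: "('a, 'c) ring_scheme \<Rightarrow> ('a, 'a) module" where
  "regular_module R =
     \<lparr>carrier = carrier R, mult = mult R, one = one R, zero = zero R, add = add R, smult = mult R\<rparr>"

definition finitely_generated :: "('a, 'c) ring_scheme \<Rightarrow> ('a, 'b) module \<Rightarrow> bool" where
  "finitely_generated R M \<longleftrightarrow>
     (\<exists>A. finite A \<and> A \<subseteq> carrier M \<and> (\<forall>N. submodule N R M \<and> A \<subseteq> N \<longrightarrow> N = carrier M))"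

text \<open>The objects of \<open>mod R\<close>; those of \<open>mod R\<^sup>o\<^sup>p\<close> are the objects of \<open>mod (op_ring R)\<close>.\<close>

definition fg_module :: "('a, 'c) ring_scheme \<Rightarrow> ('a, 'b) module \<Rightarrow> bool" where
  "fg_module R M \<longleftrightarrow> left_module R M \<and> finitely_generated R M"

definition left_noetherian :: "('a, 'c) ring_scheme \<Rightarrow> bool" where
  "left_noetherian R \<longleftrightarrow>
     (\<forall>I. submodule I R (regular_module R) \<longrightarrow>
        finitely_generated R ((regular_module R)\<lparr>carrier := I\<rparr>))"

definition right_noetherian :: "('a, 'c) ring_scheme \<Rightarrow> bool" where
  "right_noetherian R \<longleftrightarrow> left_noetherian (op_ring R)"

definition mod_hom ::
    "('a, 'c) ring_scheme \<Rightarrow> ('a, 'b) module \<Rightarrow> ('a, 'd) module \<Rightarrow> ('b \<Rightarrow> 'd) set" where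
  "mod_hom R M N = {f \<in> carrier M \<rightarrow> carrier N.
     (\<forall>x\<in>carrier M. \<forall>y\<in>carrier M. f (x \<oplus>\<^bsub>M\<^esub> y) = f x \<oplus>\<^bsub>N\<^esub> f y) \<and>
     (\<forall>r\<in>carrier R. \<forall>x\<in>carrier M. f (r \<odot>\<^bsub>M\<^esub> x) = r \<odot>\<^bsub>N\<^esub> f x)}"

definition mod_ker :: "('a, 'b) module \<Rightarrow> ('a, 'd) module \<Rightarrow> ('b \<Rightarrow> 'd) \<Rightarrow> 'b set" where
  "mod_ker M N f = {x \<in> carrier M. f x = \<zero>\<^bsub>N\<^esub>}"

definition quot_module :: "('a, 'b) module \<Rightarrow> 'b set \<Rightarrow> ('a, 'b set) module" where
  "quot_module M H =
     \<lparr>carrier = a_rcosets\<^bsub>M\<^esub> H, mult = undefined, one = undefined, zero = H, add = set_add M,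
      smult = (\<lambda>r A. \<Union>x\<in>A. H +>\<^bsub>M\<^esub> (r \<odot>\<^bsub>M\<^esub> x))\<rparr>"

text \<open>
  A universe for \<open>mod R\<close>: a finitely generated module is a quotient of some \<open>R\<^sup>n\<close>, so up to
  isomorphism its elements are cosets in \<open>R\<^sup>n\<close>, that is, sets of functions \<open>nat \<Rightarrow> 'a\<close>. Quantification
  over \<open>mod R\<close> inside a formula is quantification over this type.
\<close>

type_synonym 'a umodule = "('a, (nat \<Rightarrow> 'a) set) module"

text \<open>
  Projective objects of \<open>mod R\<close>: lifting property against epimorphisms in \<open>mod R\<close>. For finitely
  generated \<open>P\<close> this is projectivity, as the epimorphisms include \<open>R\<^sup>n \<rightarrow> P\<close>.
\<close>

definition fg_projective :: "('a, 'c) ring_scheme \<Rightarrow> ('a, 'b) module \<Rightarrow> bool" where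
  "fg_projective R P \<longleftrightarrow> fg_module R P \<and>
     (\<forall>(A :: 'a umodule) (B :: 'a umodule). \<forall>g \<in> mod_hom R A B. \<forall>f \<in> mod_hom R P B.
        fg_module R A \<and> fg_module R B \<and> g ` carrier A = carrier B \<longrightarrow>
        (\<exists>h \<in> mod_hom R P A. \<forall>x\<in>carrier P. g (h x) = f x))"

definition projective_resolution ::
    "('a, 'c) ring_scheme \<Rightarrow> ('a, 'b) module \<Rightarrow>
     (nat \<Rightarrow> ('a, 'p) module) \<Rightarrow> (nat \<Rightarrow> 'p \<Rightarrow> 'p) \<Rightarrow> ('p \<Rightarrow> 'b) \<Rightarrow> bool" where
  "projective_resolution R M P d e \<longleftrightarrow>
     (\<forall>i. fg_projective R (P i)) \<and>
     e \<in> mod_hom R (P 0) M \<and> (\<forall>i. d i \<in> mod_hom R (P (Suc i)) (P i)) \<and>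
     e ` carrier (P 0) = carrier M \<and>
     d 0 ` carrier (P 1) = mod_ker (P 0) M e \<and>
     (\<forall>i. d (Suc i) ` carrier (P (Suc (Suc i))) = mod_ker (P (Suc i)) (P i) (d i))"

text \<open>
  Finitely generated projective modules are isomorphic to submodules of some \<open>R\<^sup>n\<close>, so resolutions
  are taken on the carrier type \<open>nat \<Rightarrow> 'a\<close>.
\<close>

definition proj_dim_le :: "('a, 'c) ring_scheme \<Rightarrow> ('a, 'b) module \<Rightarrow> nat \<Rightarrow> bool" where
  "proj_dim_le R M n \<longleftrightarrow>
     (\<exists>(P :: nat \<Rightarrow> ('a, nat \<Rightarrow> 'a) module) d e.
        projective_resolution R M P d e \<and> (\<forall>i>n. carrier (P i) = {\<zero>\<^bsub>P i\<^esub>}))"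

text \<open>
  \<open>Hom\<^sub>R(M, R)\<close> with the right \<open>R\<close>-action \<open>(f r) x = (f x) r\<close>, as a left module over \<open>op_ring R\<close>.
  Homomorphisms are extensional so that they are equal if they agree on \<open>carrier M\<close>.
\<close>

definition dual_module :: "('a, 'c) ring_scheme \<Rightarrow> ('a, 'b) module \<Rightarrow> ('a, 'b \<Rightarrow> 'a) module" where
  "dual_module R M =
     \<lparr>carrier = mod_hom R M (regular_module R) \<inter> extensional (carrier M),
      mult = undefined, one = undefined,
      zero = (\<lambda>x\<in>carrier M. \<zero>\<^bsub>R\<^esub>),
      add = (\<lambda>f g. \<lambda>x\<in>carrier M. f x \<oplus>\<^bsub>R\<^esub> g x),
      smult = (\<lambda>r f. \<lambda>x\<in>carrier M. f x \<otimes>\<^bsub>R\<^esub> r)\<rparr>"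

definition cocycles ::
    "('a, 'c) ring_scheme \<Rightarrow> (nat \<Rightarrow> ('a, 'p) module) \<Rightarrow> (nat \<Rightarrow> 'p \<Rightarrow> 'p) \<Rightarrow> nat \<Rightarrow> ('p \<Rightarrow> 'a) set" where
  "cocycles R P d i =
     {f \<in> carrier (dual_module R (P i)). \<forall>x\<in>carrier (P (Suc i)). f (d i x) = \<zero>\<^bsub>R\<^esub>}"

fun coboundaries ::
    "('a, 'c) ring_scheme \<Rightarrow> (nat \<Rightarrow> ('a, 'p) module) \<Rightarrow> (nat \<Rightarrow> 'p \<Rightarrow> 'p) \<Rightarrow> nat \<Rightarrow> ('p \<Rightarrow> 'a) set" where
  "coboundaries R P d 0 = {\<zero>\<^bsub>dual_module R (P 0)\<^esub>}"
| "coboundaries R P d (Suc i) =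
     (\<lambda>g. \<lambda>x\<in>carrier (P (Suc i)). g (d i x)) ` carrier (dual_module R (P i))"

definition dual_cohomology ::
    "('a, 'c) ring_scheme \<Rightarrow> (nat \<Rightarrow> ('a, 'p) module) \<Rightarrow> (nat \<Rightarrow> 'p \<Rightarrow> 'p) \<Rightarrow> nat \<Rightarrow>
     ('a, ('p \<Rightarrow> 'a) set) module" where
  "dual_cohomology R P d i =
     quot_module ((dual_module R (P i))\<lparr>carrier := cocycles R P d i\<rparr>) (coboundaries R P d i)"

text \<open>
  \<open>Ext\<^sup>i\<^sub>R(M, R)\<close> as a right \<open>R\<close>-module. For \<open>R\<close> left noetherian and \<open>M\<close> finitely generated a
  resolution exists, and the result does not depend on it up to isomorphism. Since
  \<open>op_ring (op_ring R) = R\<close>, the same constant applied to \<open>op_ring R\<close> gives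
  \<open>Ext\<close> of right modules into the right module \<open>R\<close>.
\<close>

definition Ext ::
    "('a, 'c) ring_scheme \<Rightarrow> ('a, 'b) module \<Rightarrow> nat \<Rightarrow> ('a, ((nat \<Rightarrow> 'a) \<Rightarrow> 'a) set) module" where
  "Ext R M i =
     (let (P, d, e) = (SOME (P, d, e). projective_resolution R M P d e)
      in dual_cohomology R P d i)"

definition Ext_vanishes :: "('a, 'c) ring_scheme \<Rightarrow> ('a, 'b) module \<Rightarrow> nat \<Rightarrow> bool" where
  "Ext_vanishes R M i \<longleftrightarrow> carrier (Ext R M i) = {\<zero>\<^bsub>Ext R M i\<^esub>}"

definition grade_ge :: "('a, 'c) ring_scheme \<Rightarrow> ('a, 'b) module \<Rightarrow> nat \<Rightarrow> bool" where
  "grade_ge R X i \<longleftrightarrow> (\<forall>j<i. Ext_vanishes R X j)"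

definition sgrade_ge :: "('a, 'c) ring_scheme \<Rightarrow> ('a, 'b) module \<Rightarrow> nat \<Rightarrow> bool" where
  "sgrade_ge R X i \<longleftrightarrow> (\<forall>Y. submodule Y R X \<longrightarrow> grade_ge R (X\<lparr>carrier := Y\<rparr>) i)"

definition W_modules :: "('a, 'c) ring_scheme \<Rightarrow> nat \<Rightarrow> ('a, 'b) module set" where
  "W_modules R t = {M. fg_module R M \<and> (\<forall>i. 1 \<le> i \<and> i \<le> t \<longrightarrow> Ext_vanishes R M i)}"

definition right_W_approximation ::
    "('a, 'c) ring_scheme \<Rightarrow> nat \<Rightarrow> ('a, 'e) module \<Rightarrow> ('a, 'b) module \<Rightarrow> ('e \<Rightarrow> 'b) \<Rightarrow> bool" where
  "right_W_approximation R t E M f \<longleftrightarrow>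
     E \<in> W_modules R t \<and> f \<in> mod_hom R E M \<and>
     (\<forall>(X :: 'a umodule) \<in> W_modules R t. \<forall>g \<in> mod_hom R X M.
        \<exists>h \<in> mod_hom R X E. \<forall>x\<in>carrier X. f (h x) = g x)"

definition W_approximation_presentation ::
    "('a, 'c) ring_scheme \<Rightarrow> nat \<Rightarrow> ('a, 'b) module \<Rightarrow>
     ('a, 'k) module \<Rightarrow> ('a, 'e) module \<Rightarrow> ('k \<Rightarrow> 'e) \<Rightarrow> ('e \<Rightarrow> 'b) \<Rightarrow> bool" where
  "W_approximation_presentation R t M K E u f \<longleftrightarrow>
     fg_module R K \<and> fg_module R E \<and> u \<in> mod_hom R K E \<and> f \<in> mod_hom R E M \<and>
     inj_on u (carrier K) \<and> u ` carrier K = mod_ker E M f \<and> f ` carrier E = carrier M \<and>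
     right_W_approximation R t E M f \<and> proj_dim_le R K (t - 1)"

definition has_W_approximation_presentation ::
    "('a, 'c) ring_scheme \<Rightarrow> nat \<Rightarrow> ('a, 'b) module \<Rightarrow> bool" where
  "has_W_approximation_presentation R t M \<longleftrightarrow>
     (\<exists>(K :: 'a umodule) (E :: 'a umodule) u f. W_approximation_presentation R t M K E u f)"

end

theory Submission
  imports Defs
begin

text \<open>
  Fix a resolution \<open>F\<close> of \<open>M\<close> by finitely generated projectives. The presentation in degree \<open>t\<close> is
  obtained by changing \<open>F\<close> only below degree \<open>t\<close>. The object built is a complex \<open>T\<close> of finitely
  generated projectives, exact in positive degrees, which agrees with \<open>F\<close> from degree \<open>t\<close> on, has a
  degreewise surjective chain map \<open>\<pi>\<close> to \<open>F\<close>, and whose dual \<open>Hom(T, R)\<close> is exact in the degrees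
  \<open>1, \<dots>, t\<close> (locale \<open>approximation_stage\<close>). Such a \<open>T\<close> gives everything at once
  (\<open>presentation_of_stage\<close>):
  \<^item> \<open>T\<close> resolves \<open>E = coker (T\<^sub>1 \<rightarrow> T\<^sub>0)\<close>, so the exactness of the dual says \<open>Ext\<^sup>i(E, R) = 0\<close> for
    \<open>1 \<le> i \<le> t\<close>.
  \<^item> \<open>\<pi>\<close> induces an epimorphism \<open>E \<rightarrow> M\<close>. Its kernel \<open>K\<close> is resolved by \<open>ker \<pi>\<close>, which consists of
    projectives and lives in the degrees below \<open>t\<close>.
  \<^item> If \<open>Ext\<^sup>i(X, R) = 0\<close> for \<open>1 \<le> i \<le> t\<close>, then a map \<open>X \<rightarrow> M\<close> lifts to \<open>E\<close>: the obstruction is a class in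
    \<open>Ext\<^sup>1(X, K)\<close>, and the resolution of \<open>K\<close> filters this group by the groups \<open>Ext\<^sup>i(X, P)\<close> with \<open>P\<close>
    projective and \<open>1 \<le> i \<le> t\<close> (\<open>lift_along_epimorphism\<close>).

  The complex \<open>T\<close> is constructed by induction on \<open>t\<close>, from \<open>T = F\<close> for \<open>t = 0\<close>. Given \<open>T\<close> for \<open>t\<close>, the
  obstruction to the next step is the cohomology of \<open>Hom(T, R)\<close> in degree \<open>t + 1\<close>, which is
  \<open>H = Ext\<^sup>t\<^sup>+\<^sup>1(M, R)\<close> because \<open>T\<close> and \<open>F\<close> agree there. Take a projective resolution \<open>L\<close> of the right
  module \<open>H\<close>. A lift of \<open>L\<^sub>0 \<rightarrow> H\<close> to cocycles extends to a chain map from \<open>L\<close> to \<open>Hom(T, R)\<close>, whose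
  cone is exact in the degrees \<open>1, \<dots>, t + 1\<close>. That cone is the dual of a complex with terms
  \<open>T\<^sub>i \<oplus> N\<^sub>i\<close>, where \<open>N\<^sub>i = Hom(L\<^sub>t\<^sub>-\<^sub>i, R)\<close>, and this complex is the next \<open>T\<close>. It has to be exact
  in positive degrees. As \<open>T\<close> is, this amounts to exactness of \<open>N\<close> in positive degrees, that
  is, to \<open>Ext\<^sup>j(H, R) = 0\<close> for \<open>j < t\<close>, which is what the grade condition on \<open>H\<close> provides.

  The dual basis criterion for projectivity supports most arguments: it gives liftings along
  epimorphisms between arbitrary modules, the projectivity and reflexivity of duals, and the passage
  from maps into \<open>R\<close> to maps into projectives.
\<close>

section \<open>Left modules and submodules\<close>

lemma (in abelian_group) a_inv_zero [simp]: "\<ominus> \<zero> = \<zero>"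
  by (rule minus_equality) auto

lemma (in abelian_group) minus_self [simp]: "x \<in> carrier G \<Longrightarrow> x \<ominus> x = \<zero>"
  by (simp add: a_minus_def r_neg)

lemma (in abelian_group) minus_zero_right [simp]: "x \<in> carrier G \<Longrightarrow> x \<ominus> \<zero> = x"
  by (simp add: a_minus_def)

lemma (in left_module) smult_l_null [simp]:
  assumes "x \<in> carrier M"
  shows "\<zero> \<odot>\<^bsub>M\<^esub> x = \<zero>\<^bsub>M\<^esub>"
proof -
  have "\<zero> \<odot>\<^bsub>M\<^esub> x \<oplus>\<^bsub>M\<^esub> \<zero> \<odot>\<^bsub>M\<^esub> x = (\<zero> \<oplus> \<zero>) \<odot>\<^bsub>M\<^esub> x"
    using assms by (subst smult_l_distr) auto
  then show ?thesis
    using assms by simp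
qed

lemma (in left_module) smult_r_null [simp]:
  assumes "r \<in> carrier R"
  shows "r \<odot>\<^bsub>M\<^esub> \<zero>\<^bsub>M\<^esub> = \<zero>\<^bsub>M\<^esub>"
proof -
  have "r \<odot>\<^bsub>M\<^esub> \<zero>\<^bsub>M\<^esub> \<oplus>\<^bsub>M\<^esub> r \<odot>\<^bsub>M\<^esub> \<zero>\<^bsub>M\<^esub> = r \<odot>\<^bsub>M\<^esub> (\<zero>\<^bsub>M\<^esub> \<oplus>\<^bsub>M\<^esub> \<zero>\<^bsub>M\<^esub>)"
    using assms by (subst smult_r_distr) auto
  then show ?thesis
    using assms by simp
qed

lemma (in left_module) smult_minus_one:
  assumes "x \<in> carrier M"
  shows "(\<ominus> \<one>) \<odot>\<^bsub>M\<^esub> x = \<ominus>\<^bsub>M\<^esub> x"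
proof -
  have "(\<ominus> \<one>) \<odot>\<^bsub>M\<^esub> x \<oplus>\<^bsub>M\<^esub> x = (\<ominus> \<one> \<oplus> \<one>) \<odot>\<^bsub>M\<^esub> x"
    using assms by (subst smult_l_distr) auto
  then have "(\<ominus> \<one>) \<odot>\<^bsub>M\<^esub> x \<oplus>\<^bsub>M\<^esub> x = \<zero>\<^bsub>M\<^esub>"
    using assms by (simp add: R.l_neg)
  then show ?thesis
    using assms by (simp add: M.minus_equality)
qed

lemma (in left_module) smult_finsum:
  assumes "finite A" "r \<in> carrier R" "f \<in> A \<rightarrow> carrier M"
  shows "r \<odot>\<^bsub>M\<^esub> finsum M f A = (\<Oplus>\<^bsub>M\<^esub>i\<in>A. r \<odot>\<^bsub>M\<^esub> f i)"
  using assms by (induct A rule: finite_induct) (auto simp: smult_r_distr Pi_def)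

lemma left_moduleD:
  assumes "left_module R M"
  shows "ring R" "abelian_group M"
  using assms by (auto simp: left_module_def)

lemma left_moduleI:
  fixes R (structure) and M (structure)
  assumes "ring R"
    and "\<And>x y. \<lbrakk>x \<in> carrier M; y \<in> carrier M\<rbrakk> \<Longrightarrow> x \<oplus>\<^bsub>M\<^esub> y \<in> carrier M"
    and "\<zero>\<^bsub>M\<^esub> \<in> carrier M"
    and "\<And>x y z. \<lbrakk>x \<in> carrier M; y \<in> carrier M; z \<in> carrier M\<rbrakk> \<Longrightarrow> x \<oplus>\<^bsub>M\<^esub> y \<oplus>\<^bsub>M\<^esub> z = x \<oplus>\<^bsub>M\<^esub> (y \<oplus>\<^bsub>M\<^esub> z)"
    and "\<And>x y. \<lbrakk>x \<in> carrier M; y \<in> carrier M\<rbrakk> \<Longrightarrow> x \<oplus>\<^bsub>M\<^esub> y = y \<oplus>\<^bsub>M\<^esub> x"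
    and "\<And>x. x \<in> carrier M \<Longrightarrow> \<zero>\<^bsub>M\<^esub> \<oplus>\<^bsub>M\<^esub> x = x"
    and "\<And>x. x \<in> carrier M \<Longrightarrow> \<exists>y\<in>carrier M. y \<oplus>\<^bsub>M\<^esub> x = \<zero>\<^bsub>M\<^esub>"
    and "\<And>a x. \<lbrakk>a \<in> carrier R; x \<in> carrier M\<rbrakk> \<Longrightarrow> a \<odot>\<^bsub>M\<^esub> x \<in> carrier M"
    and "\<And>a b x. \<lbrakk>a \<in> carrier R; b \<in> carrier R; x \<in> carrier M\<rbrakk> \<Longrightarrow>
      (a \<oplus>\<^bsub>R\<^esub> b) \<odot>\<^bsub>M\<^esub> x = a \<odot>\<^bsub>M\<^esub> x \<oplus>\<^bsub>M\<^esub> b \<odot>\<^bsub>M\<^esub> x"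
    and "\<And>a x y. \<lbrakk>a \<in> carrier R; x \<in> carrier M; y \<in> carrier M\<rbrakk> \<Longrightarrow>
      a \<odot>\<^bsub>M\<^esub> (x \<oplus>\<^bsub>M\<^esub> y) = a \<odot>\<^bsub>M\<^esub> x \<oplus>\<^bsub>M\<^esub> a \<odot>\<^bsub>M\<^esub> y"
    and "\<And>a b x. \<lbrakk>a \<in> carrier R; b \<in> carrier R; x \<in> carrier M\<rbrakk> \<Longrightarrow>
      (a \<otimes>\<^bsub>R\<^esub> b) \<odot>\<^bsub>M\<^esub> x = a \<odot>\<^bsub>M\<^esub> (b \<odot>\<^bsub>M\<^esub> x)"
    and "\<And>x. x \<in> carrier M \<Longrightarrow> \<one>\<^bsub>R\<^esub> \<odot>\<^bsub>M\<^esub> x = x"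
  shows "left_module R M"
  by (intro left_module.intro abelian_groupI left_module_axioms.intro assms)

text \<open>Closure under negation is scalar multiplication by \<open>\<ominus> \<one>\<close>.\<close>

lemma left_submoduleI:
  assumes "left_module R M" "H \<subseteq> carrier M" "\<zero>\<^bsub>M\<^esub> \<in> H"
    and add: "\<And>x y. \<lbrakk>x \<in> H; y \<in> H\<rbrakk> \<Longrightarrow> x \<oplus>\<^bsub>M\<^esub> y \<in> H"
    and smult: "\<And>r x. \<lbrakk>r \<in> carrier R; x \<in> H\<rbrakk> \<Longrightarrow> r \<odot>\<^bsub>M\<^esub> x \<in> H"
  shows "submodule H R M"
proof -
  interpret left_module R M by fact
  have "\<ominus>\<^bsub>M\<^esub> x \<in> H" if "x \<in> H" for x
    using smult[of "\<ominus>\<^bsub>R\<^esub> \<one>\<^bsub>R\<^esub>" x] that assms(2) smult_minus_one[of x] by auto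
  then show ?thesis
    using assms by (intro submodule.intro subgroup.intro submodule_axioms.intro)
      (auto simp: a_inv_def)
qed

lemma submoduleD:
  assumes "submodule H R M"
  shows "H \<subseteq> carrier M" "\<zero>\<^bsub>M\<^esub> \<in> H"
    "\<And>x y. \<lbrakk>x \<in> H; y \<in> H\<rbrakk> \<Longrightarrow> x \<oplus>\<^bsub>M\<^esub> y \<in> H"
    "\<And>r x. \<lbrakk>r \<in> carrier R; x \<in> H\<rbrakk> \<Longrightarrow> r \<odot>\<^bsub>M\<^esub> x \<in> H"
    "\<And>x. x \<in> H \<Longrightarrow> \<ominus>\<^bsub>M\<^esub> x \<in> H"
    "subgroup H (add_monoid M)"
proof -
  interpret submodule H R M by fact
  show "H \<subseteq> carrier M" "\<zero>\<^bsub>M\<^esub> \<in> H"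
    "\<And>x y. \<lbrakk>x \<in> H; y \<in> H\<rbrakk> \<Longrightarrow> x \<oplus>\<^bsub>M\<^esub> y \<in> H"
    "\<And>r x. \<lbrakk>r \<in> carrier R; x \<in> H\<rbrakk> \<Longrightarrow> r \<odot>\<^bsub>M\<^esub> x \<in> H"
    "subgroup H (add_monoid M)"
    using subset one_closed m_closed subgroup_axioms by auto
  show "\<And>x. x \<in> H \<Longrightarrow> \<ominus>\<^bsub>M\<^esub> x \<in> H"
    unfolding a_inv_def by (rule m_inv_closed)
qed

lemma left_module_submodule:
  assumes "left_module R M" "submodule H R M"
  shows "left_module R (M\<lparr>carrier := H\<rparr>)"
proof -
  interpret left_module R M by fact
  note H = submoduleD[OF assms(2)]
  have c: "x \<in> carrier M" if "x \<in> H" for x using that H by auto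
  show ?thesis
  proof (rule left_moduleI)
    fix x assume "x \<in> carrier (M\<lparr>carrier := H\<rparr>)"
    then show "\<exists>y\<in>carrier (M\<lparr>carrier := H\<rparr>). y \<oplus>\<^bsub>M\<lparr>carrier := H\<rparr>\<^esub> x = \<zero>\<^bsub>M\<lparr>carrier := H\<rparr>\<^esub>"
      using H(5) c by (auto intro!: bexI[of _ "\<ominus>\<^bsub>M\<^esub> x"] simp: M.l_neg)
  qed (auto simp: c M.a_ac smult_l_distr smult_r_distr smult_assoc1 H left_moduleD(1)[OF assms(1)] intro: H)
qed

lemma submodule_carrier: "left_module R M \<Longrightarrow> submodule (carrier M) R M"
proof -
  assume "left_module R M"
  then interpret left_module R M .
  show ?thesis by (rule left_submoduleI) (auto intro: left_module_axioms)
qed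

lemma submodule_in_submodule:
  assumes "left_module R M" "submodule H R M"
  shows "submodule N R (M\<lparr>carrier := H\<rparr>) \<longleftrightarrow> submodule N R M \<and> N \<subseteq> H"
proof
  assume N: "submodule N R (M\<lparr>carrier := H\<rparr>)"
  show "submodule N R M \<and> N \<subseteq> H"
    using submoduleD[OF N] submoduleD[OF assms(2)] by (auto intro!: left_submoduleI assms)
next
  assume N: "submodule N R M \<and> N \<subseteq> H"
  then show "submodule N R (M\<lparr>carrier := H\<rparr>)"
    using submoduleD[of N R M] by (auto intro!: left_submoduleI left_module_submodule assms)
qed

section \<open>Homomorphisms, kernels and images\<close>

lemma mod_homI:
  assumes "\<And>x. x \<in> carrier M \<Longrightarrow> f x \<in> carrier N"
    and "\<And>x y. \<lbrakk>x \<in> carrier M; y \<in> carrier M\<rbrakk> \<Longrightarrow> f (x \<oplus>\<^bsub>M\<^esub> y) = f x \<oplus>\<^bsub>N\<^esub> f y"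
    and "\<And>r x. \<lbrakk>r \<in> carrier R; x \<in> carrier M\<rbrakk> \<Longrightarrow> f (r \<odot>\<^bsub>M\<^esub> x) = r \<odot>\<^bsub>N\<^esub> f x"
  shows "f \<in> mod_hom R M N"
  using assms by (auto simp: mod_hom_def)

lemma mod_hom_closed: "\<lbrakk>f \<in> mod_hom R M N; x \<in> carrier M\<rbrakk> \<Longrightarrow> f x \<in> carrier N"
  and mod_hom_add: "\<lbrakk>f \<in> mod_hom R M N; x \<in> carrier M; y \<in> carrier M\<rbrakk> \<Longrightarrow> f (x \<oplus>\<^bsub>M\<^esub> y) = f x \<oplus>\<^bsub>N\<^esub> f y"
  and mod_hom_smult: "\<lbrakk>f \<in> mod_hom R M N; r \<in> carrier R; x \<in> carrier M\<rbrakk> \<Longrightarrow> f (r \<odot>\<^bsub>M\<^esub> x) = r \<odot>\<^bsub>N\<^esub> f x"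
  by (auto simp: mod_hom_def)

lemma mod_hom_zero:
  assumes "left_module R M" "left_module R N" "f \<in> mod_hom R M N"
  shows "f \<zero>\<^bsub>M\<^esub> = \<zero>\<^bsub>N\<^esub>"
proof -
  interpret M: left_module R M by fact
  interpret N: left_module R N by fact
  have "f \<zero>\<^bsub>M\<^esub> \<oplus>\<^bsub>N\<^esub> f \<zero>\<^bsub>M\<^esub> = f \<zero>\<^bsub>M\<^esub>"
    using mod_hom_add[OF assms(3), of "\<zero>\<^bsub>M\<^esub>" "\<zero>\<^bsub>M\<^esub>"] by simp
  then show ?thesis
    using mod_hom_closed[OF assms(3), of "\<zero>\<^bsub>M\<^esub>"] by simp
qed

lemma mod_hom_uminus:
  assumes "left_module R M" "left_module R N" "f \<in> mod_hom R M N" "x \<in> carrier M"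
  shows "f (\<ominus>\<^bsub>M\<^esub> x) = \<ominus>\<^bsub>N\<^esub> f x"
proof -
  interpret M: left_module R M by fact
  interpret N: left_module R N by fact
  show ?thesis
    using mod_hom_smult[OF assms(3), of "\<ominus>\<^bsub>R\<^esub> \<one>\<^bsub>R\<^esub>" x] assms(4)
      M.smult_minus_one N.smult_minus_one mod_hom_closed[OF assms(3)] by simp
qed

lemma mod_hom_minus:
  assumes "left_module R M" "left_module R N" "f \<in> mod_hom R M N" "x \<in> carrier M" "y \<in> carrier M"
  shows "f (x \<ominus>\<^bsub>M\<^esub> y) = f x \<ominus>\<^bsub>N\<^esub> f y"
proof -
  interpret M: left_module R M by fact
  show ?thesis
    using assms mod_hom_uminus[OF assms(1-3)] mod_hom_add[OF assms(3)] by (simp add: a_minus_def)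
qed

lemma mod_hom_finsum:
  assumes "left_module R M" "left_module R N" "f \<in> mod_hom R M N"
    and "finite A" "g \<in> A \<rightarrow> carrier M"
  shows "f (finsum M g A) = (\<Oplus>\<^bsub>N\<^esub>i\<in>A. f (g i))"
proof -
  interpret M: left_module R M by fact
  interpret N: left_module R N by fact
  show ?thesis
    using assms(4,5)
  proof (induct A rule: finite_induct)
    case empty
    then show ?case using mod_hom_zero[OF assms(1-3)] by simp
  next
    case (insert a A)
    then show ?case
      using mod_hom_add[OF assms(3)] mod_hom_closed[OF assms(3)]
      by (subst M.finsum_insert) (auto simp: Pi_iff)
  qed
qed

lemma mod_hom_id: "(\<lambda>x. x) \<in> mod_hom R M M"
  by (auto simp: mod_hom_def)

lemma mod_hom_comp:
  assumes "f \<in> mod_hom R A B" "g \<in> mod_hom R B C"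
  shows "(\<lambda>x. g (f x)) \<in> mod_hom R A C"
  using assms by (auto simp: mod_hom_def Pi_iff)

lemma mod_hom_const_zero:
  assumes "left_module R N"
  shows "(\<lambda>_. \<zero>\<^bsub>N\<^esub>) \<in> mod_hom R M N"
proof -
  interpret N: left_module R N by fact
  show ?thesis by (rule mod_homI) auto
qed

lemma mod_hom_plus:
  assumes "left_module R N" "f \<in> mod_hom R M N" "g \<in> mod_hom R M N"
  shows "(\<lambda>x. f x \<oplus>\<^bsub>N\<^esub> g x) \<in> mod_hom R M N"
proof -
  interpret N: left_module R N by fact
  note h = mod_hom_closed mod_hom_add mod_hom_smult
  show ?thesis
    using assms(2,3) by (intro mod_homI) (auto simp: h[of f] h[of g] N.smult_r_distr N.M.a_ac)
qed

lemma mod_hom_neg: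
  assumes "left_module R N" "f \<in> mod_hom R M N"
  shows "(\<lambda>x. \<ominus>\<^bsub>N\<^esub> f x) \<in> mod_hom R M N"
proof -
  interpret N: left_module R N by fact
  note h = mod_hom_closed[OF assms(2)] mod_hom_add[OF assms(2)] mod_hom_smult[OF assms(2)]
  have "\<ominus>\<^bsub>N\<^esub> (r \<odot>\<^bsub>N\<^esub> y) = r \<odot>\<^bsub>N\<^esub> (\<ominus>\<^bsub>N\<^esub> y)" if "r \<in> carrier R" "y \<in> carrier N" for r y
  proof (rule N.minus_equality)
    show "r \<odot>\<^bsub>N\<^esub> (\<ominus>\<^bsub>N\<^esub> y) \<oplus>\<^bsub>N\<^esub> r \<odot>\<^bsub>N\<^esub> y = \<zero>\<^bsub>N\<^esub>"
      using that N.smult_r_distr[of r "\<ominus>\<^bsub>N\<^esub> y" y] by (simp add: N.M.l_neg)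
  qed (use that in auto)
  then show ?thesis
    by (intro mod_homI) (auto simp: h N.M.minus_add)
qed

lemma mod_hom_diff:
  assumes "left_module R N" "f \<in> mod_hom R M N" "g \<in> mod_hom R M N"
  shows "(\<lambda>x. f x \<ominus>\<^bsub>N\<^esub> g x) \<in> mod_hom R M N"
  unfolding a_minus_def
  by (intro mod_hom_plus mod_hom_neg assms)

lemma mod_hom_cong:
  assumes "left_module R M" "f \<in> mod_hom R M N" "\<And>x. x \<in> carrier M \<Longrightarrow> g x = f x"
  shows "g \<in> mod_hom R M N"
proof -
  interpret left_module R M by fact
  show ?thesis
    using assms(2) by (auto simp: mod_hom_def assms(3) Pi_iff)
qed

lemma submodule_image:
  assumes "left_module R M" "left_module R N" "f \<in> mod_hom R M N"
  shows "submodule (f ` carrier M) R N"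
proof -
  interpret M: left_module R M by fact
  have 1: "f x \<oplus>\<^bsub>N\<^esub> f y \<in> f ` carrier M" if "x \<in> carrier M" "y \<in> carrier M" for x y
    using that mod_hom_add[OF assms(3), of x y] by (metis M.M.a_closed imageI)
  have 2: "r \<odot>\<^bsub>N\<^esub> f x \<in> f ` carrier M" if "r \<in> carrier R" "x \<in> carrier M" for r x
    using that mod_hom_smult[OF assms(3), of r x] by (metis M.smult_closed imageI)
  have 3: "\<zero>\<^bsub>N\<^esub> \<in> f ` carrier M"
    using mod_hom_zero[OF assms] by (metis M.M.zero_closed imageI)
  show ?thesis
    using 1 2 3 by (intro left_submoduleI assms) (auto simp: mod_hom_closed[OF assms(3)])
qed

lemma submodule_vimage:
  assumes "left_module R M" "left_module R N" "f \<in> mod_hom R M N" "submodule H R N"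
  shows "submodule {x \<in> carrier M. f x \<in> H} R M"
proof -
  interpret M: left_module R M by fact
  show ?thesis
    using submoduleD[OF assms(4)]
    by (intro left_submoduleI assms)
       (auto simp: mod_hom_zero[OF assms(1-3)] mod_hom_add[OF assms(3)] mod_hom_smult[OF assms(3)])
qed

lemma submodule_zero: "left_module R M \<Longrightarrow> submodule {\<zero>\<^bsub>M\<^esub>} R M"
proof -
  assume "left_module R M"
  then interpret left_module R M .
  show ?thesis by (rule left_submoduleI) (auto intro: left_module_axioms)
qed

text \<open>
  Only the inclusion that is not implied by being a complex, for the term in degree \<open>Suc n\<close>.
\<close>

abbreviation exact_at :: "(nat \<Rightarrow> ('a, 'p) module) \<Rightarrow> (nat \<Rightarrow> 'p \<Rightarrow> 'p) \<Rightarrow> nat \<Rightarrow> bool" where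
  "exact_at P d n \<equiv> mod_ker (P (Suc n)) (P n) (d n) \<subseteq> d (Suc n) ` carrier (P (Suc (Suc n)))"

lemma submodule_mod_ker:
  assumes "left_module R M" "left_module R N" "f \<in> mod_hom R M N"
  shows "submodule (mod_ker M N f) R M"
  using submodule_vimage[OF assms submodule_zero[OF assms(2)]] by (simp add: mod_ker_def)

lemma mod_hom_sub_iff:
  "f \<in> mod_hom R A (M\<lparr>carrier := H\<rparr>) \<longleftrightarrow> (f \<in> mod_hom R A M \<and> f ` carrier A \<subseteq> H)"
  if "H \<subseteq> carrier M"
  using that by (auto simp: mod_hom_def)

lemma mod_hom_restrict_dom:
  "f \<in> mod_hom R M N \<Longrightarrow> H \<subseteq> carrier M \<Longrightarrow> f \<in> mod_hom R (M\<lparr>carrier := H\<rparr>) N"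
  by (rule mod_homI) (auto simp: subset_iff mod_hom_closed mod_hom_add mod_hom_smult)

section \<open>Functionals\<close>

lemma regular_module_simps [simp]:
  "carrier (regular_module R) = carrier R" "zero (regular_module R) = \<zero>\<^bsub>R\<^esub>"
  "add (regular_module R) = add R" "smult (regular_module R) = mult R"
  by (auto simp: regular_module_def)

lemma left_module_regular: "ring R \<Longrightarrow> left_module R (regular_module R)"
proof -
  assume "ring R"
  then interpret ring R .
  show ?thesis
    by (rule left_moduleI) (auto simp: a_ac l_distr r_distr m_assoc ring_axioms intro: bexI[of _ "\<ominus>\<^bsub>R\<^esub> x" for x] l_neg)
qed

lemma finsum_regular [simp]: "finsum (regular_module R) = finsum R"
  by (simp add: finsum_def fun_eq_iff finprod_def foldD_def regular_module_def)

lemma a_inv_regular [simp]: "a_inv (regular_module R) = a_inv R"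
  by (simp add: fun_eq_iff a_inv_def m_inv_def regular_module_def)

abbreviation functionals where "functionals R P \<equiv> mod_hom R P (regular_module R)"

text \<open>
  The homomorphisms obtained from a tuple of functionals and a tuple of elements. On a projective
  module these are all homomorphisms.
\<close>

lemma mod_hom_lincomb:
  assumes "left_module R A" "\<And>i. i < (n::nat) \<Longrightarrow> s i \<in> functionals R P" "\<And>i. i < n \<Longrightarrow> a i \<in> carrier A"
  shows "(\<lambda>x. \<Oplus>\<^bsub>A\<^esub>i\<in>{..<n}. s i x \<odot>\<^bsub>A\<^esub> a i) \<in> mod_hom R P A"
proof -
  interpret A: left_module R A by fact
  have s: "s i x \<in> carrier R" if "i < n" "x \<in> carrier P" for i x
    using mod_hom_closed[OF assms(2) that(2)] that by simp
  show ?thesis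
  proof (rule mod_homI)
    fix x y assume xy: "x \<in> carrier P" "y \<in> carrier P"
    have "(\<Oplus>\<^bsub>A\<^esub>i\<in>{..<n}. s i (x \<oplus>\<^bsub>P\<^esub> y) \<odot>\<^bsub>A\<^esub> a i) =
      (\<Oplus>\<^bsub>A\<^esub>i\<in>{..<n}. s i x \<odot>\<^bsub>A\<^esub> a i \<oplus>\<^bsub>A\<^esub> s i y \<odot>\<^bsub>A\<^esub> a i)"
      using xy assms(3) s by (intro A.M.finsum_cong') (auto simp: mod_hom_add[OF assms(2)] A.smult_l_distr)
    also have "\<dots> = (\<Oplus>\<^bsub>A\<^esub>i\<in>{..<n}. s i x \<odot>\<^bsub>A\<^esub> a i) \<oplus>\<^bsub>A\<^esub> (\<Oplus>\<^bsub>A\<^esub>i\<in>{..<n}. s i y \<odot>\<^bsub>A\<^esub> a i)"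
      using xy assms(3) s by (intro A.M.finsum_addf) auto
    finally show "(\<Oplus>\<^bsub>A\<^esub>i\<in>{..<n}. s i (x \<oplus>\<^bsub>P\<^esub> y) \<odot>\<^bsub>A\<^esub> a i) = \<dots>" .
  next
    fix r x assume rx: "r \<in> carrier R" "x \<in> carrier P"
    have "(\<Oplus>\<^bsub>A\<^esub>i\<in>{..<n}. s i (r \<odot>\<^bsub>P\<^esub> x) \<odot>\<^bsub>A\<^esub> a i) = (\<Oplus>\<^bsub>A\<^esub>i\<in>{..<n}. r \<odot>\<^bsub>A\<^esub> (s i x \<odot>\<^bsub>A\<^esub> a i))"
      using rx assms(3) s by (intro A.M.finsum_cong') (auto simp: mod_hom_smult[OF assms(2)] A.smult_assoc1)
    also have "\<dots> = r \<odot>\<^bsub>A\<^esub> (\<Oplus>\<^bsub>A\<^esub>i\<in>{..<n}. s i x \<odot>\<^bsub>A\<^esub> a i)"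
      using rx assms(3) s by (subst A.smult_finsum) auto
    finally show "(\<Oplus>\<^bsub>A\<^esub>i\<in>{..<n}. s i (r \<odot>\<^bsub>P\<^esub> x) \<odot>\<^bsub>A\<^esub> a i) = \<dots>" .
  qed (use assms(3) s in auto)
qed

lemma functional_closed: "\<lbrakk>f \<in> functionals R P; x \<in> carrier P\<rbrakk> \<Longrightarrow> f x \<in> carrier R"
  using mod_hom_closed[of f R P "regular_module R" x] by simp

lemma functional_add: "\<lbrakk>f \<in> functionals R P; x \<in> carrier P; y \<in> carrier P\<rbrakk> \<Longrightarrow> f (x \<oplus>\<^bsub>P\<^esub> y) = f x \<oplus>\<^bsub>R\<^esub> f y"
  using mod_hom_add[of f R P "regular_module R" x] by simp

lemma functional_zero: "\<lbrakk>left_module R P; f \<in> functionals R P\<rbrakk> \<Longrightarrow> f \<zero>\<^bsub>P\<^esub> = \<zero>\<^bsub>R\<^esub>"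
  using mod_hom_zero[of R P "regular_module R" f] left_module_regular left_moduleD(1) by fastforce

lemma functional_uminus: "\<lbrakk>left_module R P; f \<in> functionals R P; x \<in> carrier P\<rbrakk> \<Longrightarrow> f (\<ominus>\<^bsub>P\<^esub> x) = \<ominus>\<^bsub>R\<^esub> f x"
  using mod_hom_uminus[of R P "regular_module R" f x] left_module_regular left_moduleD(1) by fastforce

lemma functional_plus:
  "\<lbrakk>ring R; f \<in> functionals R P; g \<in> functionals R P\<rbrakk> \<Longrightarrow> (\<lambda>x. f x \<oplus>\<^bsub>R\<^esub> g x) \<in> functionals R P"
  using mod_hom_plus[OF left_module_regular, of R f P g] by simp

lemma functional_neg:
  "\<lbrakk>ring R; f \<in> functionals R P\<rbrakk> \<Longrightarrow> (\<lambda>x. \<ominus>\<^bsub>R\<^esub> f x) \<in> functionals R P"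
  using mod_hom_neg[OF left_module_regular, of R f P] by simp

section \<open>Free modules\<close>

text \<open>
  \<open>R\<^sup>n\<close>, with vectors continued by zero, so that all the \<open>R\<^sup>n\<close> share the type \<open>nat \<Rightarrow> 'a\<close>.
\<close>

definition free_module :: "('a, 'c) ring_scheme \<Rightarrow> nat \<Rightarrow> ('a, nat \<Rightarrow> 'a) module" where
  "free_module R n = \<lparr>carrier = {v. (\<forall>i<n. v i \<in> carrier R) \<and> (\<forall>i\<ge>n. v i = \<zero>\<^bsub>R\<^esub>)},
     mult = undefined, one = undefined, zero = (\<lambda>_. \<zero>\<^bsub>R\<^esub>),
     add = (\<lambda>u v i. u i \<oplus>\<^bsub>R\<^esub> v i), smult = (\<lambda>r v i. r \<otimes>\<^bsub>R\<^esub> v i)\<rparr>"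

definition unit_vec :: "('a, 'c) ring_scheme \<Rightarrow> nat \<Rightarrow> nat \<Rightarrow> 'a" where
  "unit_vec R i = (\<lambda>j. if i = j then \<one>\<^bsub>R\<^esub> else \<zero>\<^bsub>R\<^esub>)"

lemma free_module_simps [simp]:
  "zero (free_module R n) = (\<lambda>_. \<zero>\<^bsub>R\<^esub>)" "add (free_module R n) = (\<lambda>u v i. u i \<oplus>\<^bsub>R\<^esub> v i)"
  "smult (free_module R n) = (\<lambda>r v i. r \<otimes>\<^bsub>R\<^esub> v i)"
  by (simp_all add: free_module_def)

lemma free_module_coord:
  "ring R \<Longrightarrow> v \<in> carrier (free_module R n) \<Longrightarrow> v i \<in> carrier R"
  by (cases "i < n") (auto simp: free_module_def ring.ring_simprules)

lemma free_module_carrier: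
  assumes "ring R"
  shows "v \<in> carrier (free_module R n) \<longleftrightarrow> (\<forall>i. v i \<in> carrier R) \<and> (\<forall>i\<ge>n. v i = \<zero>\<^bsub>R\<^esub>)"
  using free_module_coord[OF assms] by (auto simp: free_module_def)

lemma left_module_free:
  assumes "ring R" shows "left_module R (free_module R n)"
proof -
  interpret ring R by fact
  note c = free_module_carrier[OF assms]
  show ?thesis
  proof (rule left_moduleI)
    fix x assume "x \<in> carrier (free_module R n)"
    then show "\<exists>y\<in>carrier (free_module R n). y \<oplus>\<^bsub>free_module R n\<^esub> x = \<zero>\<^bsub>free_module R n\<^esub>"
      by (intro bexI[of _ "\<lambda>i. \<ominus>\<^bsub>R\<^esub> x i"]) (auto simp: c l_neg)
  qed (simp_all add: c fun_eq_iff assms a_ac l_distr r_distr m_assoc)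
qed

lemma coord_functional: "ring R \<Longrightarrow> (\<lambda>v. v i) \<in> functionals R (free_module R n)"
  by (rule mod_homI) (auto simp: free_module_coord)

lemma unit_vec_free: "ring R \<Longrightarrow> i < n \<Longrightarrow> unit_vec R i \<in> carrier (free_module R n)"
  by (auto simp: free_module_carrier unit_vec_def ring.ring_simprules)

section \<open>Dual bases and projectivity\<close>

text \<open>
  A module with generators \<open>p\<close> and functionals \<open>s\<close> as here is a retract of \<open>R\<^sup>n\<close> via \<open>s\<close> and \<open>p\<close>.
\<close>

definition dual_basis ::
  "('a, 'c) ring_scheme \<Rightarrow> ('a, 'b) module \<Rightarrow> nat \<Rightarrow> (nat \<Rightarrow> 'b) \<Rightarrow> (nat \<Rightarrow> 'b \<Rightarrow> 'a) \<Rightarrow> bool" where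
  "dual_basis R P n p s \<longleftrightarrow> (\<forall>i<n. p i \<in> carrier P \<and> s i \<in> functionals R P) \<and>
     (\<forall>x\<in>carrier P. x = (\<Oplus>\<^bsub>P\<^esub>i\<in>{..<n}. s i x \<odot>\<^bsub>P\<^esub> p i))"

lemma dual_basis_free:
  assumes "ring R"
  shows "dual_basis R (free_module R n) n (unit_vec R) (\<lambda>i v. v i)"
  unfolding dual_basis_def
proof (intro conjI allI impI ballI)
  interpret ring R by fact
  interpret F: left_module R "free_module R n" by (rule left_module_free[OF assms])
  fix v assume v: "v \<in> carrier (free_module R n)"
  let ?w = "\<Oplus>\<^bsub>free_module R n\<^esub>i\<in>{..<n}. v i \<odot>\<^bsub>free_module R n\<^esub> unit_vec R i"
  note c = free_module_coord[OF assms]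
  have t: "(\<lambda>i. v i \<odot>\<^bsub>free_module R n\<^esub> unit_vec R i) \<in> {..<n} \<rightarrow> carrier (free_module R n)"
    using unit_vec_free[OF assms] c[OF v] by (intro Pi_I F.smult_closed) auto
  show "v = ?w"
  proof
    fix j
    show "v j = ?w j"
    proof (cases "j < n")
      case True
      have "?w j = (\<Oplus>\<^bsub>R\<^esub>i\<in>{..<n}. (v i \<odot>\<^bsub>free_module R n\<^esub> unit_vec R i) j)"
        using mod_hom_finsum[OF left_module_free[OF assms] left_module_regular[OF assms] coord_functional[OF assms] _ t]
        by simp
      also have "\<dots> = (\<Oplus>\<^bsub>R\<^esub>i\<in>{..<n}. if j = i then v i else \<zero>\<^bsub>R\<^esub>)"
        using c[OF v] by (intro finsum_cong') (auto simp: unit_vec_def)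
      also have "\<dots> = v j"
        using True c[OF v] by (intro finsum_singleton) auto
      finally show ?thesis by simp
    next
      case False
      have "?w \<in> carrier (free_module R n)"
        by (rule F.M.finsum_closed[OF t])
      then show ?thesis using False v by (simp add: free_module_def)
    qed
  qed
qed (auto intro: unit_vec_free coord_functional assms)

lemma dual_basisD:
  assumes "dual_basis R P n p s"
  shows "i < n \<Longrightarrow> p i \<in> carrier P" "i < n \<Longrightarrow> s i \<in> functionals R P"
    "i < n \<Longrightarrow> x \<in> carrier P \<Longrightarrow> s i x \<in> carrier R"
    "x \<in> carrier P \<Longrightarrow> (\<Oplus>\<^bsub>P\<^esub>i\<in>{..<n}. s i x \<odot>\<^bsub>P\<^esub> p i) = x"
proof -
  have *: "i < n \<Longrightarrow> p i \<in> carrier P \<and> s i \<in> functionals R P" for i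
    using assms unfolding dual_basis_def by blast
  then show "i < n \<Longrightarrow> p i \<in> carrier P" "i < n \<Longrightarrow> s i \<in> functionals R P" by blast+
  show "i < n \<Longrightarrow> x \<in> carrier P \<Longrightarrow> s i x \<in> carrier R"
    using mod_hom_closed[OF conjunct2[OF *]] by fastforce
  show "x \<in> carrier P \<Longrightarrow> (\<Oplus>\<^bsub>P\<^esub>i\<in>{..<n}. s i x \<odot>\<^bsub>P\<^esub> p i) = x"
    by (rule sym, rule bspec[OF conjunct2[OF assms[unfolded dual_basis_def]]])
qed

text \<open>
  Choose preimages of the elements \<open>f (p i)\<close> and combine them linearly with coefficients \<open>s i\<close>. This
  produces lifts for modules on arbitrary types, whereas projectivity is stated for one type only.
\<close>

lemma dual_basis_lift:
  assumes "dual_basis R P n p s" "left_module R P" "left_module R A" "left_module R B"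
    and f: "f \<in> mod_hom R P B" and g: "g \<in> mod_hom R A B"
    and im: "f ` carrier P \<subseteq> g ` carrier A"
  shows "\<exists>h\<in>mod_hom R P A. \<forall>x\<in>carrier P. g (h x) = f x"
proof -
  interpret P: left_module R P by fact
  interpret A: left_module R A by fact
  note ps = dual_basisD(1,2)[OF assms(1)] and sc = dual_basisD(3)[OF assms(1)]
  have "\<exists>a. a \<in> carrier A \<and> g a = f (p i)" if "i < n" for i
  proof -
    have "f (p i) \<in> g ` carrier A" using im ps(1)[OF that] by blast
    then show ?thesis by (metis imageE)
  qed
  then obtain a where a: "\<And>i. i < n \<Longrightarrow> a i \<in> carrier A \<and> g (a i) = f (p i)"
    by metis
  let ?h = "\<lambda>x. \<Oplus>\<^bsub>A\<^esub>i\<in>{..<n}. s i x \<odot>\<^bsub>A\<^esub> a i"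
  have h: "?h \<in> mod_hom R P A"
    by (rule mod_hom_lincomb[OF assms(3)]) (use ps a in auto)
  have gh: "g (?h x) = f x" if x: "x \<in> carrier P" for x
  proof -
    interpret B: left_module R B by fact
    have fp: "f (p i) \<in> carrier B" if "i < n" for i
      using mod_hom_closed[OF f ps(1)] that by auto
    have "g (?h x) = (\<Oplus>\<^bsub>B\<^esub>i\<in>{..<n}. g (s i x \<odot>\<^bsub>A\<^esub> a i))"
      using x a sc by (intro mod_hom_finsum[OF assms(3,4) g]) auto
    also have "\<dots> = (\<Oplus>\<^bsub>B\<^esub>i\<in>{..<n}. f (s i x \<odot>\<^bsub>P\<^esub> p i))"
      using x a sc ps fp by (intro B.M.finsum_cong') (auto simp: mod_hom_smult[OF g] mod_hom_smult[OF f])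
    also have "\<dots> = f (\<Oplus>\<^bsub>P\<^esub>i\<in>{..<n}. s i x \<odot>\<^bsub>P\<^esub> p i)"
      using x sc ps by (intro mod_hom_finsum[OF assms(2,4) f finite_lessThan, symmetric] Pi_I P.smult_closed) simp_all
    also have "\<dots> = f x"
      by (simp only: dual_basisD(4)[OF assms(1) x])
    finally show ?thesis .
  qed
  show ?thesis
    by (rule bexI[OF _ h], rule ballI, rule gh)
qed

lemma finitely_generated_image:
  assumes "left_module R M" "left_module R N" "f \<in> mod_hom R M N" "f ` carrier M = carrier N"
    and "finitely_generated R M"
  shows "finitely_generated R N"
proof -
  obtain A where A: "finite A" "A \<subseteq> carrier M" "\<And>H. submodule H R M \<Longrightarrow> A \<subseteq> H \<Longrightarrow> H = carrier M"
    using assms(5) by (auto simp: finitely_generated_def)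
  show ?thesis
    unfolding finitely_generated_def
  proof (intro exI[of _ "f ` A"] conjI allI impI)
    fix H assume H: "submodule H R N \<and> f ` A \<subseteq> H"
    then have "{x \<in> carrier M. f x \<in> H} = carrier M"
      using A(2) H by (intro A(3) submodule_vimage[OF assms(1-3)]) auto
    then have "carrier N \<subseteq> H" unfolding assms(4)[symmetric] by blast
    then show "H = carrier N"
      using submoduleD(1)[OF conjunct1[OF H]] by (rule subset_antisym[rotated])
  qed (use A assms(4) in auto)
qed

text \<open>The map \<open>R\<^sup>n \<rightarrow> M\<close> that sends the unit vectors to \<open>p\<close>.\<close>

definition lincomb :: "('a, 'b) module \<Rightarrow> nat \<Rightarrow> (nat \<Rightarrow> 'b) \<Rightarrow> (nat \<Rightarrow> 'a) \<Rightarrow> 'b" where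
  "lincomb M n p v = (\<Oplus>\<^bsub>M\<^esub>i\<in>{..<n}. v i \<odot>\<^bsub>M\<^esub> p i)"

lemma lincomb_hom:
  assumes "left_module R M" "\<And>i. i < n \<Longrightarrow> p i \<in> carrier M"
  shows "lincomb M n p \<in> mod_hom R (free_module R n) M"
  unfolding lincomb_def
  using assms coord_functional[OF left_moduleD(1)[OF assms(1)]]
  by (intro mod_hom_lincomb) auto

lemma lincomb_unit:
  assumes "left_module R M" "\<And>i. i < n \<Longrightarrow> p i \<in> carrier M" "i < n"
  shows "lincomb M n p (unit_vec R i) = p i"
proof -
  interpret left_module R M by fact
  have "lincomb M n p (unit_vec R i) = (\<Oplus>\<^bsub>M\<^esub>j\<in>{..<n}. if i = j then p j else \<zero>\<^bsub>M\<^esub>)"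
    unfolding lincomb_def
    using assms by (intro M.finsum_cong') (auto simp: unit_vec_def)
  also have "\<dots> = p i"
    using assms by (intro M.finsum_singleton) auto
  finally show ?thesis .
qed

text \<open>
  The image of the map given by a tuple is the smallest submodule that contains the tuple.
\<close>

lemma finitely_generated_iff:
  assumes "left_module R M"
  shows "finitely_generated R M \<longleftrightarrow>
    (\<exists>n p. (\<forall>i<n. p i \<in> carrier M) \<and> lincomb M n p ` carrier (free_module R n) = carrier M)"
proof
  assume "finitely_generated R M"
  then obtain A where A: "finite A" "A \<subseteq> carrier M" "\<And>H. submodule H R M \<Longrightarrow> A \<subseteq> H \<Longrightarrow> H = carrier M"
    by (auto simp: finitely_generated_def)
  obtain p where p: "bij_betw p {0..<card A} A"
    using ex_bij_betw_nat_finite[OF A(1)] by blast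
  then have pA: "p i \<in> A" if "i < card A" for i
    using that by (auto simp: bij_betw_def)
  then have pc: "p i \<in> carrier M" if "i < card A" for i
    using that A(2) by auto
  let ?I = "lincomb M (card A) p ` carrier (free_module R (card A))"
  have R: "ring R" using assms by (rule left_moduleD)
  have "submodule ?I R M"
    by (rule submodule_image[OF left_module_free[OF R] assms lincomb_hom[OF assms pc]])
  moreover have "A \<subseteq> ?I"
  proof
    fix a assume "a \<in> A"
    then obtain i where i: "i < card A" and a: "a = p i"
      using p unfolding bij_betw_def by (metis atLeastLessThan_iff imageE)
    have "lincomb M (card A) p (unit_vec R i) = p i"
      by (rule lincomb_unit[OF assms _ i]) (rule pc)
    then show "a \<in> ?I"
      unfolding a by (rule image_eqI[OF sym unit_vec_free[OF R i]])
  qed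
  ultimately have "?I = carrier M" by (rule A(3))
  then show "\<exists>n p. (\<forall>i<n. p i \<in> carrier M) \<and> lincomb M n p ` carrier (free_module R n) = carrier M"
    using pc by blast
next
  assume "\<exists>n p. (\<forall>i<n. p i \<in> carrier M) \<and> lincomb M n p ` carrier (free_module R n) = carrier M"
  then obtain n p where p: "\<And>i. i < n \<Longrightarrow> p i \<in> carrier M"
    and I: "lincomb M n p ` carrier (free_module R n) = carrier M" by blast
  interpret left_module R M by fact
  show "finitely_generated R M"
    unfolding finitely_generated_def
  proof (intro exI[of _ "p ` {..<n}"] conjI allI impI)
    fix H assume H: "submodule H R M \<and> p ` {..<n} \<subseteq> H"
    note HD = submoduleD[OF conjunct1[OF H]]
    interpret H: left_module R "M\<lparr>carrier := H\<rparr>"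
      by (rule left_module_submodule[OF assms conjunct1[OF H]])
    have "lincomb M n p v \<in> H" if v: "v \<in> carrier (free_module R n)" for v
    proof -
      have "lincomb (M\<lparr>carrier := H\<rparr>) n p \<in> mod_hom R (free_module R n) (M\<lparr>carrier := H\<rparr>)"
        using H by (intro lincomb_hom H.left_module_axioms) auto
      then have 1: "lincomb (M\<lparr>carrier := H\<rparr>) n p v \<in> H"
        using mod_hom_closed[OF _ v] by fastforce
      have "(\<lambda>x. x) \<in> mod_hom R (M\<lparr>carrier := H\<rparr>) M"
        using HD(1) by (intro mod_hom_restrict_dom mod_hom_id)
      then have "lincomb (M\<lparr>carrier := H\<rparr>) n p v = (\<Oplus>\<^bsub>M\<^esub>i\<in>{..<n}. v i \<odot>\<^bsub>M\<^esub> p i)"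
        unfolding lincomb_def
        using v H HD(4) free_module_coord[OF left_moduleD(1)[OF assms] v]
        by (subst mod_hom_finsum[OF H.left_module_axioms assms, of "\<lambda>x. x"]) auto
      with 1 show ?thesis by (simp add: lincomb_def)
    qed
    then have "lincomb M n p ` carrier (free_module R n) \<subseteq> H" by blast
    then show "H = carrier M" unfolding I by (rule subset_antisym[OF HD(1)])
  qed (use p in auto)
qed

text \<open>Transport of structure along an injection; used to move a module to a prescribed type.\<close>

definition copy_module :: "('b \<Rightarrow> 'c) \<Rightarrow> ('a, 'b) module \<Rightarrow> ('a, 'c) module" where
  "copy_module j M = (let k = inv_into (carrier M) j in
     \<lparr>carrier = j ` carrier M, mult = undefined, one = undefined, zero = j \<zero>\<^bsub>M\<^esub>,
      add = (\<lambda>x y. j (k x \<oplus>\<^bsub>M\<^esub> k y)), smult = (\<lambda>r x. j (r \<odot>\<^bsub>M\<^esub> k x))\<rparr>)"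

lemma copy_module:
  assumes "left_module R M" "inj_on j (carrier M)"
  shows "left_module R (copy_module j M)"
    and "j \<in> mod_hom R M (copy_module j M)"
    and "inv_into (carrier M) j \<in> mod_hom R (copy_module j M) M"
    and "j ` carrier M = carrier (copy_module j M)"
    and "inv_into (carrier M) j ` carrier (copy_module j M) = carrier M"
proof -
  interpret left_module R M by fact
  note [simp] = inv_into_f_f[OF assms(2)]
  note C = copy_module_def Let_def
  show 1: "left_module R (copy_module j M)"
  proof (rule left_moduleI)
    fix x assume "x \<in> carrier (copy_module j M)"
    then obtain y where y: "y \<in> carrier M" "x = j y" by (auto simp: C)
    then show "\<exists>y\<in>carrier (copy_module j M). y \<oplus>\<^bsub>copy_module j M\<^esub> x = \<zero>\<^bsub>copy_module j M\<^esub>"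
      by (intro bexI[of _ "j (\<ominus>\<^bsub>M\<^esub> y)"]) (auto simp: C M.l_neg)
  qed (auto simp: C left_moduleD(1)[OF assms(1)] M.a_ac smult_l_distr smult_r_distr smult_assoc1)
  show "j \<in> mod_hom R M (copy_module j M)" by (rule mod_homI) (auto simp: C)
  show "inv_into (carrier M) j \<in> mod_hom R (copy_module j M) M" by (rule mod_homI) (auto simp: C)
  show 4: "j ` carrier M = carrier (copy_module j M)" by (auto simp: C)
  show "inv_into (carrier M) j ` carrier (copy_module j M) = carrier M"
    using assms(2) by (force simp: C)
qed

lemma dual_basis_retract:
  assumes "dual_basis R P n p s" "left_module R P" "left_module R Q"
    and "i \<in> mod_hom R Q P" "q \<in> mod_hom R P Q" "\<And>x. x \<in> carrier Q \<Longrightarrow> q (i x) = x"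
  shows "dual_basis R Q n (\<lambda>k. q (p k)) (\<lambda>k x. s k (i x))"
proof -
  interpret P: left_module R P by fact
  interpret Q: left_module R Q by fact
  note ps = dual_basisD(1,2)[OF assms(1)] and sc = dual_basisD(3)[OF assms(1)]
  show ?thesis
    unfolding dual_basis_def
  proof (intro conjI allI impI ballI)
    fix x assume x: "x \<in> carrier Q"
    then have ix: "i x \<in> carrier P" using mod_hom_closed[OF assms(4)] by auto
    have "x = q (\<Oplus>\<^bsub>P\<^esub>k\<in>{..<n}. s k (i x) \<odot>\<^bsub>P\<^esub> p k)"
      using assms(6) x by (simp only: dual_basisD(4)[OF assms(1) ix])
    also have "\<dots> = (\<Oplus>\<^bsub>Q\<^esub>k\<in>{..<n}. q (s k (i x) \<odot>\<^bsub>P\<^esub> p k))"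
      using ix sc ps by (intro mod_hom_finsum[OF assms(2,3,5)]) auto
    also have "\<dots> = (\<Oplus>\<^bsub>Q\<^esub>k\<in>{..<n}. s k (i x) \<odot>\<^bsub>Q\<^esub> q (p k))"
      using ix sc ps mod_hom_closed[OF assms(5)]
      by (intro Q.M.finsum_cong') (auto simp: mod_hom_smult[OF assms(5)])
    finally show "x = \<dots>" .
  next
    fix k assume "k < n"
    then show "q (p k) \<in> carrier Q" "(\<lambda>x. s k (i x)) \<in> functionals R Q"
      by (rule mod_hom_closed[OF assms(5) ps(1)], rule mod_hom_comp[OF assms(4) ps(2)])
  qed
qed

lemma dual_basis_fg:
  assumes "dual_basis R P n p s" "left_module R P"
  shows "finitely_generated R P"
  unfolding finitely_generated_iff[OF assms(2)]
proof (intro exI conjI allI impI)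
  have R: "ring R" using assms(2) by (rule left_moduleD)
  show p: "p i \<in> carrier P" if "i < n" for i using that by (rule dual_basisD(1)[OF assms(1)])
  show "lincomb P n p ` carrier (free_module R n) = carrier P"
  proof
    show "lincomb P n p ` carrier (free_module R n) \<subseteq> carrier P"
      using mod_hom_closed[OF lincomb_hom[OF assms(2) p]] by auto
    show "carrier P \<subseteq> lincomb P n p ` carrier (free_module R n)"
    proof
      fix x assume x: "x \<in> carrier P"
      let ?v = "\<lambda>i. if i < n then s i x else \<zero>\<^bsub>R\<^esub>"
      interpret left_module R P by fact
      have sx: "s i x \<in> carrier R" if "i < n" for i
        using that x by (rule dual_basisD(3)[OF assms(1)])
      then have v: "?v \<in> carrier (free_module R n)" by (auto simp: free_module_carrier[OF R])
      have "lincomb P n p ?v = (\<Oplus>\<^bsub>P\<^esub>i\<in>{..<n}. s i x \<odot>\<^bsub>P\<^esub> p i)"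
        unfolding lincomb_def using sx p by (intro M.finsum_cong') auto
      also have "\<dots> = x" by (rule dual_basisD(4)[OF assms(1) x])
      finally have "lincomb P n p ?v = x" .
      then show "x \<in> lincomb P n p ` carrier (free_module R n)" by (rule image_eqI[OF sym v])
    qed
  qed
qed

lemma fg_projectiveD:
  fixes A B :: "'a umodule" and R :: "('a, 'c) ring_scheme"
  assumes "fg_projective R P" "g \<in> mod_hom R A B" "f \<in> mod_hom R P B" "fg_module R A" "fg_module R B"
    "g ` carrier A = carrier B"
  shows "\<exists>h\<in>mod_hom R P A. \<forall>x\<in>carrier P. g (h x) = f x"
  using assms unfolding fg_projective_def by blast

text \<open>
  The dual basis criterion. If \<open>P\<close> has the lifting property, the identity of \<open>P\<close> is lifted along an
  epimorphism \<open>R\<^sup>n \<rightarrow> P\<close>. The lifting property only speaks about modules whose elements are sets of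
  vectors, so \<open>R\<^sup>n\<close> is copied by \<open>v \<mapsto> {v}\<close> and \<open>P\<close> by sending an element to its fibre in \<open>R\<^sup>n\<close>.
\<close>

lemma fg_projective_iff:
  "fg_projective R P \<longleftrightarrow> left_module R P \<and> (\<exists>n p s. dual_basis R P n p s)"
proof (intro iffI conjI)
  assume "left_module R P \<and> (\<exists>n p s. dual_basis R P n p s)"
  then obtain n p s where "left_module R P" "dual_basis R P n p s" by blast
  note L = this
  have "\<exists>h\<in>mod_hom R P A. \<forall>x\<in>carrier P. g (h x) = f x"
    if "left_module R A" "left_module R B" "g \<in> mod_hom R A B" "f \<in> mod_hom R P B"
      "g ` carrier A = carrier B" for A B :: "'a umodule" and g f
    using dual_basis_lift[OF L(2,1) that(1,2,4,3)] mod_hom_closed[OF that(4)] that(5) by blast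
  then show "fg_projective R P"
    unfolding fg_projective_def fg_module_def
    by (intro conjI allI ballI impI L dual_basis_fg[OF L(2,1)]) auto
next
  assume P: "fg_projective R P"
  then show LP: "left_module R P" by (auto simp: fg_projective_def fg_module_def)
  then have R: "ring R" by (rule left_moduleD)
  from P have "finitely_generated R P" by (auto simp: fg_projective_def fg_module_def)
  then obtain n p where p: "\<And>i. i < n \<Longrightarrow> p i \<in> carrier P"
    and I: "lincomb P n p ` carrier (free_module R n) = carrier P"
    using finitely_generated_iff[OF LP] by blast
  let ?F = "free_module R n" and ?e = "lincomb P n p"
  note LF = left_module_free[OF R, of n]
  have e: "?e \<in> mod_hom R ?F P" by (rule lincomb_hom[OF LP]) (rule p)
  let ?a = "\<lambda>v :: nat \<Rightarrow> 'a. {v}" and ?b = "\<lambda>x. {v \<in> carrier ?F. ?e v = x}"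
  have ja: "inj_on ?a (carrier ?F)" by (auto simp: inj_on_def)
  have jb: "inj_on ?b (carrier P)"
  proof (rule inj_onI)
    fix x y assume xy: "x \<in> carrier P" "y \<in> carrier P" "?b x = ?b y"
    from xy(1) obtain v where v: "v \<in> carrier ?F" "x = ?e v"
      unfolding I[symmetric] by (rule imageE)
    then have "v \<in> ?b x" by simp
    then have "v \<in> ?b y" by (simp only: xy(3))
    then show "x = y" using v by simp
  qed
  let ?A = "copy_module ?a ?F" and ?B = "copy_module ?b P"
  note A = copy_module[OF LF ja] and B = copy_module[OF LP jb]
  let ?k = "inv_into (carrier ?F) ?a"
  let ?g = "\<lambda>x. ?b (?e (?k x))"
  have g: "?g \<in> mod_hom R ?A ?B"
    by (rule mod_hom_comp[OF mod_hom_comp[OF A(3) e] B(2)])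
  have "?g ` carrier ?A = ?b ` ?e ` ?k ` carrier ?A"
    by (simp only: image_image)
  also have "\<dots> = carrier ?B"
    unfolding A(5) I B(4) ..
  finally have gim: "?g ` carrier ?A = carrier ?B" .
  have "finitely_generated R ?F" by (rule dual_basis_fg[OF dual_basis_free[OF R] LF])
  then have fgA: "fg_module R ?A"
    using finitely_generated_image[OF LF A(1,2,4)] A(1) by (auto simp: fg_module_def)
  have fgB: "fg_module R ?B"
    using finitely_generated_image[OF LP B(1,2,4)] B(1) \<open>finitely_generated R P\<close> by (auto simp: fg_module_def)
  obtain h where h: "h \<in> mod_hom R P ?A" "\<forall>x\<in>carrier P. ?g (h x) = ?b x"
    using fg_projectiveD[OF P g B(2) fgA fgB gim] by (rule bexE)
  have eh: "?e (?k (h x)) = x" if "x \<in> carrier P" for x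
  proof (rule inj_onD[OF jb])
    show "?b (?e (?k (h x))) = ?b x" by (rule bspec[OF h(2) that])
    show "?e (?k (h x)) \<in> carrier P"
      using mod_hom_closed[OF mod_hom_comp[OF mod_hom_comp[OF h(1) A(3)] e] that] .
  qed (rule that)
  show "\<exists>n p s. dual_basis R P n p s"
    by (intro exI, rule dual_basis_retract[OF dual_basis_free[OF R] LF LP mod_hom_comp[OF h(1) A(3)] e]) (rule eh)
qed

lemma fg_projective_left_module: "fg_projective R P \<Longrightarrow> left_module R P"
  by (simp add: fg_projective_iff)

lemma fg_projective_lift:
  assumes "fg_projective R P" "left_module R A" "left_module R B"
    and "f \<in> mod_hom R P B" "g \<in> mod_hom R A B" "f ` carrier P \<subseteq> g ` carrier A"
  shows "\<exists>h\<in>mod_hom R P A. \<forall>x\<in>carrier P. g (h x) = f x"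
  using assms(1) dual_basis_lift[OF _ _ assms(2-6)] by (auto simp: fg_projective_iff)

lemma fg_projective_retract:
  assumes "fg_projective R P" "left_module R Q"
    and "i \<in> mod_hom R Q P" "q \<in> mod_hom R P Q" "\<And>x. x \<in> carrier Q \<Longrightarrow> q (i x) = x"
  shows "fg_projective R Q"
  using assms(1) dual_basis_retract[OF _ _ assms(2-5)] assms(2) unfolding fg_projective_iff by blast

lemma fg_projective_free: "ring R \<Longrightarrow> fg_projective R (free_module R n)"
  using dual_basis_free left_module_free unfolding fg_projective_iff by blast

text \<open>
  The coordinates \<open>s i x\<close> embed \<open>P\<close> into \<open>R\<^sup>n\<close>. Hence all constructions with projectives, such as direct
  sums, can be carried out within the type \<open>nat \<Rightarrow> 'a\<close>, which is where resolutions live.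
\<close>

lemma fg_projective_copy:
  assumes "fg_projective R P"
  obtains Q :: "('a, nat \<Rightarrow> 'a) module" and f g where "fg_projective (R :: ('a,'c) ring_scheme) Q"
    "f \<in> mod_hom R P Q" "g \<in> mod_hom R Q P"
    "\<And>x. x \<in> carrier P \<Longrightarrow> g (f x) = x" "\<And>y. y \<in> carrier Q \<Longrightarrow> f (g y) = y"
proof -
  obtain n p s where b: "dual_basis R P n p s" and P: "left_module R P"
    using assms by (auto simp: fg_projective_iff)
  interpret left_module R P by fact
  let ?j = "\<lambda>x i. if i < n then s i x else \<zero>\<^bsub>R\<^esub>"
  have "inj_on ?j (carrier P)"
  proof (rule inj_onI)
    fix x y assume xy: "x \<in> carrier P" "y \<in> carrier P" "?j x = ?j y"
    have s: "s i x = s i y" if "i < n" for i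
      using fun_cong[OF xy(3), of i] that by simp
    have c: "s i y \<in> carrier R" "p i \<in> carrier P" if "i < n" for i
      using that xy(2) by (auto simp: dual_basisD[OF b])
    have "x = (\<Oplus>\<^bsub>P\<^esub>i\<in>{..<n}. s i x \<odot>\<^bsub>P\<^esub> p i)" by (simp only: dual_basisD(4)[OF b xy(1)])
    also have "\<dots> = (\<Oplus>\<^bsub>P\<^esub>i\<in>{..<n}. s i y \<odot>\<^bsub>P\<^esub> p i)"
      using s c by (intro M.finsum_cong') auto
    also have "\<dots> = y" by (simp only: dual_basisD(4)[OF b xy(2)])
    finally show "x = y" .
  qed
  note C = copy_module[OF P this]
  show thesis
  proof (rule that[OF _ C(2,3)])
    show "fg_projective R (copy_module ?j P)"
      by (rule fg_projective_retract[OF assms C(1) C(3) C(2)])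
         (rule f_inv_into_f, simp add: C(4))
    show "inv_into (carrier P) ?j (?j x) = x" if "x \<in> carrier P" for x
      by (rule inv_into_f_f[OF \<open>inj_on ?j (carrier P)\<close> that])
    show "?j (inv_into (carrier P) ?j y) = y" if "y \<in> carrier (copy_module ?j P)" for y
      using that by (intro f_inv_into_f) (simp add: C(4))
  qed
qed

lemma functionals_separate:
  assumes "fg_projective R P" "x \<in> carrier P" "\<And>f. f \<in> functionals R P \<Longrightarrow> f x = \<zero>\<^bsub>R\<^esub>"
  shows "x = \<zero>\<^bsub>P\<^esub>"
proof -
  obtain n p s where b: "dual_basis R P n p s" and P: "left_module R P"
    using assms(1) by (auto simp: fg_projective_iff)
  interpret P: left_module R P by fact
  have "(\<Oplus>\<^bsub>P\<^esub>i\<in>{..<n}. s i x \<odot>\<^bsub>P\<^esub> p i) = (\<Oplus>\<^bsub>P\<^esub>i\<in>{..<n}. \<zero>\<^bsub>P\<^esub>)"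
    using assms(3)[OF dual_basisD(2)[OF b]] dual_basisD(1)[OF b]
    by (intro P.finsum_cong') auto
  then show ?thesis using dual_basisD(4)[OF b assms(2)] by simp
qed

text \<open>
  A map to a projective module factors as soon as its coordinates do. In this way exactness of
  \<open>Hom(P, R)\<close> yields exactness of \<open>Hom(P, N)\<close> for every finitely generated projective \<open>N\<close>.
\<close>

lemma factor_through_of_functionals:
  assumes "fg_projective R N" "f \<in> mod_hom R A N" "d \<in> mod_hom R A B"
    and ex: "\<And>s. s \<in> functionals R N \<Longrightarrow> \<exists>g\<in>functionals R B. \<forall>x\<in>carrier A. s (f x) = g (d x)"
  shows "\<exists>g\<in>mod_hom R B N. \<forall>x\<in>carrier A. f x = g (d x)"
proof -
  obtain n p s where b: "dual_basis R N n p s" and N: "left_module R N"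
    using assms(1) by (auto simp: fg_projective_iff)
  interpret N: left_module R N by fact
  note bb = dual_basisD[OF b]
  have "\<exists>g. g \<in> functionals R B \<and> (\<forall>x\<in>carrier A. s i (f x) = g (d x))" if "i < n" for i
    using ex[OF bb(2)[OF that]] by (auto simp: Bex_def)
  then obtain g where g: "\<And>i. i < n \<Longrightarrow> g i \<in> functionals R B" "\<And>i. i < n \<Longrightarrow> \<forall>x\<in>carrier A. s i (f x) = g i (d x)"
    by metis
  show ?thesis
  proof (rule bexI, rule ballI)
    show "(\<lambda>y. \<Oplus>\<^bsub>N\<^esub>i\<in>{..<n}. g i y \<odot>\<^bsub>N\<^esub> p i) \<in> mod_hom R B N"
      by (rule mod_hom_lincomb[OF N g(1) bb(1)])
    fix x assume x: "x \<in> carrier A"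
    have fx: "f x \<in> carrier N" by (rule mod_hom_closed[OF assms(2) x])
    have "f x = (\<Oplus>\<^bsub>N\<^esub>i\<in>{..<n}. s i (f x) \<odot>\<^bsub>N\<^esub> p i)" by (simp only: bb(4)[OF fx])
    also have "\<dots> = (\<Oplus>\<^bsub>N\<^esub>i\<in>{..<n}. g i (d x) \<odot>\<^bsub>N\<^esub> p i)"
      using x functional_closed[OF g(1) mod_hom_closed[OF assms(3) x]] bb(1)
      by (intro N.finsum_cong') (auto simp: bspec[OF g(2) x])
    finally show "f x = \<dots>" .
  qed
qed

section \<open>Submodules over a noetherian ring\<close>

text \<open>
  Finite generation of a submodule \<open>N\<close> tested against submodules of \<open>M\<close> rather than of \<open>N\<close>.
\<close>

definition fg_subset :: "('a, 'c) ring_scheme \<Rightarrow> ('a, 'b) module \<Rightarrow> 'b set \<Rightarrow> bool" where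
  "fg_subset R M N \<longleftrightarrow> (\<exists>A. finite A \<and> A \<subseteq> N \<and> (\<forall>H. submodule H R M \<and> A \<subseteq> H \<longrightarrow> N \<subseteq> H))"

lemma fg_subsetE:
  assumes "fg_subset R M N"
  obtains A where "finite A" "A \<subseteq> N" "\<And>H. submodule H R M \<Longrightarrow> A \<subseteq> H \<Longrightarrow> N \<subseteq> H"
proof -
  from assms obtain A where "finite A \<and> A \<subseteq> N \<and> (\<forall>H. submodule H R M \<and> A \<subseteq> H \<longrightarrow> N \<subseteq> H)"
    unfolding fg_subset_def by (rule exE)
  then show thesis by (intro that[of A]) auto
qed

lemma submodule_Int:
  assumes "left_module R M" "submodule H R M" "submodule N R M"
  shows "submodule (H \<inter> N) R M"
  using submoduleD[OF assms(2)] submoduleD[OF assms(3)] by (intro left_submoduleI[OF assms(1)]) auto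

lemma finitely_generated_submodule_iff:
  assumes "left_module R M" "submodule N R M"
  shows "finitely_generated R (M\<lparr>carrier := N\<rparr>) \<longleftrightarrow> fg_subset R M N"
proof
  assume "finitely_generated R (M\<lparr>carrier := N\<rparr>)"
  then obtain A where A: "finite A" "A \<subseteq> N" "\<And>H. submodule H R M \<Longrightarrow> H \<subseteq> N \<Longrightarrow> A \<subseteq> H \<Longrightarrow> H = N"
    unfolding finitely_generated_def submodule_in_submodule[OF assms] by auto
  show "fg_subset R M N"
    unfolding fg_subset_def
  proof (intro exI[of _ A] conjI allI impI A(1,2))
    fix H assume H: "submodule H R M \<and> A \<subseteq> H"
    have "H \<inter> N = N"
      using H A(2) by (intro A(3) submodule_Int[OF assms(1) _ assms(2)]) auto
    then show "N \<subseteq> H" by blast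
  qed
next
  assume fgN: "fg_subset R M N"
  obtain A where A: "finite A" "A \<subseteq> N" "\<And>H. submodule H R M \<Longrightarrow> A \<subseteq> H \<Longrightarrow> N \<subseteq> H"
    by (rule fg_subsetE[OF fgN]) (rule that, assumption, assumption, elim meta_allE meta_impE)
  show "finitely_generated R (M\<lparr>carrier := N\<rparr>)"
    unfolding finitely_generated_def submodule_in_submodule[OF assms]
    by (rule exI[of _ A]) (simp add: A subset_antisym)
qed

text \<open>
  The left ideal of the coefficients of \<open>m\<close> that occur in elements of \<open>N\<close>, modulo \<open>U\<close>.
\<close>

lemma submodule_colon:
  assumes "left_module R M" "submodule U R M" "submodule N R M" "m \<in> carrier M"
  shows "submodule {r \<in> carrier R. \<exists>u\<in>U. u \<oplus>\<^bsub>M\<^esub> r \<odot>\<^bsub>M\<^esub> m \<in> N} R (regular_module R)"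
    (is "submodule ?I R _")
proof -
  interpret left_module R M by fact
  note U = submoduleD[OF assms(2)] and N = submoduleD[OF assms(3)]
  have Uc: "u \<in> carrier M" if "u \<in> U" for u using U(1) that by auto
  show ?thesis
  proof (rule left_submoduleI[OF left_module_regular])
    show "ring R" by (rule left_moduleD[OF assms(1)])
    show "?I \<subseteq> carrier (regular_module R)" by auto
    show "\<zero>\<^bsub>regular_module R\<^esub> \<in> ?I"
      using U(2) N(2) assms(4) by (auto intro!: bexI[of _ "\<zero>\<^bsub>M\<^esub>"])
  next
    fix r s assume "r \<in> ?I" "s \<in> ?I"
    then obtain u v where uv: "r \<in> carrier R" "s \<in> carrier R" "u \<in> U" "v \<in> U"
      "u \<oplus>\<^bsub>M\<^esub> r \<odot>\<^bsub>M\<^esub> m \<in> N" "v \<oplus>\<^bsub>M\<^esub> s \<odot>\<^bsub>M\<^esub> m \<in> N" by auto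
    have "(u \<oplus>\<^bsub>M\<^esub> v) \<oplus>\<^bsub>M\<^esub> (r \<oplus>\<^bsub>R\<^esub> s) \<odot>\<^bsub>M\<^esub> m = (u \<oplus>\<^bsub>M\<^esub> r \<odot>\<^bsub>M\<^esub> m) \<oplus>\<^bsub>M\<^esub> (v \<oplus>\<^bsub>M\<^esub> s \<odot>\<^bsub>M\<^esub> m)"
      using uv Uc assms(4) by (simp add: smult_l_distr M.a_ac)
    also have "\<dots> \<in> N" by (rule N(3)[OF uv(5,6)])
    finally show "r \<oplus>\<^bsub>regular_module R\<^esub> s \<in> ?I"
      using uv U(3) by auto
  next
    fix r s assume r: "r \<in> carrier R" "s \<in> ?I"
    then obtain v where uv: "s \<in> carrier R" "v \<in> U" "v \<oplus>\<^bsub>M\<^esub> s \<odot>\<^bsub>M\<^esub> m \<in> N" by auto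
    have "r \<odot>\<^bsub>M\<^esub> v \<oplus>\<^bsub>M\<^esub> (r \<otimes>\<^bsub>R\<^esub> s) \<odot>\<^bsub>M\<^esub> m = r \<odot>\<^bsub>M\<^esub> (v \<oplus>\<^bsub>M\<^esub> s \<odot>\<^bsub>M\<^esub> m)"
      using r uv Uc assms(4) by (simp add: smult_r_distr smult_assoc1)
    also have "\<dots> \<in> N" using N(4) r(1) uv(3) by auto
    finally show "r \<odot>\<^bsub>regular_module R\<^esub> s \<in> ?I"
      using r uv U(4) by auto
  qed
qed

text \<open>
  One more generator \<open>m\<close>. Generators of \<open>N\<close> are those of \<open>N \<inter> U\<close> together with elements
  of \<open>N\<close> that realise generators of the left ideal of coefficients of \<open>m\<close>: subtracting a combination of the latter
  from an element of \<open>N\<close> moves it to \<open>U\<close>.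
\<close>

lemma fg_subset_extend:
  assumes "left_noetherian R" "left_module R M" "submodule U R M" "m \<in> carrier M"
    and U: "\<And>N. submodule N R M \<Longrightarrow> N \<subseteq> U \<Longrightarrow> fg_subset R M N"
    and N: "submodule N R M" "\<And>x. x \<in> N \<Longrightarrow> \<exists>u\<in>U. \<exists>r\<in>carrier R. x = u \<oplus>\<^bsub>M\<^esub> r \<odot>\<^bsub>M\<^esub> m"
  shows "fg_subset R M N"
proof -
  interpret left_module R M by fact
  have LR: "left_module R (regular_module R)" by (rule left_module_regular[OF left_moduleD(1)[OF assms(2)]])
  let ?I = "\<lambda>N. {r \<in> carrier R. \<exists>u\<in>U. u \<oplus>\<^bsub>M\<^esub> r \<odot>\<^bsub>M\<^esub> m \<in> N}"
  have I: "submodule (?I N) R (regular_module R)"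
    by (rule submodule_colon[OF assms(2,3) N(1) assms(4)])
  then have "finitely_generated R ((regular_module R)\<lparr>carrier := ?I N\<rparr>)"
    using assms(1) unfolding left_noetherian_def by (elim allE impE)
  then have fgI: "fg_subset R (regular_module R) (?I N)"
    by (simp only: finitely_generated_submodule_iff[OF LR I])
  obtain A where A: "finite A" "A \<subseteq> ?I N"
    "\<And>H. submodule H R (regular_module R) \<Longrightarrow> A \<subseteq> H \<Longrightarrow> ?I N \<subseteq> H"
    by (rule fg_subsetE[OF fgI]) (rule that, assumption, assumption, elim meta_allE meta_impE)
  have "\<exists>y\<in>N. \<exists>u\<in>U. y = u \<oplus>\<^bsub>M\<^esub> r \<odot>\<^bsub>M\<^esub> m" if "r \<in> A" for r
    using A(2) that by blast
  then obtain y where y: "\<And>r. r \<in> A \<Longrightarrow> y r \<in> N" "\<And>r. r \<in> A \<Longrightarrow> \<exists>u\<in>U. y r = u \<oplus>\<^bsub>M\<^esub> r \<odot>\<^bsub>M\<^esub> m"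
    by metis
  obtain B where B: "finite B" "B \<subseteq> N \<inter> U" "\<And>H. submodule H R M \<Longrightarrow> B \<subseteq> H \<Longrightarrow> N \<inter> U \<subseteq> H"
    by (rule fg_subsetE[OF U[OF submodule_Int[OF assms(2) N(1) assms(3)] Int_lower2]])
      (rule that, assumption, assumption, elim meta_allE meta_impE)
  show ?thesis
    unfolding fg_subset_def
  proof (intro exI[of _ "B \<union> y ` A"] conjI allI impI)
    fix H assume H: "submodule H R M \<and> B \<union> y ` A \<subseteq> H"
    then have sH: "submodule H R M" by blast
    have "A \<subseteq> ?I (N \<inter> H)"
    proof
      fix r assume r: "r \<in> A"
      then obtain u where "u \<in> U" "y r = u \<oplus>\<^bsub>M\<^esub> r \<odot>\<^bsub>M\<^esub> m" using y(2) by blast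
      moreover have "y r \<in> N \<inter> H" using y(1)[OF r] H r by blast
      moreover have "r \<in> carrier R" using A(2) r by blast
      ultimately show "r \<in> ?I (N \<inter> H)" by auto
    qed
    then have IH: "?I N \<subseteq> ?I (N \<inter> H)"
      by (intro A(3) submodule_colon[OF assms(2,3) submodule_Int[OF assms(2) N(1) sH] assms(4)])
    have BH: "N \<inter> U \<subseteq> H" using B(3)[OF sH] H by blast
    show "N \<subseteq> H"
    proof
      fix x assume x: "x \<in> N"
      then obtain u r where u: "u \<in> U" "r \<in> carrier R" "x = u \<oplus>\<^bsub>M\<^esub> r \<odot>\<^bsub>M\<^esub> m" using N(2) by blast
      then have "r \<in> ?I N" using x by auto
      then have "r \<in> ?I (N \<inter> H)" using IH by blast
      then obtain v where v: "v \<in> U" "v \<oplus>\<^bsub>M\<^esub> r \<odot>\<^bsub>M\<^esub> m \<in> N" "v \<oplus>\<^bsub>M\<^esub> r \<odot>\<^bsub>M\<^esub> m \<in> H" by auto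
      have c: "u \<in> carrier M" "v \<in> carrier M" "r \<odot>\<^bsub>M\<^esub> m \<in> carrier M"
        using u v submoduleD(1)[OF assms(3)] assms(4) by auto
      have eq: "u \<oplus>\<^bsub>M\<^esub> \<ominus>\<^bsub>M\<^esub> v = x \<oplus>\<^bsub>M\<^esub> \<ominus>\<^bsub>M\<^esub> (v \<oplus>\<^bsub>M\<^esub> r \<odot>\<^bsub>M\<^esub> m)"
        unfolding u(3) using c by (simp add: M.a_ac M.minus_add M.r_neg M.r_neg1 M.r_neg2)
      have "u \<oplus>\<^bsub>M\<^esub> \<ominus>\<^bsub>M\<^esub> v \<in> N"
        unfolding eq by (rule submoduleD(3)[OF N(1) x submoduleD(5)[OF N(1) v(2)]])
      moreover have "u \<oplus>\<^bsub>M\<^esub> \<ominus>\<^bsub>M\<^esub> v \<in> U"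
        by (rule submoduleD(3)[OF assms(3) u(1) submoduleD(5)[OF assms(3) v(1)]])
      ultimately have "u \<oplus>\<^bsub>M\<^esub> \<ominus>\<^bsub>M\<^esub> v \<in> H" using BH by blast
      then have "(u \<oplus>\<^bsub>M\<^esub> \<ominus>\<^bsub>M\<^esub> v) \<oplus>\<^bsub>M\<^esub> (v \<oplus>\<^bsub>M\<^esub> r \<odot>\<^bsub>M\<^esub> m) \<in> H"
        by (rule submoduleD(3)[OF sH _ v(3)])
      also have "(u \<oplus>\<^bsub>M\<^esub> \<ominus>\<^bsub>M\<^esub> v) \<oplus>\<^bsub>M\<^esub> (v \<oplus>\<^bsub>M\<^esub> r \<odot>\<^bsub>M\<^esub> m) = x"
        unfolding u(3) using c by (simp add: M.a_ac M.minus_add M.r_neg M.r_neg1 M.r_neg2)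
      finally show "x \<in> H" .
    qed
  qed (use A(1) B(1,2) y(1) in auto)
qed

lemma finite_subset_noetherian_submodule:
  assumes "left_noetherian R" "left_module R M" "finite A" "A \<subseteq> carrier M"
  shows "\<exists>U. submodule U R M \<and> A \<subseteq> U \<and> (\<forall>N. submodule N R M \<and> N \<subseteq> U \<longrightarrow> fg_subset R M N)"
  using assms(3,4)
proof (induct A rule: finite_induct)
  case empty
  have "fg_subset R M N" if "N \<subseteq> {\<zero>\<^bsub>M\<^esub>}" for N
    unfolding fg_subset_def using that submoduleD(2) by (intro exI[of _ "{}"]) blast
  then show ?case
    by (intro exI[of _ "{\<zero>\<^bsub>M\<^esub>}"]) (simp add: submodule_zero assms)
next
  case (insert m A)
  interpret left_module R M by fact
  obtain U where U: "submodule U R M" "A \<subseteq> U" "\<And>N. submodule N R M \<Longrightarrow> N \<subseteq> U \<Longrightarrow> fg_subset R M N"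
    using insert by blast
  note UD = submoduleD[OF U(1)]
  have Uc: "u \<in> carrier M" if "u \<in> U" for u using UD(1) that by auto
  have m: "m \<in> carrier M" using insert by auto
  let ?W = "{u \<oplus>\<^bsub>M\<^esub> r \<odot>\<^bsub>M\<^esub> m | u r. u \<in> U \<and> r \<in> carrier R}"
  have W: "u \<oplus>\<^bsub>M\<^esub> r \<odot>\<^bsub>M\<^esub> m \<in> ?W" if "u \<in> U" "r \<in> carrier R" for u r
    using that by blast
  have "submodule ?W R M"
  proof (rule left_submoduleI[OF assms(2)])
    show "?W \<subseteq> carrier M" using Uc m by auto
    show "\<zero>\<^bsub>M\<^esub> \<in> ?W"
      using W[OF UD(2), of "\<zero>\<^bsub>R\<^esub>"] m by simp
  next
    fix x y assume "x \<in> ?W" "y \<in> ?W"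
    then obtain u r v s where u: "u \<in> U" "r \<in> carrier R" "v \<in> U" "s \<in> carrier R"
      "x = u \<oplus>\<^bsub>M\<^esub> r \<odot>\<^bsub>M\<^esub> m" "y = v \<oplus>\<^bsub>M\<^esub> s \<odot>\<^bsub>M\<^esub> m" by blast
    then have "x \<oplus>\<^bsub>M\<^esub> y = (u \<oplus>\<^bsub>M\<^esub> v) \<oplus>\<^bsub>M\<^esub> (r \<oplus>\<^bsub>R\<^esub> s) \<odot>\<^bsub>M\<^esub> m"
      using Uc m by (simp add: smult_l_distr M.a_ac)
    then show "x \<oplus>\<^bsub>M\<^esub> y \<in> ?W"
      using W[OF UD(3)[OF u(1,3)] R.a_closed[OF u(2,4)]] by simp
  next
    fix t x assume t: "t \<in> carrier R" "x \<in> ?W"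
    then obtain u r where u: "u \<in> U" "r \<in> carrier R" "x = u \<oplus>\<^bsub>M\<^esub> r \<odot>\<^bsub>M\<^esub> m" by blast
    then have "t \<odot>\<^bsub>M\<^esub> x = t \<odot>\<^bsub>M\<^esub> u \<oplus>\<^bsub>M\<^esub> (t \<otimes>\<^bsub>R\<^esub> r) \<odot>\<^bsub>M\<^esub> m"
      using Uc m t by (simp add: smult_r_distr smult_assoc1)
    then show "t \<odot>\<^bsub>M\<^esub> x \<in> ?W"
      using W[OF UD(4)[OF t(1) u(1)] R.m_closed[OF t(1) u(2)]] by simp
  qed
  moreover have "insert m A \<subseteq> ?W"
  proof -
    have "m \<in> ?W" using W[OF UD(2), of "\<one>\<^bsub>R\<^esub>"] m by simp
    moreover have "u \<in> ?W" if "u \<in> U" for u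
      using W[OF that, of "\<zero>\<^bsub>R\<^esub>"] m Uc[OF that] by simp
    ultimately show ?thesis using U(2) by blast
  qed
  moreover have "fg_subset R M N" if "submodule N R M" "N \<subseteq> ?W" for N
    by (rule fg_subset_extend[OF assms(1,2) U(1) m U(3) that(1)]) (use that(2) in blast)+
  ultimately show ?case by blast
qed

text \<open>Adjoin the generators of \<open>M\<close> one at a time to the zero submodule.\<close>

lemma finitely_generated_submodule:
  assumes "left_noetherian R" "fg_module R M" "submodule N R M"
  shows "finitely_generated R (M\<lparr>carrier := N\<rparr>)"
proof -
  have LM: "left_module R M" and "finitely_generated R M" using assms(2) by (auto simp: fg_module_def)
  then obtain A where A: "finite A" "A \<subseteq> carrier M" "\<And>H. submodule H R M \<Longrightarrow> A \<subseteq> H \<Longrightarrow> H = carrier M"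
    by (auto simp: finitely_generated_def)
  obtain U where "submodule U R M" "A \<subseteq> U" "\<And>N. submodule N R M \<Longrightarrow> N \<subseteq> U \<Longrightarrow> fg_subset R M N"
    using finite_subset_noetherian_submodule[OF assms(1) LM A(1,2)] by blast
  moreover from this(1,2) have "U = carrier M" by (rule A(3))
  ultimately show ?thesis
    using assms(3) submoduleD(1)[OF assms(3)] by (simp add: finitely_generated_submodule_iff[OF LM assms(3)])
qed

section \<open>Existence of resolutions\<close>

lemma fg_submodule_cover:
  assumes "left_noetherian R" "fg_module R M" "submodule N R M"
  shows "\<exists>n e. e \<in> mod_hom R (free_module R n) M \<and> e ` carrier (free_module R n) = N"
proof -
  have LM: "left_module R M" using assms(2) by (auto simp: fg_module_def)
  note LN = left_module_submodule[OF LM assms(3)]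
  obtain n p where p: "\<And>i. i < n \<Longrightarrow> p i \<in> N"
    "lincomb (M\<lparr>carrier := N\<rparr>) n p ` carrier (free_module R n) = N"
    using finitely_generated_submodule[OF assms] unfolding finitely_generated_iff[OF LN] by auto
  have "lincomb (M\<lparr>carrier := N\<rparr>) n p \<in> mod_hom R (free_module R n) (M\<lparr>carrier := N\<rparr>)"
    by (rule lincomb_hom[OF LN]) (simp add: p)
  then have "lincomb (M\<lparr>carrier := N\<rparr>) n p \<in> mod_hom R (free_module R n) M"
    using mod_hom_sub_iff[OF submoduleD(1)[OF assms(3)]] by blast
  then show ?thesis using p(2) by blast
qed

lemma fg_projective_fg_module: "fg_projective R P \<Longrightarrow> fg_module R P"
  by (simp add: fg_projective_def)

text \<open>
  Cover \<open>M\<close>, then the kernel of each map constructed so far, by some \<open>R\<^sup>n\<close>. The kernels are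
  finitely generated as submodules of some \<open>R\<^sup>n\<close>.
\<close>

lemma projective_resolution_exists:
  fixes R :: "('a, 'c) ring_scheme"
  assumes "left_noetherian R" "fg_module R M"
  shows "\<exists>(P :: nat \<Rightarrow> ('a, nat \<Rightarrow> 'a) module) d e. projective_resolution R M P d e"
proof -
  have LM: "left_module R M" using assms(2) by (auto simp: fg_module_def)
  then have R: "ring R" by (rule left_moduleD)
  note LF = left_module_free[OF R] and PF = fg_projective_free[OF R]
  let ?F = "free_module R"
  obtain n e where e: "e \<in> mod_hom R (?F n) M" "e ` carrier (?F n) = carrier M"
    using fg_submodule_cover[OF assms submodule_carrier[OF LM]] by blast

  obtain m0 d0 where d0: "d0 \<in> mod_hom R (?F m0) (?F n)" "d0 ` carrier (?F m0) = mod_ker (?F n) M e"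
    using fg_submodule_cover[OF assms(1) fg_projective_fg_module[OF PF] submodule_mod_ker[OF LF LM e(1)]] by blast
  \<comment> \<open>A state \<open>(m, n, d)\<close> of the recursion is a map \<open>d : R\<^sup>m \<rightarrow> R\<^sup>n\<close>.\<close>
  let ?ok = "\<lambda>(m, n, d). d \<in> mod_hom R (?F m) (?F n)"
  let ?next = "\<lambda>(m, n, d) (m', n', d'). n' = m \<and> d' ` carrier (?F m') = mod_ker (?F m) (?F n) d"
  have "\<exists>f. \<forall>i. (?ok (f i) \<and> (i = 0 \<longrightarrow> f i = (m0, n, d0))) \<and> ?next (f i) (f (Suc i))"
  proof (rule dependent_nat_choice)
    show "\<exists>x. ?ok x \<and> ((0::nat) = 0 \<longrightarrow> x = (m0, n, d0))" using d0 by auto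
    fix x and i :: nat assume "?ok x \<and> (i = 0 \<longrightarrow> x = (m0, n, d0))"
    then obtain m k d where x: "x = (m, k, d)" "d \<in> mod_hom R (?F m) (?F k)" by (cases x) auto
    obtain m' d' where "d' \<in> mod_hom R (?F m') (?F m)" "d' ` carrier (?F m') = mod_ker (?F m) (?F k) d"
      using fg_submodule_cover[OF assms(1) fg_projective_fg_module[OF PF] submodule_mod_ker[OF LF LF x(2)]] by blast
    then show "\<exists>y. (?ok y \<and> (Suc i = 0 \<longrightarrow> y = (m0, n, d0))) \<and> ?next x y"
      unfolding x(1) by (intro exI[of _ "(m', m, d')"]) simp
  qed
  then obtain f where ff: "\<forall>i. (?ok (f i) \<and> (i = 0 \<longrightarrow> f i = (m0, n, d0))) \<and> ?next (f i) (f (Suc i))"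
    by (rule exE)
  have f: "?ok (f i)" "f 0 = (m0, n, d0)" "?next (f i) (f (Suc i))" for i
    using spec[OF ff, of i] spec[OF ff, of 0] by simp_all
  define N where "N i = fst (snd (f i))" for i
  define d where "d i = snd (snd (f i))" for i
  have N: "N (Suc i) = fst (f i)" for i using f(3)[of i] by (auto simp: N_def split: prod.splits)
  have d: "d i \<in> mod_hom R (?F (N (Suc i))) (?F (N i))" for i
    using f(1)[of i] N[of i] by (auto simp: N_def d_def split: prod.splits)
  have dd: "d (Suc i) ` carrier (?F (N (Suc (Suc i)))) = mod_ker (?F (N (Suc i))) (?F (N i)) (d i)" for i
    using f(3)[of i] N[of i] N[of "Suc i"] by (auto simp: N_def d_def split: prod.splits)
  have z: "N 0 = n" "d 0 = d0" "N (Suc 0) = m0" using f(2) N[of 0] by (auto simp: N_def d_def)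
  have "projective_resolution R M (\<lambda>i. ?F (N i)) d e"
    unfolding projective_resolution_def using PF d dd e d0 z by auto
  then show ?thesis by blast
qed

section \<open>Direct sums\<close>

text \<open>
  Concatenation of two dual bases. The sum \<open>Q\<close> is given by its structure maps only, which are linear, so
  the two halves of the expansion are the images of the expansions in \<open>A\<close> and \<open>B\<close>.
\<close>

lemma dual_basis_sum:
  assumes "dual_basis R A n a s" "dual_basis R B m b t"
    and "left_module R A" "left_module R B" "left_module R Q"
    and i: "i \<in> mod_hom R A Q" and j: "j \<in> mod_hom R B Q" and p: "p \<in> mod_hom R Q A" and q: "q \<in> mod_hom R Q B"
    and sum: "\<And>x. x \<in> carrier Q \<Longrightarrow> i (p x) \<oplus>\<^bsub>Q\<^esub> j (q x) = x"
  shows "dual_basis R Q (n + m) (\<lambda>k. if k < n then i (a k) else j (b (k - n)))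
    (\<lambda>k x. if k < n then s k (p x) else t (k - n) (q x))" (is "dual_basis R Q _ ?c ?u")
  unfolding dual_basis_def
proof (intro conjI allI impI ballI)
  interpret A: left_module R A by fact
  interpret B: left_module R B by fact
  interpret Q: left_module R Q by fact
  note a = dual_basisD[OF assms(1)] and b = dual_basisD[OF assms(2)]
  show c: "?c k \<in> carrier Q" if "k < n + m" for k
    using that a(1) b(1) mod_hom_closed[OF i] mod_hom_closed[OF j] by auto
  show u: "?u k \<in> functionals R Q" if "k < n + m" for k
  proof (cases "k < n")
    case True
    then show ?thesis using mod_hom_comp[OF p a(2)] by simp
  next
    case False
    then have "k - n < m" using that by auto
    then show ?thesis using False mod_hom_comp[OF q b(2)] by simp
  qed
  fix x assume x: "x \<in> carrier Q"
  let ?f = "\<lambda>k. ?u k x \<odot>\<^bsub>Q\<^esub> ?c k"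

  have px: "p x \<in> carrier A" and qx: "q x \<in> carrier B"
    by (rule mod_hom_closed[OF p x], rule mod_hom_closed[OF q x])
  have f1: "s k (p x) \<odot>\<^bsub>Q\<^esub> i (a k) \<in> carrier Q" if "k < n" for k
    by (intro Q.smult_closed a(3) that px mod_hom_closed[OF i] a(1))
  have f2: "t k (q x) \<odot>\<^bsub>Q\<^esub> j (b k) \<in> carrier Q" if "k < m" for k
    by (intro Q.smult_closed b(3) that qx mod_hom_closed[OF j] b(1))
  have "k \<in> (\<lambda>k. k + n) ` {..<m}" if "k < n + m" "\<not> k < n" for k
    using that by (intro image_eqI[of _ _ "k - n"]) auto
  then have "{..<n + m} = {..<n} \<union> (\<lambda>k. k + n) ` {..<m}" by auto
  then have "finsum Q ?f {..<n + m} = finsum Q ?f ({..<n} \<union> (\<lambda>k. k + n) ` {..<m})" by (simp only:)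
  also have "\<dots> = finsum Q ?f {..<n} \<oplus>\<^bsub>Q\<^esub> finsum Q ?f ((\<lambda>k. k + n) ` {..<m})"
    using f1 f2 by (intro Q.finsum_Un_disjoint) auto
  also have "finsum Q ?f ((\<lambda>k. k + n) ` {..<m}) = finsum Q (\<lambda>k. ?f (k + n)) {..<m}"
    using f2 by (intro Q.finsum_reindex) auto
  also have "\<dots> = (\<Oplus>\<^bsub>Q\<^esub>k\<in>{..<m}. j (t k (q x) \<odot>\<^bsub>B\<^esub> b k))"
    using b qx mod_hom_closed[OF j] by (intro Q.finsum_cong') (auto simp: mod_hom_smult[OF j])
  also have "\<dots> = j (\<Oplus>\<^bsub>B\<^esub>k\<in>{..<m}. t k (q x) \<odot>\<^bsub>B\<^esub> b k)"
    using b(1,3) qx by (subst mod_hom_finsum[OF assms(4,5) j]) auto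
  also have "\<dots> = j (q x)" by (simp only: b(4)[OF qx])
  also have "finsum Q ?f {..<n} = (\<Oplus>\<^bsub>Q\<^esub>k\<in>{..<n}. i (s k (p x) \<odot>\<^bsub>A\<^esub> a k))"
    using a px mod_hom_closed[OF i] by (intro Q.finsum_cong') (auto simp: mod_hom_smult[OF i])
  also have "\<dots> = i (\<Oplus>\<^bsub>A\<^esub>k\<in>{..<n}. s k (p x) \<odot>\<^bsub>A\<^esub> a k)"
    using a(1,3) px by (subst mod_hom_finsum[OF assms(3,5) i]) auto
  also have "\<dots> = i (p x)" by (simp only: a(4)[OF px])
  finally show "x = finsum Q ?f {..<n + m}" using sum[OF x] by simp
qed

definition prod_module :: "('a, 'b) module \<Rightarrow> ('a, 'd) module \<Rightarrow> ('a, 'b \<times> 'd) module" where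
  "prod_module A B = \<lparr>carrier = carrier A \<times> carrier B, mult = undefined, one = undefined,
     zero = (\<zero>\<^bsub>A\<^esub>, \<zero>\<^bsub>B\<^esub>), add = (\<lambda>x y. (fst x \<oplus>\<^bsub>A\<^esub> fst y, snd x \<oplus>\<^bsub>B\<^esub> snd y)),
     smult = (\<lambda>r x. (r \<odot>\<^bsub>A\<^esub> fst x, r \<odot>\<^bsub>B\<^esub> snd x))\<rparr>"

lemma left_module_prod:
  assumes "left_module R A" "left_module R B"
  shows "left_module R (prod_module A B)"
proof -
  interpret A: left_module R A by fact
  interpret B: left_module R B by fact
  show ?thesis
  proof (rule left_moduleI)
    fix x assume "x \<in> carrier (prod_module A B)"
    then show "\<exists>y\<in>carrier (prod_module A B). y \<oplus>\<^bsub>prod_module A B\<^esub> x = \<zero>\<^bsub>prod_module A B\<^esub>"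
      by (intro bexI[of _ "(\<ominus>\<^bsub>A\<^esub> fst x, \<ominus>\<^bsub>B\<^esub> snd x)"]) (auto simp: prod_module_def A.l_neg B.l_neg)
  qed (auto simp: prod_module_def left_moduleD(1)[OF assms(1)] A.a_ac B.a_ac A.smult_l_distr B.smult_l_distr
      A.smult_r_distr B.smult_r_distr A.smult_assoc1 B.smult_assoc1)
qed

text \<open>
  \<open>Q\<close> is a direct sum of \<open>A\<close> and \<open>B\<close> with projections \<open>p\<close>, \<open>q\<close> and injections \<open>i\<close>, \<open>j\<close>. The type of \<open>Q\<close>
  stays independent of those of \<open>A\<close> and \<open>B\<close>.
\<close>

definition biproduct where
  "biproduct R Q A B p q i j \<longleftrightarrow> p \<in> mod_hom R Q A \<and> q \<in> mod_hom R Q B \<and> i \<in> mod_hom R A Q \<and> j \<in> mod_hom R B Q \<and>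
    (\<forall>a\<in>carrier A. p (i a) = a \<and> q (i a) = \<zero>\<^bsub>B\<^esub>) \<and> (\<forall>b\<in>carrier B. p (j b) = \<zero>\<^bsub>A\<^esub> \<and> q (j b) = b) \<and>
    (\<forall>x\<in>carrier Q. i (p x) \<oplus>\<^bsub>Q\<^esub> j (q x) = x)"

lemma fg_projective_biproduct:
  fixes R :: "('a, 'c) ring_scheme"
  assumes "fg_projective R A" "fg_projective R B"
  shows "\<exists>(Q :: ('a, nat \<Rightarrow> 'a) module) p q i j. fg_projective R Q \<and> biproduct R Q A B p q i j"
proof -
  have A: "left_module R A" and B: "left_module R B" using assms fg_projective_left_module by auto
  interpret A: left_module R A by fact
  interpret B: left_module R B by fact
  let ?C = "prod_module A B"
  let ?i = "\<lambda>a. (a, \<zero>\<^bsub>B\<^esub>)" and ?j = "\<lambda>b. (\<zero>\<^bsub>A\<^esub>, b)"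
  note C = left_module_prod[OF A B]
  have h: "fst \<in> mod_hom R ?C A" "snd \<in> mod_hom R ?C B" "?i \<in> mod_hom R A ?C" "?j \<in> mod_hom R B ?C"
    by (auto simp: mod_hom_def prod_module_def)
  have "?i (fst x) \<oplus>\<^bsub>?C\<^esub> ?j (snd x) = x" if "x \<in> carrier ?C" for x
    using that by (auto simp: prod_module_def)
  note s = this
  obtain n a u m b v where "dual_basis R A n a u" "dual_basis R B m b v"
    using assms by (auto simp: fg_projective_iff)
  then have "dual_basis R ?C (n + m) (\<lambda>k. if k < n then ?i (a k) else ?j (b (k - n)))
    (\<lambda>k x. if k < n then u k (fst x) else v (k - n) (snd x))"
    by (intro dual_basis_sum[OF _ _ A B C h(3,4,1,2)]) (auto intro: s)
  then have "fg_projective R ?C" using C unfolding fg_projective_iff by blast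
  then obtain Q :: "('a, nat \<Rightarrow> 'a) module" and f g where Q: "fg_projective R Q"
    "f \<in> mod_hom R ?C Q" "g \<in> mod_hom R Q ?C"
    "\<And>x. x \<in> carrier ?C \<Longrightarrow> g (f x) = x" "\<And>y. y \<in> carrier Q \<Longrightarrow> f (g y) = y"
    by (rule fg_projective_copy) blast
  have Cc: "a \<in> carrier A \<Longrightarrow> ?i a \<in> carrier ?C" "b \<in> carrier B \<Longrightarrow> ?j b \<in> carrier ?C" for a b
    by (auto simp: prod_module_def)
  have fst: "f (?i (fst (g x))) \<oplus>\<^bsub>Q\<^esub> f (?j (snd (g x))) = x" if x: "x \<in> carrier Q" for x
  proof -
    have gx: "g x \<in> carrier ?C" by (rule mod_hom_closed[OF Q(3) x])
    then have "f (?i (fst (g x))) \<oplus>\<^bsub>Q\<^esub> f (?j (snd (g x))) = f (?i (fst (g x)) \<oplus>\<^bsub>?C\<^esub> ?j (snd (g x)))"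
      by (intro mod_hom_add[OF Q(2), symmetric] Cc mod_hom_closed[OF h(1)] mod_hom_closed[OF h(2)]) auto
    then show ?thesis by (simp only: s[OF gx] Q(5)[OF x])
  qed
  have "biproduct R Q A B (\<lambda>x. fst (g x)) (\<lambda>x. snd (g x)) (\<lambda>a. f (?i a)) (\<lambda>b. f (?j b))"
    unfolding biproduct_def
    using mod_hom_comp[OF Q(3) h(1)] mod_hom_comp[OF Q(3) h(2)] mod_hom_comp[OF h(3) Q(2)] mod_hom_comp[OF h(4) Q(2)] fst
    by (simp add: Q(4) Cc)
  then show ?thesis using Q(1) by blast
qed

section \<open>The opposite ring and dual modules\<close>

lemma op_ring_simps [simp]:
  "carrier (op_ring R) = carrier R" "zero (op_ring R) = zero R" "add (op_ring R) = add R"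
  "one (op_ring R) = one R" "mult (op_ring R) = (\<lambda>x y. y \<otimes>\<^bsub>R\<^esub> x)"
  by (simp_all add: op_ring_def)

lemma op_ring_op_ring [simp]: "op_ring (op_ring R) = R"
  by (simp add: op_ring_def)

lemma ring_op_ring: "ring R \<Longrightarrow> ring (op_ring R)"
proof -
  assume "ring R"
  then interpret ring R .
  have "abelian_group (op_ring R)"
    by (rule abelian_groupI) (auto simp: a_ac intro: l_neg bexI[of _ "\<ominus>\<^bsub>R\<^esub> x" for x])
  moreover have "monoid (op_ring R)"
    by (rule monoidI) (auto simp: m_assoc)
  ultimately show ?thesis
    by (rule ringI) (auto simp: l_distr r_distr)
qed

lemma finsum_op_ring [simp]: "finsum (op_ring R) = finsum R"
  by (simp add: finsum_def fun_eq_iff finprod_def foldD_def)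

lemma dual_module_simps:
  "carrier (dual_module R P) = functionals R P \<inter> extensional (carrier P)"
  "x \<in> carrier P \<Longrightarrow> \<zero>\<^bsub>dual_module R P\<^esub> x = \<zero>\<^bsub>R\<^esub>"
  "x \<in> carrier P \<Longrightarrow> (f \<oplus>\<^bsub>dual_module R P\<^esub> g) x = f x \<oplus>\<^bsub>R\<^esub> g x"
  "x \<in> carrier P \<Longrightarrow> (r \<odot>\<^bsub>dual_module R P\<^esub> f) x = f x \<otimes>\<^bsub>R\<^esub> r"
  by (simp_all add: dual_module_def)

lemma functional_smult_right:
  assumes "ring R" "f \<in> functionals R P" "r \<in> carrier R"
  shows "(\<lambda>x. f x \<otimes>\<^bsub>R\<^esub> r) \<in> functionals R P"
proof -
  interpret ring R by fact
  show ?thesis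
    by (rule mod_homI)
      (use mod_hom_closed[OF assms(2)] mod_hom_add[OF assms(2)] mod_hom_smult[OF assms(2)] assms(3)
        in \<open>auto simp: l_distr m_assoc\<close>)
qed

lemma restrict_in_dual:
  assumes "left_module R P" "f \<in> functionals R P"
  shows "restrict f (carrier P) \<in> carrier (dual_module R P)"
  using mod_hom_cong[OF assms, of "restrict f (carrier P)"] by (simp add: dual_module_simps)

lemma dual_module_eqI:
  assumes "f \<in> carrier (dual_module R P)" "g \<in> carrier (dual_module R P)"
    "\<And>x. x \<in> carrier P \<Longrightarrow> f x = g x"
  shows "f = g"
  using assms by (auto simp: dual_module_simps intro: extensionalityI)

text \<open>
  Right multiplication of values commutes with the left action on arguments, which is why the dual of
  a left module is a module over the opposite ring.
\<close>

lemma left_module_dual: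
  assumes "left_module R P"
  shows "left_module (op_ring R) (dual_module R P)"
proof -
  interpret P: left_module R P by fact
  have R: "ring R" by (rule left_moduleD[OF assms])
  let ?D = "dual_module R P"
  note LR = left_module_regular[OF R]
  note D = dual_module_simps
  have c: "f x \<in> carrier R" if "f \<in> carrier ?D" "x \<in> carrier P" for f x
    using that mod_hom_closed[of f R P "regular_module R" x] by (simp add: D)
  have add: "f \<oplus>\<^bsub>?D\<^esub> g \<in> carrier ?D" if "f \<in> carrier ?D" "g \<in> carrier ?D" for f g
    using restrict_in_dual[OF assms mod_hom_plus[OF LR, of f P g]] that
    by (simp add: D(1)) (simp add: dual_module_def)
  have zero: "\<zero>\<^bsub>?D\<^esub> \<in> carrier ?D"
    using restrict_in_dual[OF assms mod_hom_const_zero[OF LR, of P]]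
    by (simp add: D(1)) (simp add: dual_module_def)
  have sm: "r \<odot>\<^bsub>?D\<^esub> f \<in> carrier ?D" if "f \<in> carrier ?D" "r \<in> carrier R" for f r
    using restrict_in_dual[OF assms functional_smult_right[OF R, of f P r]] that
    by (simp add: D(1)) (simp add: dual_module_def)
  have neg: "(\<lambda>x\<in>carrier P. \<ominus>\<^bsub>R\<^esub> f x) \<in> carrier ?D" if "f \<in> carrier ?D" for f
    using restrict_in_dual[OF assms mod_hom_neg[OF LR, of f P]] that by (simp add: D(1))
  note eqI = dual_module_eqI[of _ R P]
  show ?thesis
  proof (rule left_moduleI)
    show "ring (op_ring R)" by (rule ring_op_ring[OF R])
    fix f assume f: "f \<in> carrier ?D"
    show "\<exists>g\<in>carrier ?D. g \<oplus>\<^bsub>?D\<^esub> f = \<zero>\<^bsub>?D\<^esub>"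
      using neg[OF f] c[OF f] by (intro bexI[of _ "\<lambda>x\<in>carrier P. \<ominus>\<^bsub>R\<^esub> f x"] eqI add zero f) (auto simp: D P.R.l_neg)
    show "\<one>\<^bsub>op_ring R\<^esub> \<odot>\<^bsub>?D\<^esub> f = f" using c[OF f] by (intro eqI sm f) (auto simp: D(2-4))
    show "\<zero>\<^bsub>?D\<^esub> \<oplus>\<^bsub>?D\<^esub> f = f" using c[OF f] by (intro eqI add zero f) (auto simp: D(2-4))
    fix r s assume r: "r \<in> carrier (op_ring R)" "s \<in> carrier (op_ring R)"
    show "(r \<oplus>\<^bsub>op_ring R\<^esub> s) \<odot>\<^bsub>?D\<^esub> f = r \<odot>\<^bsub>?D\<^esub> f \<oplus>\<^bsub>?D\<^esub> s \<odot>\<^bsub>?D\<^esub> f"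
      using c[OF f] r by (intro eqI add sm f) (auto simp: D(2-4) P.R.r_distr)
    show "r \<otimes>\<^bsub>op_ring R\<^esub> s \<odot>\<^bsub>?D\<^esub> f = r \<odot>\<^bsub>?D\<^esub> (s \<odot>\<^bsub>?D\<^esub> f)"
      using c[OF f] r by (intro eqI add sm f) (auto simp: D(2-4) P.R.m_assoc)
  next
    fix f g assume f: "f \<in> carrier ?D" "g \<in> carrier ?D"
    show "f \<oplus>\<^bsub>?D\<^esub> g = g \<oplus>\<^bsub>?D\<^esub> f" using c f by (intro eqI add) (auto simp: D(2-4) P.R.a_comm)
    fix r assume r: "r \<in> carrier (op_ring R)"
    show "r \<odot>\<^bsub>?D\<^esub> (f \<oplus>\<^bsub>?D\<^esub> g) = r \<odot>\<^bsub>?D\<^esub> f \<oplus>\<^bsub>?D\<^esub> r \<odot>\<^bsub>?D\<^esub> g"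
      using c f r by (intro eqI add sm f) (auto simp: D(2-4) P.R.l_distr)
  next
    fix f g h assume f: "f \<in> carrier ?D" "g \<in> carrier ?D" "h \<in> carrier ?D"
    show "f \<oplus>\<^bsub>?D\<^esub> g \<oplus>\<^bsub>?D\<^esub> h = f \<oplus>\<^bsub>?D\<^esub> (g \<oplus>\<^bsub>?D\<^esub> h)"
      using c f by (intro eqI add) (auto simp: D(2-4) P.R.a_assoc)
  qed (use add zero sm in auto)
qed

text \<open>The transpose of \<open>m : P \<rightarrow> Q\<close>.\<close>

definition dual_map where
  "dual_map P m = (\<lambda>f. \<lambda>x\<in>carrier P. f (m x))"

lemma dual_map_hom:
  assumes "left_module R P" "left_module R Q" "m \<in> mod_hom R P Q"
  shows "dual_map P m \<in> mod_hom (op_ring R) (dual_module R Q) (dual_module R P)"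
proof (rule mod_homI)
  interpret D: left_module "op_ring R" "dual_module R Q" by (rule left_module_dual[OF assms(2)])
  interpret D': left_module "op_ring R" "dual_module R P" by (rule left_module_dual[OF assms(1)])
  note mc = mod_hom_closed[OF assms(3)]
  have c: "dual_map P m g \<in> carrier (dual_module R P)" if "g \<in> carrier (dual_module R Q)" for g
    using restrict_in_dual[OF assms(1) mod_hom_comp[OF assms(3), of g]] that
    by (simp add: dual_map_def dual_module_simps(1))
  fix g h assume g: "g \<in> carrier (dual_module R Q)"
  show "dual_map P m g \<in> carrier (dual_module R P)" by (rule c[OF g])
  {
    assume h: "h \<in> carrier (dual_module R Q)"
    show "dual_map P m (g \<oplus>\<^bsub>dual_module R Q\<^esub> h) = dual_map P m g \<oplus>\<^bsub>dual_module R P\<^esub> dual_map P m h"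
      by (rule dual_module_eqI[OF c[OF D.a_closed[OF g h]] D'.a_closed[OF c[OF g] c[OF h]]])
        (simp add: dual_map_def dual_module_simps(2-4) mc)
  }
  fix r assume r: "r \<in> carrier (op_ring R)"
  show "dual_map P m (r \<odot>\<^bsub>dual_module R Q\<^esub> g) = r \<odot>\<^bsub>dual_module R P\<^esub> dual_map P m g"
    by (rule dual_module_eqI[OF c[OF D.smult_closed[OF r g]] D'.smult_closed[OF r c[OF g]]])
      (simp add: dual_map_def dual_module_simps(2-4) mc)
qed

lemma eval_functional:
  assumes "left_module R P" "x \<in> carrier P"
  shows "(\<lambda>f. f x) \<in> functionals (op_ring R) (dual_module R P)"
  using assms(2) mod_hom_closed[of _ R P "regular_module R" x] by (intro mod_homI) (auto simp: dual_module_simps)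

text \<open>
  The functionals of a dual basis of \<open>P\<close> and the evaluations at its elements form a dual basis of the
  dual: apply \<open>f\<close> to the expansion of an element of \<open>P\<close>.
\<close>

lemma dual_basis_dual:
  assumes "dual_basis R P n p s" "left_module R P"
  shows "dual_basis (op_ring R) (dual_module R P) n (\<lambda>i. restrict (s i) (carrier P)) (\<lambda>i f. f (p i))"
  unfolding dual_basis_def
proof (intro conjI allI impI ballI)
  note b = dual_basisD[OF assms(1)]
  have R: "ring R" by (rule left_moduleD[OF assms(2)])
  interpret P: left_module R P by fact
  interpret D: left_module "op_ring R" "dual_module R P" by (rule left_module_dual[OF assms(2)])
  show s: "restrict (s i) (carrier P) \<in> carrier (dual_module R P)" if "i < n" for i
    by (rule restrict_in_dual[OF assms(2) b(2)[OF that]])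
  show "(\<lambda>f. f (p i)) \<in> functionals (op_ring R) (dual_module R P)" if "i < n" for i
    by (rule eval_functional[OF assms(2) b(1)[OF that]])
  fix f assume f: "f \<in> carrier (dual_module R P)"
  then have ff: "f \<in> functionals R P" by (simp add: dual_module_simps)
  have fp: "f (p i) \<in> carrier R" if "i < n" for i
    using mod_hom_closed[OF ff b(1)[OF that]] by simp
  let ?t = "\<lambda>i. f (p i) \<odot>\<^bsub>dual_module R P\<^esub> restrict (s i) (carrier P)"
  have t: "?t \<in> {..<n} \<rightarrow> carrier (dual_module R P)"
    using s fp by (intro Pi_I D.smult_closed) auto
  show "f = finsum (dual_module R P) ?t {..<n}"
  proof (rule dual_module_eqI[OF f D.finsum_closed[OF t]])
    fix x assume x: "x \<in> carrier P"
    have "finsum (dual_module R P) ?t {..<n} x = (\<Oplus>\<^bsub>R\<^esub>i\<in>{..<n}. ?t i x)"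
      using mod_hom_finsum[OF D.left_module_axioms left_module_regular[OF ring_op_ring[OF R]] eval_functional[OF assms(2) x] _ t]
      by simp
    also have "\<dots> = (\<Oplus>\<^bsub>R\<^esub>i\<in>{..<n}. f (s i x \<odot>\<^bsub>P\<^esub> p i))"
      using x b(3)[OF _ x] fp b(1)
      by (intro P.R.finsum_cong') (auto simp: dual_module_simps mod_hom_smult[OF ff])
    also have "\<dots> = f (\<Oplus>\<^bsub>P\<^esub>i\<in>{..<n}. s i x \<odot>\<^bsub>P\<^esub> p i)"
      using x b(1) b(3)[OF _ x] by (subst mod_hom_finsum[OF assms(2) left_module_regular[OF R] ff]) auto
    also have "\<dots> = f x" by (simp only: b(4)[OF x])
    finally show "f x = finsum (dual_module R P) ?t {..<n} x" ..
  qed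
qed

lemma fg_projective_dual:
  "fg_projective R P \<Longrightarrow> fg_projective (op_ring R) (dual_module R P)"
  using dual_basis_dual left_module_dual unfolding fg_projective_iff by fast

text \<open>
  Every functional on the dual is an evaluation: \<open>v\<close> is determined by its values on the functionals
  \<open>s i\<close>, and these values are the coefficients of the required element.
\<close>

lemma dual_reflexive:
  assumes "fg_projective R P" "v \<in> functionals (op_ring R) (dual_module R P)"
  shows "\<exists>x\<in>carrier P. \<forall>f\<in>carrier (dual_module R P). v f = f x"
proof -
  obtain n p s where b: "dual_basis R P n p s" and P: "left_module R P"
    using assms(1) by (auto simp: fg_projective_iff)
  have R: "ring R" by (rule left_moduleD[OF P])
  interpret P: left_module R P by fact
  interpret D: left_module "op_ring R" "dual_module R P" by (rule left_module_dual[OF P])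
  note LOp = left_module_regular[OF ring_op_ring[OF R]]
  note c = dual_basis_dual[OF b P] and bb = dual_basisD[OF b]
  note cc = dual_basisD[OF c]
  let ?s = "\<lambda>i. restrict (s i) (carrier P)"
  let ?x = "\<Oplus>\<^bsub>P\<^esub>i\<in>{..<n}. v (?s i) \<odot>\<^bsub>P\<^esub> p i"
  have vs: "v (?s i) \<in> carrier R" if "i < n" for i
    using mod_hom_closed[OF assms(2) cc(1)[OF that]] by simp
  have t: "(\<lambda>i. v (?s i) \<odot>\<^bsub>P\<^esub> p i) \<in> {..<n} \<rightarrow> carrier P"
    using vs bb(1) by auto
  show ?thesis
  proof (intro bexI[of _ ?x] ballI)
    show "?x \<in> carrier P" by (rule P.finsum_closed[OF t])
    fix f assume f: "f \<in> carrier (dual_module R P)"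
    then have ff: "f \<in> functionals R P" by (simp add: dual_module_simps)
    have fp: "f (p i) \<in> carrier R" if "i < n" for i
      using mod_hom_closed[OF ff bb(1)[OF that]] by simp
    have "v f = v (\<Oplus>\<^bsub>dual_module R P\<^esub>i\<in>{..<n}. f (p i) \<odot>\<^bsub>dual_module R P\<^esub> ?s i)"
      by (simp only: cc(4)[OF f])
    also have "\<dots> = (\<Oplus>\<^bsub>R\<^esub>i\<in>{..<n}. v (f (p i) \<odot>\<^bsub>dual_module R P\<^esub> ?s i))"
      using cc(1) fp mod_hom_finsum[OF D.left_module_axioms LOp assms(2), of "{..<n}" "\<lambda>i. f (p i) \<odot>\<^bsub>dual_module R P\<^esub> ?s i"]
      by (simp add: Pi_iff)
    also have "\<dots> = (\<Oplus>\<^bsub>R\<^esub>i\<in>{..<n}. f (v (?s i) \<odot>\<^bsub>P\<^esub> p i))"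
      using vs fp bb(1) cc(1)
      by (intro P.R.finsum_cong') (auto simp: mod_hom_smult[OF ff] mod_hom_smult[OF assms(2)])
    also have "\<dots> = f ?x"
      using t by (subst mod_hom_finsum[OF P left_module_regular[OF R] ff]) auto
    finally show "v f = f ?x" .
  qed
qed

section \<open>Quotient modules\<close>

text \<open>
  The module axioms pass to the image of a structure-preserving map. This is used where it is known how
  the operations of \<open>Q\<close> act on representatives.
\<close>

lemma left_module_surjective_image:
  assumes "left_module R M" "q ` carrier M = carrier Q" "q \<zero>\<^bsub>M\<^esub> = \<zero>\<^bsub>Q\<^esub>"
    and add: "\<And>x y. \<lbrakk>x \<in> carrier M; y \<in> carrier M\<rbrakk> \<Longrightarrow> q x \<oplus>\<^bsub>Q\<^esub> q y = q (x \<oplus>\<^bsub>M\<^esub> y)"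
    and smult: "\<And>r x. \<lbrakk>r \<in> carrier R; x \<in> carrier M\<rbrakk> \<Longrightarrow> r \<odot>\<^bsub>Q\<^esub> q x = q (r \<odot>\<^bsub>M\<^esub> x)"
  shows "left_module R Q" "q \<in> mod_hom R M Q"
proof -
  interpret M: left_module R M by fact
  show "left_module R Q"
  proof (rule left_moduleI)
    fix x assume "x \<in> carrier Q"
    then obtain a where a: "a \<in> carrier M" "x = q a" unfolding assms(2)[symmetric] by blast
    then show "\<exists>y\<in>carrier Q. y \<oplus>\<^bsub>Q\<^esub> x = \<zero>\<^bsub>Q\<^esub>"
      unfolding assms(2,3)[symmetric]
      by (intro bexI[of _ "q (\<ominus>\<^bsub>M\<^esub> a)"]) (auto simp: add M.M.l_neg)
  qed (unfold assms(2,3)[symmetric], auto simp: add smult left_moduleD(1)[OF assms(1)] M.M.a_ac M.smult_l_distr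
      M.smult_r_distr M.smult_assoc1)
  show "q \<in> mod_hom R M Q"
    by (rule mod_homI) (auto simp: add smult assms(2)[symmetric])
qed

text \<open>
  The scalar action on a coset is a union over its elements; all members of that union coincide because \<open>H\<close> is
  stable under scalars.
\<close>

lemma quot_module:
  assumes "left_module R M" "submodule H R M"
  defines "q \<equiv> \<lambda>x. H +>\<^bsub>M\<^esub> x"
  shows "left_module R (quot_module M H)" "q \<in> mod_hom R M (quot_module M H)"
    "q ` carrier M = carrier (quot_module M H)"
    "\<And>x y. \<lbrakk>x \<in> carrier M; y \<in> carrier M\<rbrakk> \<Longrightarrow> q x = q y \<longleftrightarrow> x \<ominus>\<^bsub>M\<^esub> y \<in> H"
    "\<And>x. x \<in> carrier M \<Longrightarrow> q x = \<zero>\<^bsub>quot_module M H\<^esub> \<longleftrightarrow> x \<in> H"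
proof -
  interpret M: left_module R M by fact
  note H = submoduleD[OF assms(2)]
  interpret H: abelian_subgroup H M
    by (rule abelian_subgroupI3) (auto intro: additive_subgroup.intro H(6) M.M.abelian_group_axioms)
  show 4: "q x = q y \<longleftrightarrow> x \<ominus>\<^bsub>M\<^esub> y \<in> H" if xy: "x \<in> carrier M" "y \<in> carrier M" for x y
  proof -
    have "q x = q y \<longleftrightarrow> x \<in> H +>\<^bsub>M\<^esub> y"
      unfolding q_def using xy H.a_rcos_self[of x] H.a_repr_independence'[of x y] by auto
    also have "\<dots> \<longleftrightarrow> x \<ominus>\<^bsub>M\<^esub> y \<in> H"
      unfolding a_minus_def by (rule H.a_rcos_module[OF xy(2,1)])
    finally show ?thesis .
  qed
  have qz: "q \<zero>\<^bsub>M\<^esub> = \<zero>\<^bsub>quot_module M H\<^esub>"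
    using H(1) by (simp add: q_def quot_module_def)
  show "q x = \<zero>\<^bsub>quot_module M H\<^esub> \<longleftrightarrow> x \<in> H" if "x \<in> carrier M" for x
    using that 4[of x "\<zero>\<^bsub>M\<^esub>"] unfolding qz by simp
  show 3: "q ` carrier M = carrier (quot_module M H)"
    by (auto simp: q_def quot_module_def A_RCOSETS_def')
  have add: "q x \<oplus>\<^bsub>quot_module M H\<^esub> q y = q (x \<oplus>\<^bsub>M\<^esub> y)" if "x \<in> carrier M" "y \<in> carrier M" for x y
    using H.a_rcos_sum[OF that] by (simp add: q_def quot_module_def)
  have sm: "r \<odot>\<^bsub>quot_module M H\<^esub> q x = q (r \<odot>\<^bsub>M\<^esub> x)" if r: "r \<in> carrier R" "x \<in> carrier M" for r x
  proof -
    have "q (r \<odot>\<^bsub>M\<^esub> y) = q (r \<odot>\<^bsub>M\<^esub> x)" if y: "y \<in> q x" for y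
    proof -
      obtain h where h: "h \<in> H" "y = h \<oplus>\<^bsub>M\<^esub> x" using y by (auto simp: q_def a_r_coset_def')
      then have hc: "h \<in> carrier M" using H(1) by auto
      have "r \<odot>\<^bsub>M\<^esub> y \<ominus>\<^bsub>M\<^esub> r \<odot>\<^bsub>M\<^esub> x = r \<odot>\<^bsub>M\<^esub> h"
        using h(2) hc r by (simp add: M.smult_r_distr a_minus_def M.M.a_assoc M.M.r_neg)
      then show ?thesis
        using H(4)[OF r(1) h(1)] hc r h(2) by (subst 4) auto
    qed
    moreover have "x \<in> q x" unfolding q_def by (rule H.a_rcos_self[OF r(2)])
    ultimately have "(\<Union>y\<in>q x. q (r \<odot>\<^bsub>M\<^esub> y)) = q (r \<odot>\<^bsub>M\<^esub> x)" by blast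
    then show ?thesis by (simp add: q_def quot_module_def)
  qed
  note L = left_module_surjective_image[OF assms(1) 3 qz add sm]
  show "left_module R (quot_module M H)" "q \<in> mod_hom R M (quot_module M H)"
    by (rule L; assumption)+
qed

section \<open>Complexes and the cohomology of their duals\<close>

definition complex_of where
  "complex_of R P d \<longleftrightarrow> (\<forall>i. left_module R (P i)) \<and> (\<forall>i. d i \<in> mod_hom R (P (Suc i)) (P i)) \<and>
     (\<forall>i. \<forall>x\<in>carrier (P (Suc (Suc i))). d i (d (Suc i) x) = \<zero>\<^bsub>P i\<^esub>)"

text \<open>
  Exactness of \<open>Hom(P, R)\<close> in degree \<open>i\<close>, stated with functionals that are not required to be extensional. In degree \<open>0\<close> it
  says that there are no nonzero cocycles.
\<close>

definition dual_exact ::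
  "('a, 'c) ring_scheme \<Rightarrow> (nat \<Rightarrow> ('a, 'p) module) \<Rightarrow> (nat \<Rightarrow> 'p \<Rightarrow> 'p) \<Rightarrow> nat \<Rightarrow> bool" where
  "dual_exact R P d i \<longleftrightarrow> (\<forall>f\<in>functionals R (P i). (\<forall>x\<in>carrier (P (Suc i)). f (d i x) = \<zero>\<^bsub>R\<^esub>) \<longrightarrow>
     (case i of 0 \<Rightarrow> \<forall>x\<in>carrier (P 0). f x = \<zero>\<^bsub>R\<^esub>
      | Suc j \<Rightarrow> \<exists>g\<in>functionals R (P j). \<forall>x\<in>carrier (P (Suc j)). f x = g (d j x)))"

lemma dual_exact_0:
  assumes "dual_exact R P d 0" "f \<in> functionals R (P 0)"
    "\<And>x. x \<in> carrier (P (Suc 0)) \<Longrightarrow> f (d 0 x) = \<zero>\<^bsub>R\<^esub>" "x \<in> carrier (P 0)"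
  shows "f x = \<zero>\<^bsub>R\<^esub>"
  using assms unfolding dual_exact_def by auto

lemma dual_exact_Suc:
  assumes "dual_exact R P d (Suc j)" "f \<in> functionals R (P (Suc j))"
    "\<And>x. x \<in> carrier (P (Suc (Suc j))) \<Longrightarrow> f (d (Suc j) x) = \<zero>\<^bsub>R\<^esub>"
  shows "\<exists>g\<in>functionals R (P j). \<forall>x\<in>carrier (P (Suc j)). f x = g (d j x)"
  using assms unfolding dual_exact_def by auto

lemma dual_cohomology_facts:
  fixes R :: "('a, 'c) ring_scheme" and P :: "nat \<Rightarrow> ('a, 'p) module"
  assumes "complex_of R P d"
  shows "left_module (op_ring R) ((dual_module R (P i))\<lparr>carrier := cocycles R P d i\<rparr>)"
    and "submodule (cocycles R P d i) (op_ring R) (dual_module R (P i))"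
    and "submodule (coboundaries R P d i) (op_ring R) ((dual_module R (P i))\<lparr>carrier := cocycles R P d i\<rparr>)"
proof -
  let ?D = "\<lambda>i. dual_module R (P i)"
  have P: "left_module R (P i)" and d: "d i \<in> mod_hom R (P (Suc i)) (P i)"
    and dd: "x \<in> carrier (P (Suc (Suc i))) \<Longrightarrow> d i (d (Suc i) x) = \<zero>\<^bsub>P i\<^esub>" for i x
    using assms unfolding complex_of_def by auto
  have R: "ring R" by (rule left_moduleD[OF P])
  note LD = left_module_dual[OF P]
  define \<delta> :: "nat \<Rightarrow> ('p \<Rightarrow> 'a) \<Rightarrow> 'p \<Rightarrow> 'a" where "\<delta> i = dual_map (P (Suc i)) (d i)" for i
  have \<delta>: "\<delta> i \<in> mod_hom (op_ring R) (?D i) (?D (Suc i))" for i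
    unfolding \<delta>_def by (rule dual_map_hom[OF P P d])
  have cc: "cocycles R P d i = mod_ker (?D i) (?D (Suc i)) (\<delta> i)" for i
  proof -
    interpret D': left_module "op_ring R" "?D (Suc i)" by (rule LD)
    have "(\<forall>x\<in>carrier (P (Suc i)). f (d i x) = \<zero>\<^bsub>R\<^esub>) \<longleftrightarrow> \<delta> i f = \<zero>\<^bsub>?D (Suc i)\<^esub>" if "f \<in> carrier (?D i)" for f
    proof
      assume "\<forall>x\<in>carrier (P (Suc i)). f (d i x) = \<zero>\<^bsub>R\<^esub>"
      then show "\<delta> i f = \<zero>\<^bsub>?D (Suc i)\<^esub>"
        by (intro dual_module_eqI[OF mod_hom_closed[OF \<delta> that] D'.zero_closed]) (auto simp: \<delta>_def dual_map_def dual_module_simps(2))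
    next
      assume z: "\<delta> i f = \<zero>\<^bsub>?D (Suc i)\<^esub>"
      show "\<forall>x\<in>carrier (P (Suc i)). f (d i x) = \<zero>\<^bsub>R\<^esub>"
      proof
        fix x assume "x \<in> carrier (P (Suc i))"
        then show "f (d i x) = \<zero>\<^bsub>R\<^esub>"
          using fun_cong[OF z, of x] by (simp add: \<delta>_def dual_map_def dual_module_simps(2))
      qed
    qed
    then show ?thesis by (auto simp: cocycles_def mod_ker_def)
  qed
  show Z: "submodule (cocycles R P d i) (op_ring R) (?D i)" for i
    unfolding cc by (rule submodule_mod_ker[OF LD LD \<delta>])
  show "left_module (op_ring R) ((?D i)\<lparr>carrier := cocycles R P d i\<rparr>)"
    by (rule left_module_submodule[OF LD Z])
  have "submodule (coboundaries R P d i) (op_ring R) (?D i) \<and> coboundaries R P d i \<subseteq> cocycles R P d i"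
  proof (cases i)
    case 0
    then show ?thesis
      using submodule_zero[OF LD[of 0]] submoduleD(2)[OF Z[of 0]] by simp
  next
    case (Suc j)
    have im: "coboundaries R P d (Suc j) = \<delta> j ` carrier (?D j)" by (simp add: \<delta>_def dual_map_def[abs_def])
    have "\<delta> j g \<in> cocycles R P d (Suc j)" if g: "g \<in> carrier (?D j)" for g
    proof -
      have "\<delta> j g (d (Suc j) x) = \<zero>\<^bsub>R\<^esub>" if "x \<in> carrier (P (Suc (Suc j)))" for x
        using g mod_hom_zero[OF P left_module_regular[OF R], of g]
        by (simp add: \<delta>_def dual_map_def mod_hom_closed[OF d that] dd[OF that] dual_module_simps)
      then show ?thesis using mod_hom_closed[OF \<delta> g] by (simp add: cocycles_def)
    qed
    then show ?thesis
      using submodule_image[OF LD LD \<delta>, of j] unfolding Suc im by blast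
  qed
  then show "submodule (coboundaries R P d i) (op_ring R) ((?D i)\<lparr>carrier := cocycles R P d i\<rparr>)"
    unfolding submodule_in_submodule[OF LD Z] .
qed

text \<open>Passage between functionals and their extensional restrictions.\<close>

lemma dual_cohomology_trivial_iff:
  assumes "complex_of R P d"
  shows "carrier (dual_cohomology R P d i) = {\<zero>\<^bsub>dual_cohomology R P d i\<^esub>} \<longleftrightarrow> dual_exact R P d i"
proof -
  let ?D = "dual_module R (P i)"
  let ?Z = "?D\<lparr>carrier := cocycles R P d i\<rparr>"
  have P: "left_module R (P i)" and d: "d i \<in> mod_hom R (P (Suc i)) (P i)" for i
    using assms unfolding complex_of_def by auto
  note F = dual_cohomology_facts[OF assms, of i]
  note Q = quot_module[OF F(1,3)]
  interpret Z: left_module "op_ring R" ?Z by (rule F(1))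
  have "carrier (dual_cohomology R P d i) = {\<zero>\<^bsub>dual_cohomology R P d i\<^esub>} \<longleftrightarrow> cocycles R P d i \<subseteq> coboundaries R P d i"
  proof -
    let ?q = "\<lambda>x. coboundaries R P d i +>\<^bsub>?Z\<^esub> x"
    have ne: "carrier ?Z \<noteq> {}" using Z.M.zero_closed by blast
    have "?q ` carrier ?Z = {z} \<longleftrightarrow> (\<forall>x\<in>carrier ?Z. ?q x = z)" for z
      using ne by (auto simp: image_constant_conv)
    then have "?q ` carrier ?Z = {\<zero>\<^bsub>quot_module ?Z (coboundaries R P d i)\<^esub>} \<longleftrightarrow>
      (\<forall>x\<in>carrier ?Z. x \<in> coboundaries R P d i)"
      using Q(5) by simp
    then show ?thesis unfolding dual_cohomology_def Q(3)[symmetric] by auto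
  qed
  also have "\<dots> \<longleftrightarrow> dual_exact R P d i"
  proof
    assume sub: "cocycles R P d i \<subseteq> coboundaries R P d i"
    show "dual_exact R P d i"
      unfolding dual_exact_def
    proof (intro ballI impI)
      fix f assume f: "f \<in> functionals R (P i)" "\<forall>x\<in>carrier (P (Suc i)). f (d i x) = \<zero>\<^bsub>R\<^esub>"
      have "restrict f (carrier (P i)) \<in> cocycles R P d i"
        using f restrict_in_dual[OF P f(1)] mod_hom_closed[OF d] by (simp add: cocycles_def)
      then have fB: "restrict f (carrier (P i)) \<in> coboundaries R P d i" using sub by blast
      show "case i of 0 \<Rightarrow> \<forall>x\<in>carrier (P 0). f x = \<zero>\<^bsub>R\<^esub>
        | Suc j \<Rightarrow> \<exists>g\<in>functionals R (P j). \<forall>x\<in>carrier (P (Suc j)). f x = g (d j x)"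
      proof (cases i)
        case 0
        then have eq: "restrict f (carrier (P 0)) = \<zero>\<^bsub>dual_module R (P 0)\<^esub>" using fB by simp
        have "f x = \<zero>\<^bsub>R\<^esub>" if "x \<in> carrier (P 0)" for x
          using fun_cong[OF eq, of x] that by (simp add: dual_module_simps)
        then show ?thesis using 0 by simp
      next
        case (Suc j)
        then obtain g where g: "g \<in> carrier (dual_module R (P j))"
          "restrict f (carrier (P (Suc j))) = (\<lambda>x\<in>carrier (P (Suc j)). g (d j x))" using fB by auto
        have "f x = g (d j x)" if "x \<in> carrier (P (Suc j))" for x
          using fun_cong[OF g(2), of x] that by simp
        moreover have "g \<in> functionals R (P j)" using g(1) by (simp add: dual_module_simps)
        ultimately show ?thesis using Suc by auto
      qed
    qed
  next
    assume ex: "dual_exact R P d i"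
    show "cocycles R P d i \<subseteq> coboundaries R P d i"
    proof
      fix f assume "f \<in> cocycles R P d i"
      then have f: "f \<in> carrier ?D" "f \<in> functionals R (P i)" "\<And>x. x \<in> carrier (P (Suc i)) \<Longrightarrow> f (d i x) = \<zero>\<^bsub>R\<^esub>"
        by (auto simp: cocycles_def dual_module_simps)
      show "f \<in> coboundaries R P d i"
      proof (cases i)
        case 0
        interpret D: left_module "op_ring R" "dual_module R (P 0)" by (rule left_module_dual[OF P])
        have "f = \<zero>\<^bsub>dual_module R (P 0)\<^esub>"
        proof (rule dual_module_eqI[OF f(1)[unfolded 0] D.zero_closed])
          fix x assume x: "x \<in> carrier (P 0)"
          show "f x = \<zero>\<^bsub>dual_module R (P 0)\<^esub> x"
            using dual_exact_0[OF ex[unfolded 0] f(2)[unfolded 0] f(3)[unfolded 0] x] x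
            by (simp add: dual_module_simps(2))
        qed
        then show ?thesis using 0 by simp
      next
        case (Suc j)
        obtain g where g: "g \<in> functionals R (P j)" "\<forall>x\<in>carrier (P (Suc j)). f x = g (d j x)"
          using dual_exact_Suc[OF ex[unfolded Suc] f(2)[unfolded Suc] f(3)[unfolded Suc]] by (rule bexE)
        have "f = (\<lambda>x\<in>carrier (P (Suc j)). restrict g (carrier (P j)) (d j x))"
        proof (rule extensionalityI)
          show "f \<in> extensional (carrier (P (Suc j)))" using f(1) unfolding Suc by (simp add: dual_module_simps)
          show "f x = (\<lambda>x\<in>carrier (P (Suc j)). restrict g (carrier (P j)) (d j x)) x"
            if "x \<in> carrier (P (Suc j))" for x
            using bspec[OF g(2) that] mod_hom_closed[OF d that] that by simp
        qed (rule restrict_extensional)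
        then show ?thesis
          using restrict_in_dual[OF P g(1)] unfolding Suc coboundaries.simps by (rule image_eqI)
      qed
    qed
  qed
  finally show ?thesis .
qed

lemma projective_resolution_complex:
  assumes "projective_resolution R M P d e"
  shows "complex_of R P d"
proof -
  have P: "left_module R (P i)" and d: "d i \<in> mod_hom R (P (Suc i)) (P i)" for i
    using assms fg_projective_left_module unfolding projective_resolution_def by auto
  have "d (Suc i) x \<in> mod_ker (P (Suc i)) (P i) (d i)" if "x \<in> carrier (P (Suc (Suc i)))" for i x
    using assms that unfolding projective_resolution_def by blast
  then show ?thesis using P d unfolding complex_of_def by (auto simp: mod_ker_def)
qed

section \<open>Comparison of resolutions\<close>

text \<open>
  The comparison theorem for a complex of projectives over an exact augmented complex. The invariant of the recursion is that the composite with
  the boundary lands in the image of the next boundary, which is what makes the next lift exist.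
\<close>

lemma chain_map_exists:
  assumes Q: "\<And>i. fg_projective R (Q i)" "complex_of R Q \<gamma>"
    and g: "g \<in> mod_hom R (Q 0) N" "\<And>x. x \<in> carrier (Q (Suc 0)) \<Longrightarrow> g (\<gamma> 0 x) = \<zero>\<^bsub>N\<^esub>"
    and P: "complex_of R P d" and N: "left_module R N" and e: "e \<in> mod_hom R (P 0) N"
    and im: "g ` carrier (Q 0) \<subseteq> e ` carrier (P 0)"
    and ex0: "mod_ker (P 0) N e \<subseteq> d 0 ` carrier (P 1)"
    and ex: "\<And>i. exact_at P d i"
  shows "\<exists>\<phi>. (\<forall>i. \<phi> i \<in> mod_hom R (Q i) (P i)) \<and> (\<forall>x\<in>carrier (Q 0). e (\<phi> 0 x) = g x) \<and>
    (\<forall>i. \<forall>x\<in>carrier (Q (Suc i)). d i (\<phi> (Suc i) x) = \<phi> i (\<gamma> i x))"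
proof -
  have LQ: "left_module R (Q i)" and \<gamma>: "\<gamma> i \<in> mod_hom R (Q (Suc i)) (Q i)"
    and \<gamma>\<gamma>: "x \<in> carrier (Q (Suc (Suc i))) \<Longrightarrow> \<gamma> i (\<gamma> (Suc i) x) = \<zero>\<^bsub>Q i\<^esub>" for i x
    using Q(2) unfolding complex_of_def by auto
  have LP: "left_module R (P i)" and d: "d i \<in> mod_hom R (P (Suc i)) (P i)" for i
    using P unfolding complex_of_def by auto

  let ?ok = "\<lambda>i f. f \<in> mod_hom R (Q i) (P i) \<and>
    (i = 0 \<longrightarrow> (\<forall>x\<in>carrier (Q 0). e (f x) = g x)) \<and> (\<forall>x\<in>carrier (Q (Suc i)). f (\<gamma> i x) \<in> d i ` carrier (P (Suc i)))"
  have "\<exists>\<phi>. \<forall>i. ?ok i (\<phi> i) \<and> (\<forall>x\<in>carrier (Q (Suc i)). d i (\<phi> (Suc i) x) = \<phi> i (\<gamma> i x))"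
  proof (rule dependent_nat_choice)
    obtain f where f: "f \<in> mod_hom R (Q 0) (P 0)" "\<forall>x\<in>carrier (Q 0). e (f x) = g x"
      using fg_projective_lift[OF Q(1) LP N g(1) e im] by (rule bexE)
    have "f (\<gamma> 0 x) \<in> d 0 ` carrier (P (Suc 0))" if "x \<in> carrier (Q (Suc 0))" for x
      using f(2) g(2)[OF that] mod_hom_closed[OF f(1)] mod_hom_closed[OF \<gamma> that] ex0
      by (auto simp: mod_ker_def)
    with f show "\<exists>f. ?ok 0 f" by blast
  next
    fix f i assume f: "?ok i f"
    then have fh: "f \<in> mod_hom R (Q i) (P i)"
      and fim: "(\<lambda>x. f (\<gamma> i x)) ` carrier (Q (Suc i)) \<subseteq> d i ` carrier (P (Suc i))" by auto
    obtain h where h: "h \<in> mod_hom R (Q (Suc i)) (P (Suc i))" "\<forall>x\<in>carrier (Q (Suc i)). d i (h x) = f (\<gamma> i x)"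
      using fg_projective_lift[OF Q(1) LP LP mod_hom_comp[OF \<gamma> fh] d fim] by (rule bexE)
    have "h (\<gamma> (Suc i) x) \<in> d (Suc i) ` carrier (P (Suc (Suc i)))" if "x \<in> carrier (Q (Suc (Suc i)))" for x
    proof -
      have y: "\<gamma> (Suc i) x \<in> carrier (Q (Suc i))" by (rule mod_hom_closed[OF \<gamma> that])
      then have "d i (h (\<gamma> (Suc i) x)) = \<zero>\<^bsub>P i\<^esub>"
        using h(2) \<gamma>\<gamma>[OF that] mod_hom_zero[OF LQ LP fh] by simp
      then show ?thesis using ex[of i] mod_hom_closed[OF h(1) y] by (auto simp: mod_ker_def)
    qed
    with h show "\<exists>h. ?ok (Suc i) h \<and> (\<forall>x\<in>carrier (Q (Suc i)). d i (h x) = f (\<gamma> i x))" by blast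
  qed
  then obtain \<phi> where "\<forall>i. ?ok i (\<phi> i) \<and> (\<forall>x\<in>carrier (Q (Suc i)). d i (\<phi> (Suc i) x) = \<phi> i (\<gamma> i x))"
    by (rule exE)
  then show ?thesis by (intro exI[of _ \<phi>]) simp
qed

text \<open>
  A chain map that induces zero on the augmentation modules is null homotopic. The invariant of the recursion
  says that the next difference is a cycle.
\<close>

lemma null_homotopy_exists:
  assumes Q: "\<And>i. fg_projective R (Q i)" "complex_of R Q \<gamma>"
    and P: "complex_of R P d"
    and \<theta>: "\<And>i. \<theta> i \<in> mod_hom R (Q i) (P i)" "\<And>i x. x \<in> carrier (Q (Suc i)) \<Longrightarrow> d i (\<theta> (Suc i) x) = \<theta> i (\<gamma> i x)"
    and im: "\<theta> 0 ` carrier (Q 0) \<subseteq> d 0 ` carrier (P (Suc 0))"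
    and ex: "\<And>i. exact_at P d i"
  shows "\<exists>h. (\<forall>i. h i \<in> mod_hom R (Q i) (P (Suc i))) \<and> (\<forall>x\<in>carrier (Q 0). \<theta> 0 x = d 0 (h 0 x)) \<and>
    (\<forall>i. \<forall>x\<in>carrier (Q (Suc i)). \<theta> (Suc i) x = d (Suc i) (h (Suc i) x) \<oplus>\<^bsub>P (Suc i)\<^esub> h i (\<gamma> i x))"
proof -
  have LQ: "left_module R (Q i)" and \<gamma>: "\<gamma> i \<in> mod_hom R (Q (Suc i)) (Q i)"
    and \<gamma>\<gamma>: "x \<in> carrier (Q (Suc (Suc i))) \<Longrightarrow> \<gamma> i (\<gamma> (Suc i) x) = \<zero>\<^bsub>Q i\<^esub>" for i x
    using Q(2) unfolding complex_of_def by auto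
  have LP: "left_module R (P i)" and d: "d i \<in> mod_hom R (P (Suc i)) (P i)" for i
    using P unfolding complex_of_def by auto
  let ?ok = "\<lambda>i h. h \<in> mod_hom R (Q i) (P (Suc i)) \<and> (i = 0 \<longrightarrow> (\<forall>x\<in>carrier (Q 0). \<theta> 0 x = d 0 (h x))) \<and>
    (\<forall>x\<in>carrier (Q (Suc i)). d i (h (\<gamma> i x)) = \<theta> i (\<gamma> i x))"
  let ?next = "\<lambda>i h h'. \<forall>x\<in>carrier (Q (Suc i)). \<theta> (Suc i) x = d (Suc i) (h' x) \<oplus>\<^bsub>P (Suc i)\<^esub> h (\<gamma> i x)"
  have "\<exists>h. \<forall>i. ?ok i (h i) \<and> ?next i (h i) (h (Suc i))"
  proof (rule dependent_nat_choice)
    obtain f where f: "f \<in> mod_hom R (Q 0) (P (Suc 0))" "\<forall>x\<in>carrier (Q 0). d 0 (f x) = \<theta> 0 x"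
      using fg_projective_lift[OF Q(1) LP LP \<theta>(1) d im] by (rule bexE)
    then show "\<exists>h. ?ok 0 h"
      using mod_hom_closed[OF \<gamma>[of 0]] by (intro exI[of _ f]) simp
  next
    fix h i assume ok: "?ok i h"
    then have h: "h \<in> mod_hom R (Q i) (P (Suc i))" "\<And>x. x \<in> carrier (Q (Suc i)) \<Longrightarrow> d i (h (\<gamma> i x)) = \<theta> i (\<gamma> i x)" by auto
    interpret P: left_module R "P (Suc i)" by (rule LP)
    interpret P0: left_module R "P i" by (rule LP)
    let ?f = "\<lambda>x. \<theta> (Suc i) x \<ominus>\<^bsub>P (Suc i)\<^esub> h (\<gamma> i x)"
    have f: "?f \<in> mod_hom R (Q (Suc i)) (P (Suc i))"
      by (rule mod_hom_diff[OF LP \<theta>(1) mod_hom_comp[OF \<gamma> h(1)]])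
    have "?f x \<in> mod_ker (P (Suc i)) (P i) (d i)" if x: "x \<in> carrier (Q (Suc i))" for x
    proof -
      have c: "\<theta> (Suc i) x \<in> carrier (P (Suc i))" "h (\<gamma> i x) \<in> carrier (P (Suc i))" "\<theta> i (\<gamma> i x) \<in> carrier (P i)"
        by (rule mod_hom_closed[OF \<theta>(1) x], rule mod_hom_closed[OF mod_hom_comp[OF \<gamma> h(1)] x],
          rule mod_hom_closed[OF mod_hom_comp[OF \<gamma> \<theta>(1)] x])
      have "d i (?f x) = d i (\<theta> (Suc i) x) \<ominus>\<^bsub>P i\<^esub> d i (h (\<gamma> i x))"
        by (rule mod_hom_minus[OF LP LP d c(1,2)])
      also have "\<dots> = \<zero>\<^bsub>P i\<^esub>"
        unfolding \<theta>(2)[OF x] h(2)[OF x] a_minus_def by (rule P0.M.r_neg[OF c(3)])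
      finally show ?thesis using mod_hom_closed[OF f x] by (simp add: mod_ker_def)
    qed
    then have im: "?f ` carrier (Q (Suc i)) \<subseteq> d (Suc i) ` carrier (P (Suc (Suc i)))"
      using ex[of i] by blast
    obtain k where k: "k \<in> mod_hom R (Q (Suc i)) (P (Suc (Suc i)))" "\<forall>x\<in>carrier (Q (Suc i)). d (Suc i) (k x) = ?f x"
      using fg_projective_lift[OF Q(1) LP LP f d im] by (rule bexE)
    have "?next i h k"
    proof
      fix x assume x: "x \<in> carrier (Q (Suc i))"
      have c: "\<theta> (Suc i) x \<in> carrier (P (Suc i))" "h (\<gamma> i x) \<in> carrier (P (Suc i))"
        by (rule mod_hom_closed[OF \<theta>(1) x], rule mod_hom_closed[OF mod_hom_comp[OF \<gamma> h(1)] x])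
      show "\<theta> (Suc i) x = d (Suc i) (k x) \<oplus>\<^bsub>P (Suc i)\<^esub> h (\<gamma> i x)"
        unfolding bspec[OF k(2) x] a_minus_def using c by (simp add: P.M.a_assoc P.M.l_neg)
    qed
    moreover have "d (Suc i) (k (\<gamma> (Suc i) x)) = \<theta> (Suc i) (\<gamma> (Suc i) x)" if x: "x \<in> carrier (Q (Suc (Suc i)))" for x
    proof -
      have y: "\<gamma> (Suc i) x \<in> carrier (Q (Suc i))" by (rule mod_hom_closed[OF \<gamma> x])
      have "h (\<gamma> i (\<gamma> (Suc i) x)) = \<zero>\<^bsub>P (Suc i)\<^esub>" unfolding \<gamma>\<gamma>[OF x] by (rule mod_hom_zero[OF LQ LP h(1)])
      then show ?thesis
        unfolding bspec[OF k(2) y] using mod_hom_closed[OF \<theta>(1) y] by simp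
    qed
    ultimately show "\<exists>k. ?ok (Suc i) k \<and> ?next i h k" using k(1) by blast
  qed
  then obtain h where "\<forall>i. ?ok i (h i) \<and> ?next i (h i) (h (Suc i))" by (rule exE)
  then show ?thesis by (intro exI[of _ h]) simp
qed

text \<open>
  Chain maps \<open>\<phi>\<close> and \<open>\<psi>\<close> between the two resolutions over the identity of \<open>M\<close> compose to a map that is homotopic to the
  identity. Hence a cocycle \<open>f\<close> on \<open>Q\<close> differs from \<open>f \<circ> \<psi> \<circ> \<phi>\<close> by a coboundary, while \<open>f \<circ> \<psi>\<close> is a
  cocycle on \<open>P\<close>, hence a coboundary.
\<close>

lemma dual_exact_transfer:
  assumes P: "projective_resolution R M P d e" and Q: "projective_resolution R M Q \<gamma> \<epsilon>" and M: "left_module R M"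
    and ex: "dual_exact R P d i"
  shows "dual_exact R Q \<gamma> i"
proof -
  note PD = P[unfolded projective_resolution_def] and QD = Q[unfolded projective_resolution_def]
  note cP = projective_resolution_complex[OF P] and cQ = projective_resolution_complex[OF Q]
  have LQ: "left_module R (Q i)" and \<gamma>: "\<gamma> i \<in> mod_hom R (Q (Suc i)) (Q i)"
    and LP: "left_module R (P i)" and d: "d i \<in> mod_hom R (P (Suc i)) (P i)" for i
    using cP cQ unfolding complex_of_def by auto
  have R: "ring R" by (rule left_moduleD[OF M])
  note LR = left_module_regular[OF R]
  interpret R: ring R by (rule R)
  have z: "x \<in> carrier (P (Suc 0)) \<Longrightarrow> e (d 0 x) = \<zero>\<^bsub>M\<^esub>" "y \<in> carrier (Q (Suc 0)) \<Longrightarrow> \<epsilon> (\<gamma> 0 y) = \<zero>\<^bsub>M\<^esub>" for x y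
  proof -
    show "x \<in> carrier (P (Suc 0)) \<Longrightarrow> e (d 0 x) = \<zero>\<^bsub>M\<^esub>"
      using PD imageI[of x "carrier (P 1)" "d 0"] by (auto simp: mod_ker_def)
    show "y \<in> carrier (Q (Suc 0)) \<Longrightarrow> \<epsilon> (\<gamma> 0 y) = \<zero>\<^bsub>M\<^esub>"
      using QD imageI[of y "carrier (Q 1)" "\<gamma> 0"] by (auto simp: mod_ker_def)
  qed
  obtain \<phi> where \<phi>: "\<forall>i. \<phi> i \<in> mod_hom R (Q i) (P i)" "\<forall>x\<in>carrier (Q 0). e (\<phi> 0 x) = \<epsilon> x"
    "\<forall>i. \<forall>x\<in>carrier (Q (Suc i)). d i (\<phi> (Suc i) x) = \<phi> i (\<gamma> i x)"
    using chain_map_exists[of R Q \<gamma> \<epsilon> M P d e] PD QD cP cQ M z by auto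
  obtain \<psi> where \<psi>: "\<forall>i. \<psi> i \<in> mod_hom R (P i) (Q i)" "\<forall>x\<in>carrier (P 0). \<epsilon> (\<psi> 0 x) = e x"
    "\<forall>i. \<forall>x\<in>carrier (P (Suc i)). \<gamma> i (\<psi> (Suc i) x) = \<psi> i (d i x)"
    using chain_map_exists[of R P d e M Q \<gamma> \<epsilon>] PD QD cP cQ M z by auto
  note \<phi>h = spec[OF \<phi>(1)] and \<psi>h = spec[OF \<psi>(1)]
  note \<phi>c = mod_hom_closed[OF \<phi>h] and \<psi>c = mod_hom_closed[OF \<psi>h] and \<gamma>c = mod_hom_closed[OF \<gamma>]
  have \<phi>\<gamma>: "d i (\<phi> (Suc i) x) = \<phi> i (\<gamma> i x)" if "x \<in> carrier (Q (Suc i))" for i x using \<phi>(3) that by blast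
  have \<psi>d: "\<gamma> i (\<psi> (Suc i) x) = \<psi> i (d i x)" if "x \<in> carrier (P (Suc i))" for i x using \<psi>(3) that by blast
  let ?\<theta> = "\<lambda>i x. \<psi> i (\<phi> i x) \<ominus>\<^bsub>Q i\<^esub> x"
  have \<theta>h: "?\<theta> i \<in> mod_hom R (Q i) (Q i)" for i
    by (rule mod_hom_diff[OF LQ mod_hom_comp[OF \<phi>h \<psi>h] mod_hom_id])
  have \<theta>c: "\<gamma> i (?\<theta> (Suc i) x) = ?\<theta> i (\<gamma> i x)" if x: "x \<in> carrier (Q (Suc i))" for i x
    by (subst mod_hom_minus[OF LQ LQ \<gamma> \<psi>c[OF \<phi>c[OF x]] x]) (simp add: \<psi>d[OF \<phi>c[OF x]] \<phi>\<gamma>[OF x])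
  have "?\<theta> 0 x \<in> mod_ker (Q 0) M \<epsilon>" if x: "x \<in> carrier (Q 0)" for x
  proof -
    have \<epsilon>: "\<epsilon> \<in> mod_hom R (Q 0) M" using QD by blast
    interpret M: left_module R M by (rule M)
    have "\<epsilon> (?\<theta> 0 x) = \<epsilon> x \<ominus>\<^bsub>M\<^esub> \<epsilon> x"
      using \<phi>(2) \<psi>(2) \<phi>c[OF x] x by (subst mod_hom_minus[OF LQ M \<epsilon> \<psi>c[OF \<phi>c[OF x]] x]) simp
    then show ?thesis
      using mod_hom_closed[OF \<theta>h x] mod_hom_closed[OF \<epsilon> x] by (simp add: mod_ker_def a_minus_def M.M.r_neg)
  qed
  then have im: "?\<theta> 0 ` carrier (Q 0) \<subseteq> \<gamma> 0 ` carrier (Q (Suc 0))" using QD by auto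
  obtain h where h: "\<forall>i. h i \<in> mod_hom R (Q i) (Q (Suc i))" "\<forall>x\<in>carrier (Q 0). ?\<theta> 0 x = \<gamma> 0 (h 0 x)"
    "\<forall>i. \<forall>x\<in>carrier (Q (Suc i)). ?\<theta> (Suc i) x = \<gamma> (Suc i) (h (Suc i) x) \<oplus>\<^bsub>Q (Suc i)\<^esub> h i (\<gamma> i x)"
    using null_homotopy_exists[of R Q \<gamma> Q \<gamma> ?\<theta>, OF _ cQ cQ \<theta>h \<theta>c im] QD by auto
  note hh = spec[OF h(1)]
  note hc = mod_hom_closed[OF hh]
  have key: "f (\<psi> i (\<phi> i x)) \<ominus>\<^bsub>R\<^esub> f x = f (?\<theta> i x)"
    if "f \<in> functionals R (Q i)" "x \<in> carrier (Q i)" for f i x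
    using mod_hom_minus[OF LQ LR that(1) \<psi>c[OF \<phi>c[OF that(2)]] that(2)]
    by (simp add: a_minus_def)

  show ?thesis
    unfolding dual_exact_def
  proof (intro ballI impI)
    fix f assume f: "f \<in> functionals R (Q i)" "\<forall>x\<in>carrier (Q (Suc i)). f (\<gamma> i x) = \<zero>\<^bsub>R\<^esub>"
    have k: "f (\<psi> i (d i x)) = \<zero>\<^bsub>R\<^esub>" if "x \<in> carrier (P (Suc i))" for x
      using bspec[OF f(2) \<psi>c[OF that]] \<psi>d[OF that] by simp
    have fc: "f x \<in> carrier R" if "x \<in> carrier (Q i)" for x
      using mod_hom_closed[OF f(1) that] by simp
    note f\<psi> = mod_hom_comp[OF \<psi>h f(1)]
    show "case i of 0 \<Rightarrow> \<forall>x\<in>carrier (Q 0). f x = \<zero>\<^bsub>R\<^esub>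
      | Suc j \<Rightarrow> \<exists>g\<in>functionals R (Q j). \<forall>x\<in>carrier (Q (Suc j)). f x = g (\<gamma> j x)"
    proof (cases i)
      case 0
      have "f x = \<zero>\<^bsub>R\<^esub>" if x: "x \<in> carrier (Q 0)" for x
      proof -
        have "f (\<psi> 0 (\<phi> 0 x)) = \<zero>\<^bsub>R\<^esub>"
          using dual_exact_0[OF ex[unfolded 0] f\<psi>[unfolded 0] _ \<phi>c[OF x]] k[unfolded 0] by simp
        moreover have "f (?\<theta> 0 x) = \<zero>\<^bsub>R\<^esub>"
          using h(2) f(2)[unfolded 0] x hc[of x 0] by simp
        ultimately have "\<ominus>\<^bsub>R\<^esub> f x = \<zero>\<^bsub>R\<^esub>"
          using key[OF f(1)[unfolded 0] x] fc[unfolded 0, OF x] by (simp add: a_minus_def)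
        then show ?thesis using fc[unfolded 0, OF x] R.minus_minus[of "f x"] by simp
      qed
      then show ?thesis by (simp add: 0)
    next
      case (Suc j)
      obtain g where g: "g \<in> functionals R (P j)" "\<forall>x\<in>carrier (P (Suc j)). f (\<psi> (Suc j) x) = g (d j x)"
        using dual_exact_Suc[OF ex[unfolded Suc] f\<psi>[unfolded Suc]] k[unfolded Suc] by auto

      have fhj: "(\<lambda>x. f (h j x)) \<in> functionals R (Q j)" by (rule mod_hom_comp[OF hh f(1)[unfolded Suc]])
      have G: "(\<lambda>y. g (\<phi> j y) \<ominus>\<^bsub>R\<^esub> f (h j y)) \<in> functionals R (Q j)"
        using mod_hom_diff[OF LR mod_hom_comp[OF \<phi>h g(1)] fhj] by (simp add: a_minus_def)
      have "f x = g (\<phi> j (\<gamma> j x)) \<ominus>\<^bsub>R\<^esub> f (h j (\<gamma> j x))" if x: "x \<in> carrier (Q (Suc j))" for x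
      proof -
        note y = \<gamma>c[OF x]
        have c: "f x \<in> carrier R" "f (h j (\<gamma> j x)) \<in> carrier R" "g (\<phi> j (\<gamma> j x)) \<in> carrier R"
          using fc[unfolded Suc, OF x] mod_hom_closed[OF fhj y] mod_hom_closed[OF g(1) \<phi>c[OF y]] by auto
        have "f (?\<theta> (Suc j) x) = f (\<gamma> (Suc j) (h (Suc j) x)) \<oplus>\<^bsub>R\<^esub> f (h j (\<gamma> j x))"
          using h(3) x mod_hom_add[OF f(1)[unfolded Suc] \<gamma>c[OF hc[OF x]] hc[OF y]] by simp
        also have "\<dots> = f (h j (\<gamma> j x))"
          using f(2)[unfolded Suc] hc[OF x] c by simp
        finally have "f (h j (\<gamma> j x)) = f (\<psi> (Suc j) (\<phi> (Suc j) x)) \<ominus>\<^bsub>R\<^esub> f x"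
          using key[OF f(1)[unfolded Suc] x] by simp
        also have "f (\<psi> (Suc j) (\<phi> (Suc j) x)) = g (\<phi> j (\<gamma> j x))"
          using g(2) \<phi>c[OF x] \<phi>\<gamma>[OF x] by simp
        finally have eq: "f (h j (\<gamma> j x)) = g (\<phi> j (\<gamma> j x)) \<ominus>\<^bsub>R\<^esub> f x" .
        show ?thesis
          unfolding eq using c by (simp add: a_minus_def R.minus_add R.minus_minus R.r_neg2)
      qed
      then show ?thesis using G unfolding Suc by auto
    qed
  qed
qed

text \<open>One resolution computes all the modules \<open>Ext R M i\<close>, since the choice in their definition does not depend on \<open>i\<close>.\<close>

lemma Ext_resolution:
  fixes R :: "('a, 'c) ring_scheme" and M :: "('a, 'b) module"
  assumes "left_noetherian R" "fg_module R M"
  obtains P :: "nat \<Rightarrow> ('a, nat \<Rightarrow> 'a) module" and d e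
  where "projective_resolution R M P d e" "\<And>i. Ext R M i = dual_cohomology R P d i"
proof -
  let ?S = "SOME (P :: nat \<Rightarrow> ('a, nat \<Rightarrow> 'a) module, d, e). projective_resolution R M P d e"
  obtain P d e where S: "?S = (P, d, e)" by (cases ?S) auto
  have "\<exists>x :: (nat \<Rightarrow> ('a, nat \<Rightarrow> 'a) module) \<times> _ \<times> _. case x of (P, d, e) \<Rightarrow> projective_resolution R M P d e"
    using projective_resolution_exists[OF assms] by auto
  from someI_ex[OF this] have "projective_resolution R M P d e" unfolding S by simp
  moreover have "Ext R M i = dual_cohomology R P d i" for i by (simp add: Ext_def S)
  ultimately show thesis by (rule that)
qed

lemma Ext_vanishes_iff:
  assumes "left_noetherian R" "fg_module R M" "projective_resolution R M P d e"
  shows "Ext_vanishes R M i \<longleftrightarrow> dual_exact R P d i"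
proof -
  have M: "left_module R M" using assms(2) by (simp add: fg_module_def)
  obtain Q \<gamma> \<epsilon> where Q: "projective_resolution R M Q \<gamma> \<epsilon>" "\<And>i. Ext R M i = dual_cohomology R Q \<gamma> i"
    using Ext_resolution[OF assms(1,2)] by blast
  have "Ext_vanishes R M i \<longleftrightarrow> dual_exact R Q \<gamma> i"
    unfolding Ext_vanishes_def Q(2) by (rule dual_cohomology_trivial_iff[OF projective_resolution_complex[OF Q(1)]])
  also have "\<dots> \<longleftrightarrow> dual_exact R P d i"
    using dual_exact_transfer[OF Q(1) assms(3) M] dual_exact_transfer[OF assms(3) Q(1) M] by blast
  finally show ?thesis .
qed

section \<open>The dual of a resolution of Ext\<close>

text \<open>
  The properties of the dual \<open>N\<close> of a resolution \<open>L\<close> of \<open>H = Ext\<^sup>t\<^sup>+\<^sup>1(M, R)\<close>, numbered so that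
  \<open>N\<^sub>i = Hom(L\<^sub>t\<^sub>-\<^sub>i, R)\<close>, in terms of functionals on \<open>N\<close>. By reflexivity a functional on \<open>N\<^sub>t\<close> is an element of
  \<open>L\<^sub>0\<close>, and composition with \<open>\<beta>\<close> is a lift of \<open>L\<^sub>0 \<rightarrow> H\<close> to cocycles of \<open>Hom(F, R)\<close>. With this reading \<open>generate\<close>
  says that \<open>L\<^sub>0 \<rightarrow> H\<close> is onto; \<open>relations\<close> and \<open>relations_vanish\<close> say that its kernel is the image of \<open>L\<^sub>1\<close>.
  The latter two are restricted to positive \<open>t\<close>, as \<open>L\<^sub>1\<close> does not occur in \<open>N\<close> for \<open>t = 0\<close>. The assumption \<open>exact\<close> is
  where the vanishing of \<open>Ext\<^sup>j(H, R)\<close> for \<open>j < t\<close> enters.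
\<close>

locale coresolution =
  fixes R :: "('a, 'c) ring_scheme" and F :: "nat \<Rightarrow> ('a, 'p) module" and d and t
    and N :: "nat \<Rightarrow> ('a, 'n) module" and \<Delta> and \<beta>
  assumes projective: "fg_projective R (N i)"
    and complex: "complex_of R N \<Delta>"
    and bounded: "i > t \<Longrightarrow> carrier (N i) = {\<zero>\<^bsub>N i\<^esub>}"
    and exact: "exact_at N \<Delta> i"
    and dual_exact: "Suc i < t \<Longrightarrow> dual_exact R N \<Delta> (Suc i)"
    and augmentation_hom: "\<beta> \<in> mod_hom R (F (Suc t)) (N t)"
    and augmentation_boundary: "x \<in> carrier (F (Suc (Suc t))) \<Longrightarrow> \<beta> (d (Suc t) x) = \<zero>\<^bsub>N t\<^esub>"
    and generate: "\<lbrakk>f \<in> functionals R (F (Suc t));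
        \<And>x. x \<in> carrier (F (Suc (Suc t))) \<Longrightarrow> f (d (Suc t) x) = \<zero>\<^bsub>R\<^esub>\<rbrakk> \<Longrightarrow>
      \<exists>w\<in>functionals R (N t). \<exists>g\<in>functionals R (F t). \<forall>x\<in>carrier (F (Suc t)). f x = w (\<beta> x) \<oplus>\<^bsub>R\<^esub> g (d t x)"
    and relations: "\<lbrakk>t = Suc t'; v \<in> functionals R (N t); g \<in> functionals R (F t);
        \<And>x. x \<in> carrier (F (Suc t)) \<Longrightarrow> v (\<beta> x) = g (d t x)\<rbrakk> \<Longrightarrow>
      \<exists>w\<in>functionals R (N t'). \<forall>y\<in>carrier (N t). v y = w (\<Delta> t' y)"
    and relations_vanish: "\<lbrakk>t = Suc t'; w \<in> functionals R (N t')\<rbrakk> \<Longrightarrow>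
      \<exists>g\<in>functionals R (F t). \<forall>x\<in>carrier (F (Suc t)). w (\<Delta> t' (\<beta> x)) = g (d t x)"

lemmas coresolution_facts = coresolution.projective coresolution.complex coresolution.bounded coresolution.exact
  coresolution.dual_exact coresolution.augmentation_hom coresolution.augmentation_boundary coresolution.generate
  coresolution.relations coresolution.relations_vanish

lemma fg_projective_zero:
  assumes "left_module R N" "carrier N = {\<zero>\<^bsub>N\<^esub>}"
  shows "fg_projective R N"
proof -
  interpret left_module R N by fact
  have "dual_basis R N 0 p s" for p s
    using assms(2) by (simp add: dual_basis_def)
  then show ?thesis using assms(1) unfolding fg_projective_iff by blast
qed

text \<open>
  Exactness of \<open>N\<close> in degree \<open>i\<close> is exactness of \<open>Hom(L, S)\<close> in degree \<open>t - i\<close>, which is assumed. Exactness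
  of the dual of \<open>N\<close> is exactness of \<open>L\<close>, because \<open>L\<close> is reflexive.
\<close>

lemma reversed_dual_complex:
  fixes S :: "('a, 'c) ring_scheme"
  assumes L: "\<And>i. fg_projective S (L i)" "complex_of S L m"
    and ex: "\<And>i. exact_at L m i"
    and dx: "\<And>j. j < t \<Longrightarrow> dual_exact S L m j"
  shows "\<exists>N \<Delta>. (\<forall>i\<le>t. N i = dual_module S (L (t - i))) \<and>
      (\<forall>i<t. \<Delta> i = dual_map (L (t - i)) (m (t - Suc i))) \<and>
      (\<forall>i. fg_projective (op_ring S) (N i)) \<and> complex_of (op_ring S) N \<Delta> \<and> (\<forall>i>t. carrier (N i) = {\<zero>\<^bsub>N i\<^esub>}) \<and>
      (\<forall>i. exact_at N \<Delta> i) \<and>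
      (\<forall>j. Suc j < t \<longrightarrow> dual_exact (op_ring S) N \<Delta> (Suc j))"
proof -
  have LL: "left_module S (L i)" and m: "m i \<in> mod_hom S (L (Suc i)) (L i)"
    and mm: "x \<in> carrier (L (Suc (Suc i))) \<Longrightarrow> m i (m (Suc i) x) = \<zero>\<^bsub>L i\<^esub>" for i x
    using L(2) unfolding complex_of_def by auto
  let ?D = "\<lambda>j. dual_module S (L j)" and ?\<delta> = "\<lambda>j. dual_map (L (Suc j)) (m j)"
  note LD = left_module_dual[OF LL] and \<delta> = dual_map_hom[OF LL LL m]
  let ?Z = "(?D 0)\<lparr>carrier := {\<zero>\<^bsub>?D 0\<^esub>}\<rparr>"
  have Z: "left_module (op_ring S) ?Z"
    by (rule left_module_submodule[OF LD submodule_zero[OF LD]])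
  \<comment> \<open>The zero module above degree \<open>t\<close> has the type of the duals.\<close>
  define N where "N i = (if i \<le> t then ?D (t - i) else ?Z)" for i
  define \<Delta> where "\<Delta> i = (if i < t then dual_map (L (t - i)) (m (t - Suc i)) else (\<lambda>_. \<zero>\<^bsub>N i\<^esub>))" for i
  have N1: "N (Suc i) = ?D (t - Suc i)" "N i = ?D (Suc (t - Suc i))" "\<Delta> i = ?\<delta> (t - Suc i)" if "i < t" for i
    using that by (auto simp: N_def \<Delta>_def Suc_diff_Suc)
  have LN: "left_module (op_ring S) (N i)" for i using LD Z by (simp add: N_def)
  have Nz: "carrier (N i) = {\<zero>\<^bsub>N i\<^esub>}" if "i > t" for i using that by (simp add: N_def)
  have pN: "fg_projective (op_ring S) (N i)" for i
  proof (cases "i \<le> t")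
    case True
    then show ?thesis using fg_projective_dual[OF L(1)] by (simp add: N_def)
  next
    case False
    then show ?thesis using fg_projective_zero[OF LN Nz] by simp
  qed
  have \<Delta>: "\<Delta> i \<in> mod_hom (op_ring S) (N (Suc i)) (N i)" for i
  proof (cases "i < t")
    case True
    then show ?thesis using \<delta>[of "t - Suc i"] by (simp only: N1)
  next
    case False
    then show ?thesis using mod_hom_const_zero[OF LN] by (simp add: \<Delta>_def)
  qed
  have \<Delta>z: "\<Delta> i \<zero>\<^bsub>N (Suc i)\<^esub> = \<zero>\<^bsub>N i\<^esub>" for i by (rule mod_hom_zero[OF LN LN \<Delta>])
  have cx: "\<Delta> i (\<Delta> (Suc i) x) = \<zero>\<^bsub>N i\<^esub>" if x: "x \<in> carrier (N (Suc (Suc i)))" for i x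
  proof (cases "Suc i < t")
    case True
    define j where "j = t - Suc (Suc i)"
    have j: "t - Suc i = Suc j" using True by (simp add: j_def)
    have i: "i < t" using True by simp
    have xD: "x \<in> carrier (?D j)" using x N1(1)[OF True] by (simp add: j_def)
    then have xf: "x \<in> functionals S (L j)" by (simp add: dual_module_simps)
    interpret D: left_module "op_ring S" "?D (Suc (Suc j))" by (rule LD)
    have "?\<delta> (Suc j) (?\<delta> j x) = \<zero>\<^bsub>?D (Suc (Suc j))\<^esub>"
    proof (rule dual_module_eqI[OF mod_hom_closed[OF \<delta> mod_hom_closed[OF \<delta> xD]] D.zero_closed])
      fix l assume l: "l \<in> carrier (L (Suc (Suc j)))"
      show "?\<delta> (Suc j) (?\<delta> j x) l = \<zero>\<^bsub>?D (Suc (Suc j))\<^esub> l"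
        using l mm[OF l] mod_hom_closed[OF m l] functional_zero[OF LL xf]
        by (simp add: dual_map_def dual_module_simps(2))
    qed
    then show ?thesis unfolding N1(3)[OF True] N1(2,3)[OF i] j unfolding j_def[symmetric] .
  next
    case False
    then have "\<Delta> (Suc i) x = \<zero>\<^bsub>N (Suc i)\<^esub>" by (simp add: \<Delta>_def)
    then show ?thesis using \<Delta>z by simp
  qed
  have exN: "exact_at N \<Delta> i" for i
  proof
    fix f assume f: "f \<in> mod_ker (N (Suc i)) (N i) (\<Delta> i)"
    interpret N: left_module "op_ring S" "N (Suc (Suc i))" by (rule LN)
    have zero: "f \<in> \<Delta> (Suc i) ` carrier (N (Suc (Suc i)))" if "f = \<zero>\<^bsub>N (Suc i)\<^esub>"
      using \<Delta>z[of "Suc i"] that N.zero_closed by (metis imageI)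
    show "f \<in> \<Delta> (Suc i) ` carrier (N (Suc (Suc i)))"
    proof (cases "i < t")
      case False
      then show ?thesis using f Nz[of "Suc i"] by (intro zero) (auto simp: mod_ker_def)
    next
      case True
      let ?j = "t - Suc i"
      have fD: "f \<in> carrier (?D ?j)" and f0: "?\<delta> ?j f = \<zero>\<^bsub>?D (Suc ?j)\<^esub>"
        using f unfolding N1[OF True] by (auto simp: mod_ker_def)
      have ff: "f \<in> functionals S (L ?j)" using fD by (simp add: dual_module_simps)
      have fm: "f (m ?j l) = \<zero>\<^bsub>S\<^esub>" if l: "l \<in> carrier (L (Suc ?j))" for l
        using fun_cong[OF f0, of l] l by (simp add: dual_map_def dual_module_simps(2))
      have dxj: "dual_exact S L m ?j" using True by (intro dx) simp
      show ?thesis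
      proof (cases ?j)
        case 0
        interpret D: left_module "op_ring S" "?D 0" by (rule LD)
        have "f = \<zero>\<^bsub>?D 0\<^esub>"
        proof (rule dual_module_eqI[OF fD[unfolded 0] D.zero_closed])
          fix x assume x: "x \<in> carrier (L 0)"
          show "f x = \<zero>\<^bsub>?D 0\<^esub> x"
            using dual_exact_0[OF dxj[unfolded 0] ff[unfolded 0] fm[unfolded 0] x] x by (simp add: dual_module_simps(2))
        qed
        then show ?thesis using 0 by (intro zero) (simp add: N1(1)[OF True])
      next
        case (Suc j')
        obtain g where g: "g \<in> functionals S (L j')" "\<forall>x\<in>carrier (L (Suc j')). f x = g (m j' x)"
          using dual_exact_Suc[OF dxj[unfolded Suc] ff[unfolded Suc] fm[unfolded Suc]] by (rule bexE)
        have i: "Suc i < t" "t - Suc (Suc i) = j'" using Suc by auto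
        have rg: "restrict g (carrier (L j')) \<in> carrier (?D j')" by (rule restrict_in_dual[OF LL g(1)])
        have "f = ?\<delta> j' (restrict g (carrier (L j')))"
        proof (rule dual_module_eqI[OF fD[unfolded Suc] mod_hom_closed[OF \<delta> rg]])
          fix x assume x: "x \<in> carrier (L (Suc j'))"
          show "f x = ?\<delta> j' (restrict g (carrier (L j'))) x"
            using bspec[OF g(2) x] mod_hom_closed[OF m x] x by (simp add: dual_map_def)
        qed
        then show ?thesis
          using rg unfolding N1(1,3)[OF i(1)] i(2) by (rule image_eqI)
      qed
    qed
  qed
  have dxN: "dual_exact (op_ring S) N \<Delta> (Suc i)" if i: "Suc i < t" for i
    unfolding dual_exact_def
  proof (intro ballI impI, simp only: nat.case)
    define j where "j = t - Suc (Suc i)"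
    have j: "t - Suc i = Suc j" using i by (simp add: j_def)
    have i': "i < t" using i by simp
    note A = N1[OF i'] and B = N1[OF i]
    fix v assume v: "v \<in> functionals (op_ring S) (N (Suc i))"
      "\<forall>x\<in>carrier (N (Suc (Suc i))). v (\<Delta> (Suc i) x) = \<zero>\<^bsub>op_ring S\<^esub>"
    have v1: "v \<in> functionals (op_ring S) (?D (Suc j))" using v(1) by (simp only: A(1) j)
    have v2: "v (?\<delta> j f) = \<zero>\<^bsub>S\<^esub>" if "f \<in> carrier (?D j)" for f
      using v(2) that by (simp add: B(1,3) j_def[symmetric])
    obtain x where x: "x \<in> carrier (L (Suc j))" "\<forall>f\<in>carrier (?D (Suc j)). v f = f x"
      using dual_reflexive[OF L(1) v1] by (rule bexE)
    have "m j x = \<zero>\<^bsub>L j\<^esub>"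
    proof (rule functionals_separate[OF L(1) mod_hom_closed[OF m x(1)]])
      fix f assume f: "f \<in> functionals S (L j)"
      note rf = restrict_in_dual[OF LL f]
      have "v (?\<delta> j (restrict f (carrier (L j)))) = f (m j x)"
        using bspec[OF x(2) mod_hom_closed[OF \<delta> rf]] x(1) mod_hom_closed[OF m x(1)] by (simp add: dual_map_def)
      then show "f (m j x) = \<zero>\<^bsub>S\<^esub>" using v2[OF rf] by simp
    qed
    then have "x \<in> mod_ker (L (Suc j)) (L j) (m j)" using x(1) by (simp add: mod_ker_def)
    then have "x \<in> m (Suc j) ` carrier (L (Suc (Suc j)))" using ex[of j] by blast
    then obtain y where y: "x = m (Suc j) y" "y \<in> carrier (L (Suc (Suc j)))" by (rule imageE)
    show "\<exists>g\<in>functionals (op_ring S) (N i). \<forall>x\<in>carrier (N (Suc i)). v x = g (\<Delta> i x)"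
    proof (rule bexI, rule ballI)
      show "(\<lambda>f. f y) \<in> functionals (op_ring S) (N i)"
        unfolding A(2) j by (rule eval_functional[OF LL y(2)])
      fix f assume "f \<in> carrier (N (Suc i))"
      then have f: "f \<in> carrier (?D (Suc j))" by (simp only: A(1) j)
      show "v f = \<Delta> i f y"
        using bspec[OF x(2) f] y unfolding A(3) j by (simp add: dual_map_def)
    qed
  qed
  show ?thesis
  proof (rule exI[of _ N], rule exI[of _ \<Delta>], intro conjI allI impI)
    show "complex_of (op_ring S) N \<Delta>" using LN \<Delta> cx by (simp add: complex_of_def)
    show "N i = ?D (t - i)" if "i \<le> t" for i using that by (simp add: N_def)
    show "\<Delta> i = dual_map (L (t - i)) (m (t - Suc i))" if "i < t" for i using that by (simp add: \<Delta>_def)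
  qed (rule pN Nz exN dxN; assumption)+
qed

text \<open>
  The map \<open>\<eta>\<close> lifts \<open>L\<^sub>0 \<rightarrow> H\<close> to the cocycles on \<open>F\<^sub>t\<^sub>+\<^sub>1\<close>, and \<open>\<beta>\<close> is \<open>\<eta>\<close> with its two arguments exchanged.
\<close>

lemma coresolution_exists:
  fixes R :: "('a, 'c) ring_scheme" and F :: "nat \<Rightarrow> ('a, nat \<Rightarrow> 'a) module"
  assumes R: "right_noetherian R" and F: "\<And>i. fg_projective R (F i)" "complex_of R F d"
    and grade: "grade_ge (op_ring R) (dual_cohomology R F d (Suc t)) t"
  shows "\<exists>(N :: nat \<Rightarrow> ('a, (nat \<Rightarrow> 'a) \<Rightarrow> 'a) module) \<Delta> \<beta>. coresolution R F d t N \<Delta> \<beta>"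
proof -
  let ?S = "op_ring R"
  have LF: "left_module R (F i)" and d: "d i \<in> mod_hom R (F (Suc i)) (F i)"
    and dd: "x \<in> carrier (F (Suc (Suc i))) \<Longrightarrow> d i (d (Suc i) x) = \<zero>\<^bsub>F i\<^esub>" for i x
    using F(2) unfolding complex_of_def by auto
  have rR: "ring R" by (rule left_moduleD[OF LF])
  interpret R: ring R by (rule rR)
  let ?D = "dual_module R (F (Suc t))"
  let ?Z = "?D\<lparr>carrier := cocycles R F d (Suc t)\<rparr>" and ?B = "coboundaries R F d (Suc t)"
  let ?H = "dual_cohomology R F d (Suc t)"
  note C = dual_cohomology_facts[OF F(2), of "Suc t"]
  have nS: "left_noetherian ?S" using R by (simp add: right_noetherian_def)
  have H: "?H = quot_module ?Z ?B" by (simp add: dual_cohomology_def)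
  define q where "q x = ?B +>\<^bsub>?Z\<^esub> x" for x
  note Q = quot_module[OF C(1,3), folded q_def H]
  have qh: "q \<in> mod_hom ?S ?Z ?H" unfolding q_def[abs_def] H by (rule quot_module[OF C(1,3)])
  have qs: "q ` carrier ?Z = carrier ?H" unfolding q_def[abs_def] H by (rule quot_module[OF C(1,3)])
  interpret Z: left_module ?S ?Z by (rule C(1))
  have fgZ: "finitely_generated ?S ?Z"
    by (rule finitely_generated_submodule[OF nS fg_projective_fg_module[OF fg_projective_dual[OF F(1)]] C(2)])
  have fgH: "fg_module ?S ?H"
    unfolding fg_module_def using finitely_generated_image[OF C(1) Q(1) qh qs fgZ] Q(1) by blast
  obtain L :: "nat \<Rightarrow> ('a, nat \<Rightarrow> 'a) module" and m \<epsilon> where L: "projective_resolution ?S ?H L m \<epsilon>"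
    using projective_resolution_exists[OF nS fgH] by blast
  have dx: "dual_exact ?S L m j" if "j < t" for j
    using grade that unfolding grade_ge_def Ext_vanishes_iff[OF nS fgH L] by blast
  have Lp: "fg_projective ?S (L i)" and \<epsilon>: "\<epsilon> \<in> mod_hom ?S (L 0) ?H" "\<epsilon> ` carrier (L 0) = carrier ?H"
    "m 0 ` carrier (L 1) = mod_ker (L 0) ?H \<epsilon>"
    and Lex: "m (Suc i) ` carrier (L (Suc (Suc i))) = mod_ker (L (Suc i)) (L i) (m i)" for i
    using L unfolding projective_resolution_def by auto
  note cL = projective_resolution_complex[OF L]
  have LL: "left_module ?S (L i)" and m: "m i \<in> mod_hom ?S (L (Suc i)) (L i)" for i
    using cL unfolding complex_of_def by auto
  have Lex': "exact_at L m i" for i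
    unfolding Lex ..
  obtain N \<Delta> where NN: "(\<forall>i\<le>t. N i = dual_module ?S (L (t - i))) \<and>
      (\<forall>i<t. \<Delta> i = dual_map (L (t - i)) (m (t - Suc i))) \<and>
      (\<forall>i. fg_projective (op_ring ?S) (N i)) \<and> complex_of (op_ring ?S) N \<Delta> \<and> (\<forall>i>t. carrier (N i) = {\<zero>\<^bsub>N i\<^esub>}) \<and>
      (\<forall>i. exact_at N \<Delta> i) \<and>
      (\<forall>j. Suc j < t \<longrightarrow> dual_exact (op_ring ?S) N \<Delta> (Suc j))"
    by (rule exE[OF reversed_dual_complex[OF Lp cL Lex' dx]], assumption, elim exE) (rule that)
  note NN' = NN[unfolded op_ring_op_ring]
  note N = conjunct1[OF NN'] conjunct1[OF conjunct2[OF NN']]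
  note NN3 = conjunct2[OF conjunct2[OF NN']]
  note N2 = conjunct1[OF NN3] conjunct1[OF conjunct2[OF NN3]] conjunct1[OF conjunct2[OF conjunct2[OF NN3]]]
    conjunct1[OF conjunct2[OF conjunct2[OF conjunct2[OF NN3]]]] conjunct2[OF conjunct2[OF conjunct2[OF conjunct2[OF NN3]]]]
  have Nt: "N t = dual_module ?S (L 0)" using N(1) by simp
  have Nt': "N t' = dual_module ?S (L 1)" "\<Delta> t' = dual_map (L 1) (m 0)" if "t = Suc t'" for t'
    using N that by auto
  obtain \<eta> where \<eta>: "\<eta> \<in> mod_hom ?S (L 0) ?Z" "\<forall>l\<in>carrier (L 0). q (\<eta> l) = \<epsilon> l"
    using fg_projective_lift[OF Lp C(1) Q(1) \<epsilon>(1) qh] unfolding \<epsilon>(2) qs by blast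
  have \<eta>D: "\<eta> \<in> mod_hom ?S (L 0) ?D"
    using \<eta>(1) mod_hom_sub_iff[OF submoduleD(1)[OF C(2)]] by blast
  have \<eta>f: "\<eta> l \<in> functionals R (F (Suc t))" if "l \<in> carrier (L 0)" for l
    using mod_hom_closed[OF \<eta>D that] by (simp add: dual_module_simps)
  have \<eta>c: "\<eta> l (d (Suc t) x) = \<zero>\<^bsub>R\<^esub>" if "l \<in> carrier (L 0)" "x \<in> carrier (F (Suc (Suc t)))" for l x
    using mod_hom_closed[OF \<eta>(1) that(1)] that(2) by (simp add: cocycles_def)
  have ev: "(\<lambda>l. \<eta> l x) \<in> functionals ?S (L 0)" if "x \<in> carrier (F (Suc t))" for x
    by (rule mod_hom_comp[OF \<eta>D eval_functional[OF LF that]])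
  define \<beta> where "\<beta> x = restrict (\<lambda>l. \<eta> l x) (carrier (L 0))" for x
  have \<beta>D: "\<beta> x \<in> carrier (dual_module ?S (L 0))" if "x \<in> carrier (F (Suc t))" for x
    unfolding \<beta>_def by (rule restrict_in_dual[OF LL ev[OF that]])
  interpret N: left_module R "dual_module ?S (L 0)"
    using left_module_dual[OF LL, of 0] by simp
  interpret Ft: left_module R "F (Suc t)" by (rule LF)
  have \<beta>: "\<beta> \<in> mod_hom R (F (Suc t)) (N t)"
    unfolding Nt
  proof (rule mod_homI)
    fix x y assume x: "x \<in> carrier (F (Suc t))" and y: "y \<in> carrier (F (Suc t))"
    show "\<beta> (x \<oplus>\<^bsub>F (Suc t)\<^esub> y) = \<beta> x \<oplus>\<^bsub>dual_module ?S (L 0)\<^esub> \<beta> y"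
      by (rule dual_module_eqI[OF \<beta>D[OF Ft.M.a_closed[OF x y]] N.M.a_closed[OF \<beta>D[OF x] \<beta>D[OF y]]])
        (simp add: \<beta>_def dual_module_simps(3) functional_add[OF \<eta>f x y])
  next
    fix r x assume r: "r \<in> carrier R" and x: "x \<in> carrier (F (Suc t))"
    show "\<beta> (r \<odot>\<^bsub>F (Suc t)\<^esub> x) = r \<odot>\<^bsub>dual_module ?S (L 0)\<^esub> \<beta> x"
      by (rule dual_module_eqI[OF \<beta>D[OF Ft.smult_closed[OF r x]] N.smult_closed[OF r \<beta>D[OF x]]])
        (use mod_hom_smult[OF \<eta>f r x] in \<open>simp add: \<beta>_def dual_module_simps(4)\<close>)
  qed (rule \<beta>D)
  have \<beta>d: "\<beta> (d (Suc t) x) = \<zero>\<^bsub>N t\<^esub>" if x: "x \<in> carrier (F (Suc (Suc t)))" for x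
    unfolding Nt
    by (rule dual_module_eqI[OF \<beta>D[OF mod_hom_closed[OF d x]] N.M.zero_closed])
      (simp add: \<beta>_def dual_module_simps(2) \<eta>c x)
  have evN: "(\<lambda>f. f l) \<in> functionals R (dual_module ?S (L i))" if "l \<in> carrier (L i)" for l i
    using eval_functional[OF LL that] by simp
  have ref: "\<exists>l\<in>carrier (L i). \<forall>f\<in>carrier (dual_module ?S (L i)). v f = f l"
    if "v \<in> functionals R (dual_module ?S (L i))" for v i
    using dual_reflexive[OF Lp, of v i] that by simp
  have B: "?B = dual_map (F (Suc t)) (d t) ` carrier (dual_module R (F t))"
    by (simp add: dual_map_def[abs_def])
  have cob: "\<exists>g\<in>functionals R (F t). \<forall>x\<in>carrier (F (Suc t)). f x = g (d t x)" if "f \<in> ?B" for f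
  proof -
    obtain g where "f = dual_map (F (Suc t)) (d t) g" "g \<in> carrier (dual_module R (F t))"
      using \<open>f \<in> ?B\<close> unfolding B by (rule imageE)
    then show ?thesis by (intro bexI[of _ g]) (auto simp: dual_map_def dual_module_simps)
  qed
  have cobI: "f \<in> ?B" if f: "f \<in> carrier ?D" "g \<in> functionals R (F t)" "\<And>x. x \<in> carrier (F (Suc t)) \<Longrightarrow> f x = g (d t x)" for f g
  proof -
    note rg = restrict_in_dual[OF LF f(2)]
    have "f = dual_map (F (Suc t)) (d t) (restrict g (carrier (F t)))"
      using f(3) mod_hom_closed[OF d]
      by (intro dual_module_eqI[OF f(1) mod_hom_closed[OF dual_map_hom[OF LF LF d] rg]]) (simp add: dual_map_def)
    then show ?thesis unfolding B using rg by (rule image_eqI)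
  qed
  have gen: "\<exists>w\<in>functionals R (N t). \<exists>g\<in>functionals R (F t). \<forall>x\<in>carrier (F (Suc t)). f x = w (\<beta> x) \<oplus>\<^bsub>R\<^esub> g (d t x)"
    if f: "f \<in> functionals R (F (Suc t))" "\<forall>x\<in>carrier (F (Suc (Suc t))). f (d (Suc t) x) = \<zero>\<^bsub>R\<^esub>" for f
  proof -
    let ?f = "restrict f (carrier (F (Suc t)))"
    have fZ: "?f \<in> carrier ?Z"
      using restrict_in_dual[OF LF f(1)] f(2) mod_hom_closed[OF d] by (simp add: cocycles_def)
    have "q ?f \<in> \<epsilon> ` carrier (L 0)" unfolding \<epsilon>(2) by (rule mod_hom_closed[OF qh fZ])
    then obtain l where l: "q ?f = \<epsilon> l" "l \<in> carrier (L 0)" by (rule imageE)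
    note \<eta>Z = mod_hom_closed[OF \<eta>(1) l(2)]
    have "q ?f = q (\<eta> l)" using \<eta>(2) l by simp
    then have "?f \<ominus>\<^bsub>?Z\<^esub> \<eta> l \<in> ?B" using Q(4)[OF fZ \<eta>Z] by blast
    from cob[OF this] obtain g where g: "g \<in> functionals R (F t)"
      "\<forall>x\<in>carrier (F (Suc t)). (?f \<ominus>\<^bsub>?Z\<^esub> \<eta> l) x = g (d t x)" by (rule bexE)
    have el: "(\<lambda>f. f l) \<in> functionals R (N t)" unfolding Nt by (rule evN[OF l(2)])
    have "f x = \<beta> x l \<oplus>\<^bsub>R\<^esub> g (d t x)" if x: "x \<in> carrier (F (Suc t))" for x
    proof -
      have evZ: "(\<lambda>f. f x) \<in> functionals ?S ?Z"
        by (rule mod_hom_restrict_dom[OF eval_functional[OF LF x] submoduleD(1)[OF C(2)]])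
      have c: "\<eta> l x \<in> carrier R" "g (d t x) \<in> carrier R"
        using functional_closed[OF \<eta>f[OF l(2)] x] functional_closed[OF g(1) mod_hom_closed[OF d x]] by auto
      have "?f = (?f \<ominus>\<^bsub>?Z\<^esub> \<eta> l) \<oplus>\<^bsub>?Z\<^esub> \<eta> l"
        unfolding a_minus_def using fZ \<eta>Z by (subst Z.M.a_assoc) (auto simp only: Z.M.l_neg Z.M.r_zero Z.M.a_inv_closed)
      then have "?f x = ((?f \<ominus>\<^bsub>?Z\<^esub> \<eta> l) \<oplus>\<^bsub>?Z\<^esub> \<eta> l) x" by (rule fun_cong)
      also have "\<dots> = (?f \<ominus>\<^bsub>?Z\<^esub> \<eta> l) x \<oplus>\<^bsub>R\<^esub> \<eta> l x"
        using functional_add[OF evZ Z.M.minus_closed[OF fZ \<eta>Z] \<eta>Z] by simp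
      also have "\<dots> = \<beta> x l \<oplus>\<^bsub>R\<^esub> g (d t x)"
        using bspec[OF g(2) x] l(2) c by (simp add: \<beta>_def R.a_comm)
      finally show "f x = \<beta> x l \<oplus>\<^bsub>R\<^esub> g (d t x)" using x by simp
    qed
    then have eq: "\<forall>x\<in>carrier (F (Suc t)). f x = \<beta> x l \<oplus>\<^bsub>R\<^esub> g (d t x)" by (rule ballI)
    show ?thesis by (rule bexI[OF _ el], rule bexI[OF _ g(1)], rule eq)
  qed
  have C1: "\<exists>w\<in>functionals R (N t'). \<forall>y\<in>carrier (N t). v y = w (\<Delta> t' y)"
    if t': "t = Suc t'" and v: "v \<in> functionals R (N t)" and g: "g \<in> functionals R (F t)"
      "\<forall>x\<in>carrier (F (Suc t)). v (\<beta> x) = g (d t x)" for t' v g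
  proof -
    obtain l where l: "l \<in> carrier (L 0)" "\<forall>f\<in>carrier (dual_module ?S (L 0)). v f = f l"
      using ref[OF v[unfolded Nt]] by (rule bexE)
    have "\<eta> l \<in> ?B"
    proof (rule cobI[OF mod_hom_closed[OF \<eta>D l(1)] g(1)])
      fix x assume x: "x \<in> carrier (F (Suc t))"
      show "\<eta> l x = g (d t x)" using bspec[OF g(2) x] bspec[OF l(2) \<beta>D[OF x]] l(1) by (simp add: \<beta>_def)
    qed
    then have "q (\<eta> l) = \<zero>\<^bsub>?H\<^esub>" using Q(5)[OF mod_hom_closed[OF \<eta>(1) l(1)]] by blast
    then have "l \<in> mod_ker (L 0) ?H \<epsilon>" using \<eta>(2) l(1) by (simp add: mod_ker_def)
    then obtain y where y: "l = m 0 y" "y \<in> carrier (L 1)" unfolding \<epsilon>(3)[symmetric] by (rule imageE)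
    show ?thesis
    proof (rule bexI, rule ballI)
      show "(\<lambda>f. f y) \<in> functionals R (N t')" unfolding Nt'[OF t'] by (rule evN[OF y(2)])
      fix f assume "f \<in> carrier (N t)"
      then have "v f = f l" using l(2) unfolding Nt by blast
      then show "v f = \<Delta> t' f y" unfolding Nt'[OF t'] y(1) using y(2) by (simp add: dual_map_def)
    qed
  qed
  have C2: "\<exists>g\<in>functionals R (F t). \<forall>x\<in>carrier (F (Suc t)). w (\<Delta> t' (\<beta> x)) = g (d t x)"
    if t': "t = Suc t'" and w: "w \<in> functionals R (N t')" for t' w
  proof -
    obtain y where y: "y \<in> carrier (L 1)" "\<forall>f\<in>carrier (dual_module ?S (L 1)). w f = f y"
      using ref[OF w[unfolded Nt'[OF t']]] by (rule bexE)
    have my: "m 0 y \<in> carrier (L 0)" using mod_hom_closed[OF m[of 0]] y(1) by simp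
    have "m 0 y \<in> mod_ker (L 0) ?H \<epsilon>" unfolding \<epsilon>(3)[symmetric] using y(1) by (rule imageI)
    then have "q (\<eta> (m 0 y)) = \<zero>\<^bsub>?H\<^esub>" using \<eta>(2) my by (simp add: mod_ker_def)
    then have "\<eta> (m 0 y) \<in> ?B" using Q(5)[OF mod_hom_closed[OF \<eta>(1) my]] by blast
    from cob[OF this] obtain g where g: "g \<in> functionals R (F t)"
      "\<forall>x\<in>carrier (F (Suc t)). \<eta> (m 0 y) x = g (d t x)" by (rule bexE)
    have "w (\<Delta> t' (\<beta> x)) = g (d t x)" if x: "x \<in> carrier (F (Suc t))" for x
    proof -
      have "dual_map (L 1) (m 0) (\<beta> x) \<in> carrier (dual_module ?S (L 1))"
        using mod_hom_closed[OF dual_map_hom[OF LL LL m[of 0]] \<beta>D[OF x]] by simp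
      then have "w (\<Delta> t' (\<beta> x)) = dual_map (L 1) (m 0) (\<beta> x) y" using y(2) unfolding Nt'[OF t'] by blast
      then show ?thesis using bspec[OF g(2) x] y(1) my by (simp add: dual_map_def \<beta>_def)
    qed
    then show ?thesis using g(1) by blast
  qed
  have "coresolution R F d t N \<Delta> \<beta>"
  proof (rule coresolution.intro)
    fix i
    show "fg_projective R (N i)" by (rule spec[OF N2(1)])
    show "complex_of R N \<Delta>" by (rule N2(2))
    show "exact_at N \<Delta> i" by (rule spec[OF N2(4)])
    show "t < i \<Longrightarrow> carrier (N i) = {\<zero>\<^bsub>N i\<^esub>}" using N2(3) by simp
    show "Suc i < t \<Longrightarrow> dual_exact R N \<Delta> (Suc i)" using N2(5) by simp
    show "\<beta> \<in> mod_hom R (F (Suc t)) (N t)" by (rule \<beta>)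
    show "\<exists>w\<in>functionals R (N t). \<exists>g\<in>functionals R (F t). \<forall>x\<in>carrier (F (Suc t)). f x = w (\<beta> x) \<oplus>\<^bsub>R\<^esub> g (d t x)"
      if "f \<in> functionals R (F (Suc t))" "\<And>x. x \<in> carrier (F (Suc (Suc t))) \<Longrightarrow> f (d (Suc t) x) = \<zero>\<^bsub>R\<^esub>" for f
      by (rule gen[OF that(1)], rule ballI, rule that(2))
    show "\<exists>w\<in>functionals R (N t'). \<forall>y\<in>carrier (N t). v y = w (\<Delta> t' y)"
      if "t = Suc t'" "v \<in> functionals R (N t)" "g \<in> functionals R (F t)"
        "\<And>x. x \<in> carrier (F (Suc t)) \<Longrightarrow> v (\<beta> x) = g (d t x)" for t' v g
      by (rule C1[OF that(1-3)], rule ballI, rule that(4))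
  qed (rule \<beta>d C2; assumption)+
  then show ?thesis by blast
qed

lemma biproductD:
  assumes "biproduct R Q A B p q i j"
  shows "p \<in> mod_hom R Q A" "q \<in> mod_hom R Q B" "i \<in> mod_hom R A Q" "j \<in> mod_hom R B Q"
    "a \<in> carrier A \<Longrightarrow> p (i a) = a" "a \<in> carrier A \<Longrightarrow> q (i a) = \<zero>\<^bsub>B\<^esub>"
    "b \<in> carrier B \<Longrightarrow> p (j b) = \<zero>\<^bsub>A\<^esub>" "b \<in> carrier B \<Longrightarrow> q (j b) = b"
    "x \<in> carrier Q \<Longrightarrow> i (p x) \<oplus>\<^bsub>Q\<^esub> j (q x) = x"
  using assms by (auto simp: biproduct_def)

lemma biproduct_eqI:
  assumes "biproduct R Q A B p q i j" "x \<in> carrier Q" "y \<in> carrier Q" "p x = p y" "q x = q y"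
  shows "x = y"
proof -
  have "i (p x) \<oplus>\<^bsub>Q\<^esub> j (q x) = y"
    unfolding assms(4,5) by (rule biproductD(9)[OF assms(1,3)])
  then show ?thesis by (rule trans[OF sym[OF biproductD(9)[OF assms(1,2)]]])
qed

lemma biproduct_pair:
  assumes "biproduct R Q A B p q i j" "left_module R A" "left_module R B" "left_module R Q"
    "a \<in> carrier A" "b \<in> carrier B"
  shows "i a \<oplus>\<^bsub>Q\<^esub> j b \<in> carrier Q" "p (i a \<oplus>\<^bsub>Q\<^esub> j b) = a" "q (i a \<oplus>\<^bsub>Q\<^esub> j b) = b"
proof -
  interpret A: left_module R A by fact
  interpret B: left_module R B by fact
  interpret Q: left_module R Q by fact
  note b = biproductD[OF assms(1)]
  have c: "i a \<in> carrier Q" "j b \<in> carrier Q"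
    by (rule mod_hom_closed[OF b(3) assms(5)], rule mod_hom_closed[OF b(4) assms(6)])
  show "i a \<oplus>\<^bsub>Q\<^esub> j b \<in> carrier Q" using c by simp
  show "p (i a \<oplus>\<^bsub>Q\<^esub> j b) = a" "q (i a \<oplus>\<^bsub>Q\<^esub> j b) = b"
    using assms(5,6) b(5-8) mod_hom_add[OF b(1) c] mod_hom_add[OF b(2) c] by simp_all
qed

section \<open>Cones\<close>

text \<open>In coordinates: \<open>(x, u) \<mapsto> (\<delta> x, b x + \<Delta> u)\<close>.\<close>

definition cone_map where
  "cone_map Q N p q i j \<delta> \<Delta> b = (\<lambda>n x. i n (\<delta> n (p (Suc n) x)) \<oplus>\<^bsub>Q n\<^esub>
     j n (b n (p (Suc n) x) \<oplus>\<^bsub>N n\<^esub> \<Delta> n (q (Suc n) x)))"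

text \<open>
  The sign in \<open>rel\<close> makes the boundary \<open>(x, u) \<mapsto> (\<delta> x, b x + \<Delta> u)\<close> square to zero. The terms are
  arbitrary biproducts, which keeps the cone within the type of the given complex.
\<close>

locale cone =
  fixes R :: "('a, 'c) ring_scheme" and T :: "nat \<Rightarrow> ('a, 't) module" and \<delta>
    and N :: "nat \<Rightarrow> ('a, 'n) module" and \<Delta> and b and Q :: "nat \<Rightarrow> ('a, 'q) module" and p q i j
  assumes T: "complex_of R T \<delta>" and N: "complex_of R N \<Delta>"
    and b: "\<And>n. b n \<in> mod_hom R (T (Suc n)) (N n)"
    and rel: "\<And>n x. x \<in> carrier (T (Suc (Suc n))) \<Longrightarrow> b n (\<delta> (Suc n) x) \<oplus>\<^bsub>N n\<^esub> \<Delta> n (b (Suc n) x) = \<zero>\<^bsub>N n\<^esub>"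
    and Q: "\<And>n. left_module R (Q n)" and bp: "\<And>n. biproduct R (Q n) (T n) (N n) (p n) (q n) (i n) (j n)"
begin

abbreviation \<delta>' where "\<delta>' \<equiv> cone_map Q N p q i j \<delta> \<Delta> b"

lemma left_module_T: "left_module R (T n)" and \<delta>_hom: "\<delta> n \<in> mod_hom R (T (Suc n)) (T n)"
  and \<delta>\<delta>: "x \<in> carrier (T (Suc (Suc n))) \<Longrightarrow> \<delta> n (\<delta> (Suc n) x) = \<zero>\<^bsub>T n\<^esub>"
  using T unfolding complex_of_def by auto

lemma left_module_N: "left_module R (N n)" and \<Delta>_hom: "\<Delta> n \<in> mod_hom R (N (Suc n)) (N n)"
  and \<Delta>\<Delta>: "y \<in> carrier (N (Suc (Suc n))) \<Longrightarrow> \<Delta> n (\<Delta> (Suc n) y) = \<zero>\<^bsub>N n\<^esub>"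
  using N unfolding complex_of_def by auto

lemmas bp_facts = biproductD[OF bp]
lemmas pc = mod_hom_closed[OF bp_facts(1)] and qc = mod_hom_closed[OF bp_facts(2)] and ic = mod_hom_closed[OF bp_facts(3)]
  and jc = mod_hom_closed[OF bp_facts(4)] and \<delta>c = mod_hom_closed[OF \<delta>_hom] and \<Delta>c = mod_hom_closed[OF \<Delta>_hom] and bc = mod_hom_closed[OF b]

lemma second_hom: "(\<lambda>x. b n (p (Suc n) x) \<oplus>\<^bsub>N n\<^esub> \<Delta> n (q (Suc n) x)) \<in> mod_hom R (Q (Suc n)) (N n)"
  by (rule mod_hom_plus[OF left_module_N mod_hom_comp[OF bp_facts(1) b] mod_hom_comp[OF bp_facts(2) \<Delta>_hom]])

lemma \<delta>'_hom: "\<delta>' n \<in> mod_hom R (Q (Suc n)) (Q n)"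
  unfolding cone_map_def
  by (rule mod_hom_plus[OF Q mod_hom_comp[OF mod_hom_comp[OF bp_facts(1) \<delta>_hom] bp_facts(3)] mod_hom_comp[OF second_hom bp_facts(4)]])

lemmas \<delta>'c = mod_hom_closed[OF \<delta>'_hom]

lemma coordinates:
  assumes "x \<in> carrier (Q (Suc n))"
  shows "p n (\<delta>' n x) = \<delta> n (p (Suc n) x)" "q n (\<delta>' n x) = b n (p (Suc n) x) \<oplus>\<^bsub>N n\<^esub> \<Delta> n (q (Suc n) x)"
  unfolding cone_map_def
  using biproduct_pair[OF bp left_module_T left_module_N Q \<delta>c[OF pc[OF assms]] mod_hom_closed[OF second_hom assms]] by auto

lemma cone_complex: "complex_of R Q \<delta>'"
  unfolding complex_of_def
proof (intro conjI allI ballI Q \<delta>'_hom)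
  fix n x assume x: "x \<in> carrier (Q (Suc (Suc n)))"
  interpret N: left_module R "N n" by (rule left_module_N)
  interpret Q: left_module R "Q n" by (rule Q)
  note y = \<delta>'c[OF x]
  note px = pc[OF x] and qx = qc[OF x]
  have "\<Delta> n (q (Suc n) (\<delta>' (Suc n) x)) = \<Delta> n (b (Suc n) (p (Suc (Suc n)) x)) \<oplus>\<^bsub>N n\<^esub> \<Delta> n (\<Delta> (Suc n) (q (Suc (Suc n)) x))"
    unfolding coordinates(2)[OF x] by (rule mod_hom_add[OF \<Delta>_hom bc[OF px] \<Delta>c[OF qx]])
  also have "\<dots> = \<Delta> n (b (Suc n) (p (Suc (Suc n)) x))"
    using \<Delta>\<Delta>[OF qx] \<Delta>c[OF bc[OF px]] by simp
  finally have 1: "q n (\<delta>' n (\<delta>' (Suc n) x)) = \<zero>\<^bsub>N n\<^esub>"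
    unfolding coordinates(2)[OF y] coordinates(1)[OF x] using rel[OF px] by simp
  have 2: "p n (\<delta>' n (\<delta>' (Suc n) x)) = \<zero>\<^bsub>T n\<^esub>"
    unfolding coordinates(1)[OF y] coordinates(1)[OF x] by (rule \<delta>\<delta>[OF px])
  show "\<delta>' n (\<delta>' (Suc n) x) = \<zero>\<^bsub>Q n\<^esub>"
    by (rule biproduct_eqI[OF bp \<delta>'c[OF y] Q.M.zero_closed])
      (simp_all add: 1 2 mod_hom_zero[OF Q left_module_T bp_facts(1)] mod_hom_zero[OF Q left_module_N bp_facts(2)])
qed

text \<open>
  If \<open>(x, u)\<close> is a cycle, write \<open>x = \<delta> y\<close>. Subtracting the boundary of \<open>(y, 0)\<close> leaves \<open>(0, u - b y)\<close>, and
  \<open>u - b y\<close> is a cycle of \<open>N\<close>.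
\<close>

lemma cone_exact:
  assumes exT: "exact_at T \<delta> n"
    and exN: "exact_at N \<Delta> n"
  shows "exact_at Q \<delta>' n"
proof
  fix x assume "x \<in> mod_ker (Q (Suc n)) (Q n) (\<delta>' n)"
  then have x: "x \<in> carrier (Q (Suc n))" and x0: "\<delta>' n x = \<zero>\<^bsub>Q n\<^esub>" by (auto simp: mod_ker_def)
  interpret N: left_module R "N n" by (rule left_module_N)
  interpret N': left_module R "N (Suc n)" by (rule left_module_N)
  note px = pc[OF x] and qx = qc[OF x]
  have p0: "\<delta> n (p (Suc n) x) = \<zero>\<^bsub>T n\<^esub>"
    using coordinates(1)[OF x] mod_hom_zero[OF Q left_module_T bp_facts(1)] by (simp add: x0)
  have q0: "b n (p (Suc n) x) \<oplus>\<^bsub>N n\<^esub> \<Delta> n (q (Suc n) x) = \<zero>\<^bsub>N n\<^esub>"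
    using coordinates(2)[OF x] mod_hom_zero[OF Q left_module_N bp_facts(2)] by (simp add: x0)
  have "p (Suc n) x \<in> \<delta> (Suc n) ` carrier (T (Suc (Suc n)))"
    using exT px p0 by (auto simp: mod_ker_def)
  then obtain y where y: "p (Suc n) x = \<delta> (Suc n) y" "y \<in> carrier (T (Suc (Suc n)))" by (rule imageE)
  let ?z = "q (Suc n) x \<ominus>\<^bsub>N (Suc n)\<^esub> b (Suc n) y"
  have z: "?z \<in> carrier (N (Suc n))" using qx bc[OF y(2)] by simp
  have c: "\<Delta> n (q (Suc n) x) \<in> carrier (N n)" "\<Delta> n (b (Suc n) y) \<in> carrier (N n)" "b n (\<delta> (Suc n) y) \<in> carrier (N n)"
    by (rule \<Delta>c[OF qx], rule \<Delta>c[OF bc[OF y(2)]], rule bc[OF \<delta>c[OF y(2)]])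
  have "\<ominus>\<^bsub>N n\<^esub> b n (\<delta> (Suc n) y) = \<Delta> n (q (Suc n) x)"
    by (rule N.M.minus_equality[OF trans[OF N.M.a_comm[OF c(1,3)] q0[unfolded y(1)]] c(3,1)])
  moreover have "\<ominus>\<^bsub>N n\<^esub> b n (\<delta> (Suc n) y) = \<Delta> n (b (Suc n) y)"
    by (rule N.M.minus_equality[OF trans[OF N.M.a_comm[OF c(2,3)] rel[OF y(2)]] c(3,2)])
  ultimately have "\<Delta> n (q (Suc n) x) = \<Delta> n (b (Suc n) y)" by simp
  then have "\<Delta> n ?z = \<zero>\<^bsub>N n\<^esub>"
    using mod_hom_minus[OF left_module_N left_module_N \<Delta>_hom qx bc[OF y(2)]] c by (simp add: a_minus_def N.M.r_neg)
  then have "?z \<in> \<Delta> (Suc n) ` carrier (N (Suc (Suc n)))"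
    using exN z by (auto simp: mod_ker_def)
  then obtain u where u: "?z = \<Delta> (Suc n) u" "u \<in> carrier (N (Suc (Suc n)))" by (rule imageE)
  let ?w = "i (Suc (Suc n)) y \<oplus>\<^bsub>Q (Suc (Suc n))\<^esub> j (Suc (Suc n)) u"
  note w = biproduct_pair[OF bp left_module_T left_module_N Q y(2) u(2)]
  have "x = \<delta>' (Suc n) ?w"
  proof (rule biproduct_eqI[OF bp x \<delta>'c[OF w(1)]])
    show "p (Suc n) x = p (Suc n) (\<delta>' (Suc n) ?w)"
      unfolding coordinates(1)[OF w(1)] w(2) by (rule y(1))
    show "q (Suc n) x = q (Suc n) (\<delta>' (Suc n) ?w)"
      unfolding coordinates(2)[OF w(1)] w(2,3) u(1)[symmetric]
      unfolding a_minus_def using qx bc[OF y(2)] by (subst N'.M.a_lcomm) (simp_all add: N'.M.r_neg)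
  qed
  then show "x \<in> \<delta>' (Suc n) ` carrier (Q (Suc (Suc n)))" using w(1) by (rule image_eqI)
qed

text \<open>
  A functional on the cone is a pair \<open>(f, v)\<close>. The assumption is the statement for pairs, in which
  the biproducts no longer occur.
\<close>

lemma cone_dual_exact:
  assumes ex: "\<And>f v. \<lbrakk>f \<in> functionals R (T (Suc n)); v \<in> functionals R (N (Suc n));
      \<And>y. y \<in> carrier (T (Suc (Suc n))) \<Longrightarrow> f (\<delta> (Suc n) y) \<oplus>\<^bsub>R\<^esub> v (b (Suc n) y) = \<zero>\<^bsub>R\<^esub>;
      \<And>u. u \<in> carrier (N (Suc (Suc n))) \<Longrightarrow> v (\<Delta> (Suc n) u) = \<zero>\<^bsub>R\<^esub>\<rbrakk> \<Longrightarrow>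
    \<exists>g\<in>functionals R (T n). \<exists>w\<in>functionals R (N n).
      (\<forall>y\<in>carrier (T (Suc n)). f y = g (\<delta> n y) \<oplus>\<^bsub>R\<^esub> w (b n y)) \<and> (\<forall>u\<in>carrier (N (Suc n)). v u = w (\<Delta> n u))"
  shows "dual_exact R Q \<delta>' (Suc n)"
  unfolding dual_exact_def
proof (intro ballI impI, simp only: nat.case)
  fix h assume h: "h \<in> functionals R (Q (Suc n))" "\<forall>x\<in>carrier (Q (Suc (Suc n))). h (\<delta>' (Suc n) x) = \<zero>\<^bsub>R\<^esub>"
  have R: "ring R" by (rule left_moduleD[OF Q])
  interpret R: ring R by (rule R)
  let ?f = "\<lambda>y. h (i (Suc n) y)" and ?v = "\<lambda>u. h (j (Suc n) u)"
  have f: "?f \<in> functionals R (T (Suc n))" and v: "?v \<in> functionals R (N (Suc n))"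
    by (rule mod_hom_comp[OF bp_facts(3) h(1)], rule mod_hom_comp[OF bp_facts(4) h(1)])
  have hsum: "h x = ?f (p (Suc n) x) \<oplus>\<^bsub>R\<^esub> ?v (q (Suc n) x)" if x: "x \<in> carrier (Q (Suc n))" for x
    using functional_add[OF h(1) ic[OF pc[OF x]] jc[OF qc[OF x]]] bp_facts(9)[OF x] by simp
  have eq1: "?f (\<delta> (Suc n) (p (Suc (Suc n)) x)) \<oplus>\<^bsub>R\<^esub>
      ?v (b (Suc n) (p (Suc (Suc n)) x) \<oplus>\<^bsub>N (Suc n)\<^esub> \<Delta> (Suc n) (q (Suc (Suc n)) x)) = \<zero>\<^bsub>R\<^esub>"
    if x: "x \<in> carrier (Q (Suc (Suc n)))" for x
    using bspec[OF h(2) x] hsum[OF \<delta>'c[OF x]] by (simp only: coordinates[OF x])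
  have f1: "?f (\<delta> (Suc n) y) \<oplus>\<^bsub>R\<^esub> ?v (b (Suc n) y) = \<zero>\<^bsub>R\<^esub>" if y: "y \<in> carrier (T (Suc (Suc n)))" for y
  proof -
    interpret N: left_module R "N (Suc n)" by (rule left_module_N)
    show ?thesis
      using eq1[OF ic[OF y]] bc[OF y] by (simp add: bp_facts(5,6) y mod_hom_zero[OF left_module_N left_module_N \<Delta>_hom])
  qed
  have v1: "?v (\<Delta> (Suc n) u) = \<zero>\<^bsub>R\<^esub>" if u: "u \<in> carrier (N (Suc (Suc n)))" for u
  proof -
    interpret N: left_module R "N (Suc n)" by (rule left_module_N)
    have "?f (\<delta> (Suc n) \<zero>\<^bsub>T (Suc (Suc n))\<^esub>) = \<zero>\<^bsub>R\<^esub>"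
      using functional_zero[OF left_module_T f] mod_hom_zero[OF left_module_T left_module_T \<delta>_hom] by simp
    then show ?thesis
      using eq1[OF jc[OF u]] \<Delta>c[OF u] functional_closed[OF v \<Delta>c[OF u]] by (simp add: bp_facts(7,8) u mod_hom_zero[OF left_module_T left_module_N b])
  qed
  obtain g where g: "g \<in> functionals R (T n)" "\<exists>w\<in>functionals R (N n).
      (\<forall>y\<in>carrier (T (Suc n)). ?f y = g (\<delta> n y) \<oplus>\<^bsub>R\<^esub> w (b n y)) \<and> (\<forall>u\<in>carrier (N (Suc n)). ?v u = w (\<Delta> n u))"
    using ex[OF f v f1 v1] by (rule bexE)
  from g(2) obtain w where w: "w \<in> functionals R (N n)"
      "(\<forall>y\<in>carrier (T (Suc n)). ?f y = g (\<delta> n y) \<oplus>\<^bsub>R\<^esub> w (b n y)) \<and> (\<forall>u\<in>carrier (N (Suc n)). ?v u = w (\<Delta> n u))"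
    by (rule bexE)
  have G: "(\<lambda>x. g (p n x) \<oplus>\<^bsub>R\<^esub> w (q n x)) \<in> functionals R (Q n)"
    by (rule functional_plus[OF R mod_hom_comp[OF bp_facts(1) g(1)] mod_hom_comp[OF bp_facts(2) w(1)]])
  have "h x = g (p n (\<delta>' n x)) \<oplus>\<^bsub>R\<^esub> w (q n (\<delta>' n x))" if x: "x \<in> carrier (Q (Suc n))" for x
  proof -
    note px = pc[OF x] and qx = qc[OF x]
    have c: "g (\<delta> n (p (Suc n) x)) \<in> carrier R" "w (b n (p (Suc n) x)) \<in> carrier R" "w (\<Delta> n (q (Suc n) x)) \<in> carrier R"
      by (rule functional_closed[OF g(1) \<delta>c[OF px]], rule functional_closed[OF w(1) bc[OF px]],
        rule functional_closed[OF w(1) \<Delta>c[OF qx]])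
    have "?f (p (Suc n) x) = g (\<delta> n (p (Suc n) x)) \<oplus>\<^bsub>R\<^esub> w (b n (p (Suc n) x))" using w(2) px by blast
    moreover have "?v (q (Suc n) x) = w (\<Delta> n (q (Suc n) x))" using w(2) qx by blast
    ultimately show ?thesis
      using hsum[OF x] c by (simp add: coordinates[OF x] functional_add[OF w(1) bc[OF px] \<Delta>c[OF qx]] R.a_assoc)
  qed
  then show "\<exists>g\<in>functionals R (Q n). \<forall>x\<in>carrier (Q (Suc n)). h x = g (\<delta>' n x)"
    by (intro bexI[OF _ G] ballI)
qed

end

section \<open>Making the dual exact one degree further\<close>

text \<open>
  The agreement with \<open>F\<close> from degree \<open>t\<close> on is literal, so that the cohomology of \<open>Hom(T, R)\<close> in degree \<open>t + 1\<close> is that of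
  \<open>Hom(F, R)\<close>.
\<close>

locale approximation_stage =
  fixes R :: "('a, 'c) ring_scheme" and F :: "nat \<Rightarrow> ('a, 'p) module" and d and t
    and T :: "nat \<Rightarrow> ('a, 'p) module" and \<delta> and \<pi>
  assumes projective: "fg_projective R (T i)"
    and complex: "complex_of R T \<delta>"
    and exact: "exact_at T \<delta> i"
    and modules_agree: "i \<ge> t \<Longrightarrow> T i = F i"
    and projection_id: "\<lbrakk>i \<ge> t; x \<in> carrier (F i)\<rbrakk> \<Longrightarrow> \<pi> i x = x"
    and boundary_agrees: "\<lbrakk>i \<ge> t; x \<in> carrier (F (Suc i))\<rbrakk> \<Longrightarrow> \<delta> i x = d i x"
    and dual_exact: "i < t \<Longrightarrow> dual_exact R T \<delta> (Suc i)"
    and projection_hom: "\<pi> i \<in> mod_hom R (T i) (F i)"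
    and projection_onto: "\<pi> i ` carrier (T i) = carrier (F i)"
    and projection_chain: "x \<in> carrier (T (Suc i)) \<Longrightarrow> d i (\<pi> (Suc i) x) = \<pi> i (\<delta> i x)"

lemmas stage_facts = approximation_stage.projective approximation_stage.complex approximation_stage.exact
  approximation_stage.modules_agree approximation_stage.projection_id approximation_stage.boundary_agrees
  approximation_stage.dual_exact approximation_stage.projection_hom approximation_stage.projection_onto
  approximation_stage.projection_chain

text \<open>
  The maps \<open>b n\<close> are the transpose of a chain map from the resolution \<open>L\<close> of \<open>Ext\<^sup>t\<^sup>+\<^sup>1(M, R)\<close> to \<open>Hom(T, R)\<close>. They
  are constructed by descending induction on \<open>n\<close>, starting with \<open>\<beta>\<close> in degree \<open>t\<close> and zero above.
\<close>

lemma stage_connecting_maps: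
  assumes st: "approximation_stage R F d t T \<delta> \<pi>" and co: "coresolution R F d t N \<Delta> \<beta>"
  shows "\<exists>b. (\<forall>n. b n \<in> mod_hom R (T (Suc n)) (N n)) \<and>
    (\<forall>n. \<forall>x\<in>carrier (T (Suc (Suc n))). b n (\<delta> (Suc n) x) \<oplus>\<^bsub>N n\<^esub> \<Delta> n (b (Suc n) x) = \<zero>\<^bsub>N n\<^esub>) \<and>
    b t = \<beta>"
proof -
  note S = stage_facts[OF st] and C = coresolution_facts[OF co]
  have left_module_T: "left_module R (T n)" and \<delta>: "\<delta> n \<in> mod_hom R (T (Suc n)) (T n)" for n
    using S(2) unfolding complex_of_def by auto
  have left_module_N: "left_module R (N n)" and \<Delta>: "\<Delta> n \<in> mod_hom R (N (Suc n)) (N n)"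
    and \<Delta>\<Delta>: "y \<in> carrier (N (Suc (Suc n))) \<Longrightarrow> \<Delta> n (\<Delta> (Suc n) y) = \<zero>\<^bsub>N n\<^esub>" for n y
    using C(2) unfolding complex_of_def by auto
  have R: "ring R" by (rule left_moduleD[OF left_module_T])
  interpret R: ring R by (rule R)
  define Pr where "Pr k b \<longleftrightarrow> (\<forall>n\<ge>k. b n \<in> mod_hom R (T (Suc n)) (N n)) \<and>
    (\<forall>n\<ge>k. \<forall>x\<in>carrier (T (Suc (Suc n))). b n (\<delta> (Suc n) x) \<oplus>\<^bsub>N n\<^esub> \<Delta> n (b (Suc n) x) = \<zero>\<^bsub>N n\<^esub>) \<and> b t = \<beta>" for k b
  have "\<exists>b. Pr 0 b"
  proof (rule inc_induct[of 0 t])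
    let ?b = "\<lambda>n. if n = t then \<beta> else (\<lambda>_. \<zero>\<^bsub>N n\<^esub>)"
    have Tt: "T (Suc t) = F (Suc t)" "T (Suc (Suc t)) = F (Suc (Suc t))" by (rule S(4), simp)+
    have h: "?b n \<in> mod_hom R (T (Suc n)) (N n)" for n
    proof (cases "n = t")
      case True
      then show ?thesis using C(6) Tt(1) by simp
    next
      case False
      then show ?thesis using mod_hom_const_zero[OF left_module_N[of n], of "T (Suc n)"] by simp
    qed
    have "?b n (\<delta> (Suc n) x) \<oplus>\<^bsub>N n\<^esub> \<Delta> n (?b (Suc n) x) = \<zero>\<^bsub>N n\<^esub>"
      if n: "n \<ge> t" and x: "x \<in> carrier (T (Suc (Suc n)))" for n x
    proof -
      interpret N: left_module R "N n" by (rule left_module_N)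
      have z: "\<Delta> n (?b (Suc n) x) = \<zero>\<^bsub>N n\<^esub>"
        using n mod_hom_zero[OF left_module_N left_module_N \<Delta>, of n] by simp
      show ?thesis
      proof (cases "n = t")
        case True
        then have "x \<in> carrier (F (Suc (Suc t)))" using x Tt(2) by simp
        then have "?b n (\<delta> (Suc n) x) = \<zero>\<^bsub>N n\<^esub>" using S(6)[of "Suc t" x] C(7) by (simp add: True)
        then show ?thesis unfolding z by simp
      next
        case False
        then show ?thesis unfolding z by simp
      qed
    qed
    then have prt: "Pr t ?b" using h unfolding Pr_def by auto
    show "\<exists>b. Pr t b" by (rule exI, rule prt)
  next
    fix n assume n: "n < t" and "\<exists>b. Pr (Suc n) b"
    then obtain b where "Pr (Suc n) b" by (elim exE)
    then have b: "\<And>m. m \<ge> Suc n \<Longrightarrow> b m \<in> mod_hom R (T (Suc m)) (N m)" and bt: "b t = \<beta>"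
      and rel: "\<And>m x. m \<ge> Suc n \<Longrightarrow> x \<in> carrier (T (Suc (Suc m))) \<Longrightarrow>
        b m (\<delta> (Suc m) x) \<oplus>\<^bsub>N m\<^esub> \<Delta> m (b (Suc m) x) = \<zero>\<^bsub>N m\<^esub>"
      unfolding Pr_def by auto
    note bn = b[OF order_refl]
    interpret N: left_module R "N n" by (rule left_module_N)
    interpret N': left_module R "N (Suc n)" by (rule left_module_N)
    let ?f = "\<lambda>x. \<ominus>\<^bsub>N n\<^esub> \<Delta> n (b (Suc n) x)"
    have f: "?f \<in> mod_hom R (T (Suc (Suc n))) (N n)"
      by (rule mod_hom_neg[OF left_module_N mod_hom_comp[OF bn \<Delta>]])
    have "\<exists>g\<in>functionals R (T (Suc n)). \<forall>x\<in>carrier (T (Suc (Suc n))). s (?f x) = g (\<delta> (Suc n) x)"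
      if s: "s \<in> functionals R (N n)" for s
    proof (cases "Suc n = t")
      \<comment> \<open>\<open>Hom(T, R)\<close> need not be exact in degree \<open>t + 1\<close>; here the cocycle is a relation between the
        classes in \<open>H\<close> and is a coboundary for that reason.\<close>
      case True
      obtain g where g: "g \<in> functionals R (F t)" "\<forall>x\<in>carrier (F (Suc t)). s (\<Delta> n (\<beta> x)) = g (d t x)"
        using C(10)[OF True[symmetric] s] by (rule bexE)
      have Tt: "T t = F t" "T (Suc t) = F (Suc t)" by (rule S(4), simp)+
      show ?thesis
      proof (rule bexI, rule ballI)
        show "(\<lambda>x. \<ominus>\<^bsub>R\<^esub> g x) \<in> functionals R (T (Suc n))"
          unfolding True Tt by (rule functional_neg[OF R g(1)])
        fix x assume x: "x \<in> carrier (T (Suc (Suc n)))"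
        then have xF: "x \<in> carrier (F (Suc t))" by (simp only: True Tt)
        have c: "\<Delta> n (b (Suc n) x) \<in> carrier (N n)" by (rule mod_hom_closed[OF mod_hom_comp[OF bn \<Delta>] x])
        show "s (?f x) = \<ominus>\<^bsub>R\<^esub> g (\<delta> (Suc n) x)"
          unfolding functional_uminus[OF left_module_N s c] using bspec[OF g(2) xF] S(6)[OF order_refl xF] by (simp add: True bt)
      qed
    next
      case False
      then have nt: "Suc n < t" using n by simp
      have "s (?f (\<delta> (Suc (Suc n)) x)) = \<zero>\<^bsub>R\<^esub>" if x: "x \<in> carrier (T (Suc (Suc (Suc n))))" for x
      proof -
        have c: "b (Suc n) (\<delta> (Suc (Suc n)) x) \<in> carrier (N (Suc n))"
            "b (Suc (Suc n)) x \<in> carrier (N (Suc (Suc n)))"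
          by (rule mod_hom_closed[OF mod_hom_comp[OF \<delta> bn] x], rule mod_hom_closed[OF b x]) simp
        note c3 = mod_hom_closed[OF \<Delta> c(2)]
        have "b (Suc n) (\<delta> (Suc (Suc n)) x) = \<ominus>\<^bsub>N (Suc n)\<^esub> \<Delta> (Suc n) (b (Suc (Suc n)) x)"
          using rel[OF order_refl x] c(1) c3 by (simp add: N'.M.minus_equality)
        then have "\<Delta> n (b (Suc n) (\<delta> (Suc (Suc n)) x)) = \<ominus>\<^bsub>N n\<^esub> \<zero>\<^bsub>N n\<^esub>"
          using mod_hom_uminus[OF left_module_N left_module_N \<Delta> c3] \<Delta>\<Delta>[OF c(2)] by simp
        then show ?thesis using functional_zero[OF left_module_N s] by (simp add: N.M.minus_minus)
      qed
      then show ?thesis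
        by (rule dual_exact_Suc[OF S(7)[OF nt] mod_hom_comp[OF f s]])
    qed
    then obtain g where g: "g \<in> mod_hom R (T (Suc n)) (N n)" "\<forall>x\<in>carrier (T (Suc (Suc n))). ?f x = g (\<delta> (Suc n) x)"
      using factor_through_of_functionals[OF C(1) f \<delta>] by blast
    have prn: "Pr n (b(n := g))"
      unfolding Pr_def
    proof (intro conjI allI impI ballI)
      show "(b(n := g)) t = \<beta>" using n bt by simp
      fix m assume m: "n \<le> m"
      show "(b(n := g)) m \<in> mod_hom R (T (Suc m)) (N m)"
        using m g(1) b[of m] by (cases "m = n") auto
      fix x assume x: "x \<in> carrier (T (Suc (Suc m)))"
      show "(b(n := g)) m (\<delta> (Suc m) x) \<oplus>\<^bsub>N m\<^esub> \<Delta> m ((b(n := g)) (Suc m) x) = \<zero>\<^bsub>N m\<^esub>"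
      proof (cases "m = n")
        case True
        have c: "\<Delta> n (b (Suc n) x) \<in> carrier (N n)"
          by (rule mod_hom_closed[OF mod_hom_comp[OF bn \<Delta>]]) (use x True in simp)
        show ?thesis
          using bspec[OF g(2), of x] x c True by (simp add: N.M.l_neg[OF c] g(2)[rule_format, symmetric])
      next
        case False
        then show ?thesis using rel[of m x] m x by simp
      qed
    qed
    show "\<exists>b. Pr n b" by (rule exI, rule prn)
  qed simp
  then show ?thesis unfolding Pr_def by simp
qed

text \<open>If \<open>B\<close> is zero, the sum can be \<open>A\<close> itself; this preserves literal agreement in high degrees.\<close>

lemma padded_biproduct:
  fixes R :: "('a, 'c) ring_scheme" and A :: "('a, nat \<Rightarrow> 'a) module"
  assumes "fg_projective R A" "fg_projective R B" "c \<Longrightarrow> carrier B = {\<zero>\<^bsub>B\<^esub>}"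
  shows "\<exists>(Q :: ('a, nat \<Rightarrow> 'a) module) p q i j. fg_projective R Q \<and> biproduct R Q A B p q i j \<and>
    (c \<longrightarrow> Q = A \<and> p = (\<lambda>x. x))"
proof (cases c)
  case True
  have A: "left_module R A" and B: "left_module R B" using assms fg_projective_left_module by auto
  interpret A: left_module R A by fact
  interpret B: left_module R B by fact
  have "biproduct R A A B (\<lambda>x. x) (\<lambda>_. \<zero>\<^bsub>B\<^esub>) (\<lambda>x. x) (\<lambda>_. \<zero>\<^bsub>A\<^esub>)"
    unfolding biproduct_def using mod_hom_id mod_hom_const_zero[OF A] mod_hom_const_zero[OF B] assms(3)[OF True] by auto
  then show ?thesis using assms(1) by blast
next
  case False
  then show ?thesis using fg_projective_biproduct[OF assms(1,2)] by blast
qed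

text \<open>
  The cone of the connecting maps. Its dual is exact in degree \<open>t + 1\<close> because every cocycle on \<open>F\<^sub>t\<^sub>+\<^sub>1\<close> becomes
  a coboundary after \<open>N\<^sub>t\<close> is added. It stays exact in the degrees \<open>1, \<dots>, t\<close> because \<open>Hom(T, R)\<close> is exact there
  and the relations between the classes added in degree \<open>t + 1\<close> are resolved by \<open>L\<close>.
\<close>

lemma stage_step:
  fixes R :: "('a, 'c) ring_scheme" and F :: "nat \<Rightarrow> ('a, nat \<Rightarrow> 'a) module"
    and T :: "nat \<Rightarrow> ('a, nat \<Rightarrow> 'a) module"
  assumes st: "approximation_stage R F d t T \<delta> \<pi>" and co: "coresolution R F d t N \<Delta> \<beta>"
  shows "\<exists>(Q :: nat \<Rightarrow> ('a, nat \<Rightarrow> 'a) module) \<delta>' \<pi>'. approximation_stage R F d (Suc t) Q \<delta>' \<pi>'"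
proof -
  note S = stage_facts[OF st] and C = coresolution_facts[OF co]
  obtain b where bb: "(\<forall>n. b n \<in> mod_hom R (T (Suc n)) (N n)) \<and>
    (\<forall>n. \<forall>x\<in>carrier (T (Suc (Suc n))). b n (\<delta> (Suc n) x) \<oplus>\<^bsub>N n\<^esub> \<Delta> n (b (Suc n) x) = \<zero>\<^bsub>N n\<^esub>) \<and> b t = \<beta>"
    using stage_connecting_maps[OF st co] by (elim exE)
  have b: "b n \<in> mod_hom R (T (Suc n)) (N n)" for n by (rule spec[OF conjunct1[OF bb]])
  have rel: "b n (\<delta> (Suc n) x) \<oplus>\<^bsub>N n\<^esub> \<Delta> n (b (Suc n) x) = \<zero>\<^bsub>N n\<^esub>" if "x \<in> carrier (T (Suc (Suc n)))" for n x
    by (rule bspec[OF spec[OF conjunct1[OF conjunct2[OF bb]]] that])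
  have bt: "b t = \<beta>" by (rule conjunct2[OF conjunct2[OF bb]])
  let ?bi = "\<lambda>n (Q, p, q, i, j). fg_projective R (Q :: ('a, nat \<Rightarrow> 'a) module) \<and> biproduct R Q (T n) (N n) p q i j \<and>
    (n > t \<longrightarrow> Q = T n \<and> p = (\<lambda>x. x))"
  have "\<exists>w. ?bi n w" for n
  proof -
    have "\<exists>(Q :: ('a, nat \<Rightarrow> 'a) module) p q i j. fg_projective R Q \<and> biproduct R Q (T n) (N n) p q i j \<and>
        (n > t \<longrightarrow> Q = T n \<and> p = (\<lambda>x. x))"
      by (rule padded_biproduct[OF S(1) C(1)]) (rule C(3))
    then obtain Q :: "('a, nat \<Rightarrow> 'a) module" and p q i j where "fg_projective R Q \<and> biproduct R Q (T n) (N n) p q i j \<and>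
        (n > t \<longrightarrow> Q = T n \<and> p = (\<lambda>x. x))"
      by (elim exE)
    then show ?thesis by (intro exI[of _ "(Q, p, q, i, j)"]) simp
  qed
  then have "\<forall>n. \<exists>w. ?bi n w" by (rule allI)
  from choice[OF this] obtain W where W: "\<forall>n. ?bi n (W n)" by (rule exE)
  define Q where "Q n = fst (W n)" for n
  define p where "p n = fst (snd (W n))" for n
  define q where "q n = fst (snd (snd (W n)))" for n
  define i where "i n = fst (snd (snd (snd (W n))))" for n
  define j where "j n = snd (snd (snd (snd (W n))))" for n
  have "fg_projective R (Q n) \<and> biproduct R (Q n) (T n) (N n) (p n) (q n) (i n) (j n) \<and>
      (n > t \<longrightarrow> Q n = T n \<and> p n = (\<lambda>x. x))" for n
    using spec[OF W, of n] by (simp add: Q_def p_def q_def i_def j_def split_beta)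
  then have Qp: "fg_projective R (Q n)" and bp: "biproduct R (Q n) (T n) (N n) (p n) (q n) (i n) (j n)"
    and Qt: "n > t \<Longrightarrow> Q n = T n" "n > t \<Longrightarrow> p n = (\<lambda>x. x)" for n by auto
  interpret cone R T \<delta> N \<Delta> b Q p q i j
  proof (rule cone.intro)
    show "complex_of R T \<delta>" by (rule S(2))
    show "complex_of R N \<Delta>" by (rule C(2))
    fix n
    show "b n \<in> mod_hom R (T (Suc n)) (N n)" by (rule b)
    show "left_module R (Q n)" by (rule fg_projective_left_module[OF Qp])
    show "biproduct R (Q n) (T n) (N n) (p n) (q n) (i n) (j n)" by (rule bp)
    show "b n (\<delta> (Suc n) x) \<oplus>\<^bsub>N n\<^esub> \<Delta> n (b (Suc n) x) = \<zero>\<^bsub>N n\<^esub>" if "x \<in> carrier (T (Suc (Suc n)))" for x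
      by (rule rel[OF that])
  qed
  have R: "ring R" by (rule left_moduleD[OF left_module_T])
  interpret R: ring R by (rule R)
  have Tt: "T t = F t" "T (Suc t) = F (Suc t)" "T (Suc (Suc t)) = F (Suc (Suc t))" by (rule S(4), simp)+
  have Nz: "u = \<zero>\<^bsub>N (Suc t)\<^esub>" if "u \<in> carrier (N (Suc t))" for u
    using that C(3)[of "Suc t"] by simp
  have dx: "dual_exact R Q \<delta>' (Suc n)" if n: "n < Suc t" for n
  proof (rule cone_dual_exact)
    fix f v assume f: "f \<in> functionals R (T (Suc n))" and v: "v \<in> functionals R (N (Suc n))"
      and fv: "\<And>y. y \<in> carrier (T (Suc (Suc n))) \<Longrightarrow> f (\<delta> (Suc n) y) \<oplus>\<^bsub>R\<^esub> v (b (Suc n) y) = \<zero>\<^bsub>R\<^esub>"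
      and v\<Delta>: "\<And>u. u \<in> carrier (N (Suc (Suc n))) \<Longrightarrow> v (\<Delta> (Suc n) u) = \<zero>\<^bsub>R\<^esub>"
    have fc: "f y \<in> carrier R" if "y \<in> carrier (T (Suc n))" for y by (rule functional_closed[OF f that])
    show "\<exists>g\<in>functionals R (T n). \<exists>w\<in>functionals R (N n).
      (\<forall>y\<in>carrier (T (Suc n)). f y = g (\<delta> n y) \<oplus>\<^bsub>R\<^esub> w (b n y)) \<and> (\<forall>u\<in>carrier (N (Suc n)). v u = w (\<Delta> n u))"
    proof (cases "n = t")
      \<comment> \<open>\<open>v\<close> is zero, since \<open>N\<close> ends in degree \<open>t\<close>, and \<open>f\<close> is a cocycle on \<open>F\<^sub>t\<^sub>+\<^sub>1\<close>.\<close>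
      case True
      have fF: "f \<in> functionals R (F (Suc t))" using f by (simp only: True Tt)
      have "f (d (Suc t) x) = \<zero>\<^bsub>R\<^esub>" if x: "x \<in> carrier (F (Suc (Suc t)))" for x
      proof -
        have xT: "x \<in> carrier (T (Suc (Suc n)))" using x by (simp only: True Tt)
        have "v (b (Suc n) x) = \<zero>\<^bsub>R\<^esub>"
          using Nz[of "b (Suc n) x"] bc[OF xT] functional_zero[OF left_module_N v] by (simp add: True)
        then show ?thesis
          using fv[OF xT] fc[OF \<delta>c[OF xT]] S(6)[of "Suc t" x] x by (simp add: True)
      qed
      then obtain w where w: "w \<in> functionals R (N t)"
        "\<exists>g\<in>functionals R (F t). \<forall>x\<in>carrier (F (Suc t)). f x = w (\<beta> x) \<oplus>\<^bsub>R\<^esub> g (d t x)"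
        using C(8)[OF fF] by (metis (no_types, lifting))
      from w(2) obtain g where g: "g \<in> functionals R (F t)"
        "\<forall>x\<in>carrier (F (Suc t)). f x = w (\<beta> x) \<oplus>\<^bsub>R\<^esub> g (d t x)" by (rule bexE)
      have gT: "g \<in> functionals R (T n)" and wN: "w \<in> functionals R (N n)"
        using g(1) w(1) by (simp_all only: True Tt)
      have e1: "f y = g (\<delta> n y) \<oplus>\<^bsub>R\<^esub> w (b n y)" if y: "y \<in> carrier (T (Suc n))" for y
      proof -
        have yF: "y \<in> carrier (F (Suc t))" using y by (simp only: True Tt)
        have "\<delta> n y = d t y" using S(6)[OF order_refl yF] by (simp only: True)
        then show ?thesis
          using bspec[OF g(2) yF] functional_closed[OF gT \<delta>c[OF y]] functional_closed[OF wN bc[OF y]]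
          by (simp add: True bt R.a_comm)
      qed
      have e2: "v u = w (\<Delta> n u)" if u: "u \<in> carrier (N (Suc n))" for u
      proof -
        have "u = \<zero>\<^bsub>N (Suc n)\<^esub>" using Nz u by (simp only: True)
        then show ?thesis
          using functional_zero[OF left_module_N v] functional_zero[OF left_module_N wN] mod_hom_zero[OF left_module_N left_module_N \<Delta>_hom] by simp
      qed
      show ?thesis
        by (rule bexI[OF _ gT], rule bexI[OF _ wN], intro conjI ballI, erule e1, erule e2)
    next
      case False
      then have nt: "n < t" using n by simp
      \<comment> \<open>First split off \<open>v\<close>. What remains of \<open>f\<close> is a cocycle on \<open>T\<close> in one of the degrees \<open>1, \<dots>, t\<close>.\<close>
      have "\<exists>w\<in>functionals R (N n). \<forall>u\<in>carrier (N (Suc n)). v u = w (\<Delta> n u)"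
      proof (cases "Suc n < t")
        case True
        show ?thesis by (rule dual_exact_Suc[OF C(5)[OF True] v v\<Delta>])
      next
        case False
        then have t: "t = Suc n" using nt by simp
        have "v (\<beta> x) = \<ominus>\<^bsub>R\<^esub> f (d t x)" if x: "x \<in> carrier (F (Suc t))" for x
        proof -
          have xT: "x \<in> carrier (T (Suc (Suc n)))" using x by (simp only: t[symmetric] Tt)
          have "f (d t x) \<oplus>\<^bsub>R\<^esub> v (\<beta> x) = \<zero>\<^bsub>R\<^esub>"
            using fv[OF xT] S(6)[OF order_refl x] bt by (simp only: t[symmetric])
          moreover have "f (d t x) \<in> carrier R" "v (\<beta> x) \<in> carrier R"
            using fc[OF \<delta>c[OF xT]] functional_closed[OF v bc[OF xT]] S(6)[OF order_refl x] bt by (simp_all only: t[symmetric])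
          ultimately show ?thesis by (metis R.a_comm R.minus_equality)
        qed
        then show ?thesis
          unfolding t[symmetric] using v functional_neg[OF R f] 
          by (intro C(9)[OF t, of v "\<lambda>x. \<ominus>\<^bsub>R\<^esub> f x"]) (simp_all only: t[symmetric] Tt)
      qed
      then obtain w where w: "w \<in> functionals R (N n)" "\<forall>u\<in>carrier (N (Suc n)). v u = w (\<Delta> n u)" by (rule bexE)
      have wb: "(\<lambda>y. w (b n y)) \<in> functionals R (T (Suc n))" by (rule mod_hom_comp[OF b w(1)])
      let ?f = "\<lambda>y. f y \<oplus>\<^bsub>R\<^esub> (\<ominus>\<^bsub>R\<^esub> w (b n y))"
      have f': "?f \<in> functionals R (T (Suc n))"
        by (rule functional_plus[OF R f functional_neg[OF R wb]])
      have f0: "?f (\<delta> (Suc n) y) = \<zero>\<^bsub>R\<^esub>" if y: "y \<in> carrier (T (Suc (Suc n)))" for y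
      proof -
        have c: "b n (\<delta> (Suc n) y) \<in> carrier (N n)" "\<Delta> n (b (Suc n) y) \<in> carrier (N n)"
          by (rule bc[OF \<delta>c[OF y]], rule \<Delta>c[OF bc[OF y]])
        have c2: "w (b n (\<delta> (Suc n) y)) \<in> carrier R" "w (\<Delta> n (b (Suc n) y)) \<in> carrier R" "f (\<delta> (Suc n) y) \<in> carrier R"
          by (rule functional_closed[OF w(1) c(1)], rule functional_closed[OF w(1) c(2)], rule fc[OF \<delta>c[OF y]])
        have "w (b n (\<delta> (Suc n) y)) \<oplus>\<^bsub>R\<^esub> w (\<Delta> n (b (Suc n) y)) = \<zero>\<^bsub>R\<^esub>"
          using functional_add[OF w(1) c] rel[OF y] functional_zero[OF left_module_N w(1)] by simp
        then have "\<ominus>\<^bsub>R\<^esub> w (b n (\<delta> (Suc n) y)) = w (\<Delta> n (b (Suc n) y))"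
          using c2 by (metis R.a_comm R.minus_equality)
        then show ?thesis using fv[OF y] bspec[OF w(2) bc[OF y]] by simp
      qed
      have "\<exists>g\<in>functionals R (T n). \<forall>y\<in>carrier (T (Suc n)). ?f y = g (\<delta> n y)"
        by (rule dual_exact_Suc[OF S(7)[OF nt] f']) (rule f0)
      then obtain g where g: "g \<in> functionals R (T n)" "\<forall>y\<in>carrier (T (Suc n)). ?f y = g (\<delta> n y)" by (rule bexE)
      have e1: "f y = g (\<delta> n y) \<oplus>\<^bsub>R\<^esub> w (b n y)" if y: "y \<in> carrier (T (Suc n))" for y
        unfolding bspec[OF g(2) y, symmetric] using fc[OF y] functional_closed[OF wb y] by (simp add: R.a_assoc R.l_neg)
      show ?thesis
        by (rule bexI[OF _ g(1)], rule bexI[OF _ w(1)], intro conjI w(2) ballI, erule e1)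
    qed
  qed
  let ?\<pi> = "\<lambda>n x. \<pi> n (p n x)"
  have p_surj: "p n ` carrier (Q n) = carrier (T n)" for n
  proof
    show "p n ` carrier (Q n) \<subseteq> carrier (T n)" using pc by auto
    show "carrier (T n) \<subseteq> p n ` carrier (Q n)"
      using bp_facts(5)[symmetric] ic by (intro subsetI image_eqI) auto
  qed
  have "approximation_stage R F d (Suc t) Q \<delta>' ?\<pi>"
  proof (rule approximation_stage.intro)
    fix n x
    show "fg_projective R (Q n)" by (rule Qp)
    show "complex_of R Q \<delta>'" by (rule cone_complex)
    show "exact_at Q \<delta>' n"
      by (rule cone_exact[OF S(3) C(4)])
    show "?\<pi> n \<in> mod_hom R (Q n) (F n)" by (rule mod_hom_comp[OF bp_facts(1) S(8)])
    show "?\<pi> n ` carrier (Q n) = carrier (F n)"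
      using S(9)[of n] p_surj[of n] by (simp add: image_image[symmetric, of "\<pi> n" "p n"])
    show "n < Suc t \<Longrightarrow> dual_exact R Q \<delta>' (Suc n)" by (rule dx)
    show "d n (?\<pi> (Suc n) x) = ?\<pi> n (\<delta>' n x)" if "x \<in> carrier (Q (Suc n))"
      unfolding coordinates(1)[OF that] by (rule S(10)[OF pc[OF that]])
    assume n: "Suc t \<le> n"
    show "Q n = F n" using Qt(1)[of n] S(4)[of n] n by simp
    show "?\<pi> n x = x" if "x \<in> carrier (F n)" using Qt(2)[of n] S(5)[of n x] n that by simp
    show "\<delta>' n x = d n x" if x: "x \<in> carrier (F (Suc n))"
    proof -
      have "x \<in> carrier (Q (Suc n))" using x n Qt(1)[of "Suc n"] S(4)[of "Suc n"] by simp
      from coordinates(1)[OF this] show ?thesis using Qt(2)[of n] Qt(2)[of "Suc n"] S(6)[of n x] n x by simp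
    qed
  qed
  then show ?thesis by blast
qed

lemma stage_exists:
  fixes R :: "('a, 'c) ring_scheme" and F :: "nat \<Rightarrow> ('a, nat \<Rightarrow> 'a) module"
  assumes "right_noetherian R" "projective_resolution R M F d e"
    and grade: "\<And>t. \<lbrakk>1 \<le> t; t < k\<rbrakk> \<Longrightarrow> grade_ge (op_ring R) (dual_cohomology R F d (Suc t)) t"
  shows "t \<le> k \<Longrightarrow> \<exists>(T :: nat \<Rightarrow> ('a, nat \<Rightarrow> 'a) module) \<delta> \<pi>. approximation_stage R F d t T \<delta> \<pi>"
proof (induct t)
  case 0
  have "approximation_stage R F d 0 F d (\<lambda>_ x. x)"
    using assms(2) projective_resolution_complex[OF assms(2)]
    by (intro approximation_stage.intro) (simp_all add: projective_resolution_def mod_hom_id)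
  then show ?case by blast
next
  case (Suc t)
  have F: "fg_projective R (F i)" for i using assms(2) by (simp add: projective_resolution_def)
  have g: "grade_ge (op_ring R) (dual_cohomology R F d (Suc t)) t"
    using grade[of t] Suc(2) by (cases "t = 0") (auto simp: grade_ge_def)
  obtain N :: "nat \<Rightarrow> ('a, (nat \<Rightarrow> 'a) \<Rightarrow> 'a) module" and \<Delta> \<beta> where "coresolution R F d t N \<Delta> \<beta>"
    using coresolution_exists[OF assms(1) F projective_resolution_complex[OF assms(2)] g] by (elim exE)
  moreover obtain T :: "nat \<Rightarrow> ('a, nat \<Rightarrow> 'a) module" and \<delta> \<pi> where "approximation_stage R F d t T \<delta> \<pi>"
    using Suc by (auto elim!: exE)
  ultimately show ?case by (intro stage_step)
qed

section \<open>Lifting along the approximation\<close>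

lemma hom_through_surjection:
  assumes "left_module R A" "left_module R B" "left_module R C"
    and q: "q \<in> mod_hom R A B" "q ` carrier A = carrier B" and g: "g \<in> mod_hom R A C"
    and ker: "\<And>x. \<lbrakk>x \<in> carrier A; q x = \<zero>\<^bsub>B\<^esub>\<rbrakk> \<Longrightarrow> g x = \<zero>\<^bsub>C\<^esub>"
  shows "\<exists>f\<in>mod_hom R B C. \<forall>x\<in>carrier A. f (q x) = g x"
proof -
  interpret A: left_module R A by fact
  interpret B: left_module R B by fact
  interpret C: left_module R C by fact
  note qc = mod_hom_closed[OF q(1)] and gc = mod_hom_closed[OF g]
  define s where "s y = inv_into (carrier A) q y" for y
  have s: "s y \<in> carrier A" "q (s y) = y" if "y \<in> carrier B" for y
    using that q(2) unfolding s_def by (metis inv_into_into, metis f_inv_into_f)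
  have same: "g x = g y" if x: "x \<in> carrier A" and y: "y \<in> carrier A" and eq: "q x = q y" for x y
  proof -
    have "q (x \<ominus>\<^bsub>A\<^esub> y) = \<zero>\<^bsub>B\<^esub>"
      using mod_hom_minus[OF assms(1,2) q(1) x y] qc[OF y] eq by (simp add: a_minus_def B.M.r_neg)
    then have "g (x \<ominus>\<^bsub>A\<^esub> y) = \<zero>\<^bsub>C\<^esub>" using x y by (intro ker) simp_all
    moreover have "g x = g (x \<ominus>\<^bsub>A\<^esub> y) \<oplus>\<^bsub>C\<^esub> g y"
      using x y mod_hom_add[OF g, of "x \<ominus>\<^bsub>A\<^esub> y" y] by (simp add: a_minus_def A.M.a_assoc A.M.l_neg)
    ultimately show ?thesis using gc[OF y] by simp
  qed
  show ?thesis
  proof (rule bexI, rule ballI)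
    show "(\<lambda>y. g (s y)) \<in> mod_hom R B C"
    proof (rule mod_homI)
      fix y z assume y: "y \<in> carrier B" and z: "z \<in> carrier B"
      have "g (s (y \<oplus>\<^bsub>B\<^esub> z)) = g (s y \<oplus>\<^bsub>A\<^esub> s z)"
        using s y z mod_hom_add[OF q(1) s(1)[OF y] s(1)[OF z]] by (intro same) simp_all
      then show "g (s (y \<oplus>\<^bsub>B\<^esub> z)) = g (s y) \<oplus>\<^bsub>C\<^esub> g (s z)"
        using mod_hom_add[OF g s(1)[OF y] s(1)[OF z]] by simp
    next
      fix r y assume r: "r \<in> carrier R" and y: "y \<in> carrier B"
      have "g (s (r \<odot>\<^bsub>B\<^esub> y)) = g (r \<odot>\<^bsub>A\<^esub> s y)"
        using s y r mod_hom_smult[OF q(1) r s(1)[OF y]] by (intro same) simp_all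
      then show "g (s (r \<odot>\<^bsub>B\<^esub> y)) = r \<odot>\<^bsub>C\<^esub> g (s y)"
        using mod_hom_smult[OF g r s(1)[OF y]] by simp
    qed (rule gc[OF s(1)])
    fix x assume x: "x \<in> carrier A"
    show "g (s (q x)) = g x" by (rule same[OF s(1)[OF qc[OF x]] x s(2)[OF qc[OF x]]])
  qed
qed

lemma dual_exact_projective:
  assumes "dual_exact R Q \<gamma> (Suc n)" "complex_of R Q \<gamma>" "fg_projective R N" "h \<in> mod_hom R (Q (Suc n)) N"
    "\<And>x. x \<in> carrier (Q (Suc (Suc n))) \<Longrightarrow> h (\<gamma> (Suc n) x) = \<zero>\<^bsub>N\<^esub>"
  shows "\<exists>s\<in>mod_hom R (Q n) N. \<forall>x\<in>carrier (Q (Suc n)). h x = s (\<gamma> n x)"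
proof (rule factor_through_of_functionals[OF assms(3,4)])
  show "\<gamma> n \<in> mod_hom R (Q (Suc n)) (Q n)" using assms(2) by (simp add: complex_of_def)
  fix s assume s: "s \<in> functionals R N"
  have "s (h (\<gamma> (Suc n) x)) = \<zero>\<^bsub>R\<^esub>" if "x \<in> carrier (Q (Suc (Suc n)))" for x
    unfolding assms(5)[OF that] by (rule functional_zero[OF fg_projective_left_module[OF assms(3)] s])
  then show "\<exists>g\<in>functionals R (Q n). \<forall>x\<in>carrier (Q (Suc n)). s (h x) = g (\<gamma> n x)"
    by (rule dual_exact_Suc[OF assms(1) mod_hom_comp[OF assms(4) s]])
qed

text \<open>
  Lift \<open>Q \<rightarrow> X \<rightarrow> M\<close> to a chain map \<open>\<phi>, c\<^sub>0, c\<^sub>1, \<dots>\<close> from \<open>Q\<close> to the complex \<open>\<dots> \<rightarrow> P\<^sub>1 \<rightarrow> P\<^sub>0 \<rightarrow> E\<close>. As \<open>P\<close> vanishes above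
  degree \<open>r\<close>, the last nonzero \<open>c\<^sub>i\<close> is a cocycle with values in a projective module, hence factors
  through the boundary of \<open>Q\<close>. Correcting its predecessor by this factor makes that one a cocycle, and so on
  down to a corrected \<open>\<phi>\<close> that vanishes on boundaries and therefore descends to \<open>X\<close>.
\<close>

lemma lift_along_epimorphism:
  assumes Q: "projective_resolution R X Q \<gamma> \<eta>" and X: "left_module R X"
    and dx: "\<And>n. n < Suc r \<Longrightarrow> dual_exact R Q \<gamma> (Suc n)"
    and P: "\<And>n. fg_projective R (P n)" "complex_of R P d"
    and ex: "\<And>n. exact_at P d n"
    and bounded: "\<And>n. n > r \<Longrightarrow> carrier (P n) = {\<zero>\<^bsub>P n\<^esub>}"
    and E: "left_module R E" and M: "left_module R M"
    and f: "f \<in> mod_hom R E M" "f ` carrier E = carrier M"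
    and \<epsilon>: "\<epsilon> \<in> mod_hom R (P 0) E" "\<epsilon> ` carrier (P 0) = mod_ker E M f" "d 0 ` carrier (P 1) = mod_ker (P 0) E \<epsilon>"
    and g: "g \<in> mod_hom R X M"
  shows "\<exists>h\<in>mod_hom R X E. \<forall>x\<in>carrier X. f (h x) = g x"
proof -
  note QD = Q[unfolded projective_resolution_def]
  note cQ = projective_resolution_complex[OF Q]
  have Qp: "fg_projective R (Q n)" and LQ: "left_module R (Q n)" and \<gamma>: "\<gamma> n \<in> mod_hom R (Q (Suc n)) (Q n)"
    and \<gamma>\<gamma>: "x \<in> carrier (Q (Suc (Suc n))) \<Longrightarrow> \<gamma> n (\<gamma> (Suc n) x) = \<zero>\<^bsub>Q n\<^esub>" for n x
    using cQ QD unfolding complex_of_def by auto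
  have LP: "left_module R (P n)" and d: "d n \<in> mod_hom R (P (Suc n)) (P n)"
    and dd: "x \<in> carrier (P (Suc (Suc n))) \<Longrightarrow> d n (d (Suc n) x) = \<zero>\<^bsub>P n\<^esub>" for n x
    using P(2) unfolding complex_of_def by auto
  have \<eta>: "\<eta> \<in> mod_hom R (Q 0) X" "\<eta> ` carrier (Q 0) = carrier X" and \<gamma>0: "\<gamma> 0 ` carrier (Q 1) = mod_ker (Q 0) X \<eta>"
    using QD by auto
  note \<gamma>c = mod_hom_closed[OF \<gamma>] and dc = mod_hom_closed[OF d]
  interpret E: left_module R E by (rule E)
  interpret M: left_module R M by (rule M)
  have \<eta>\<gamma>: "\<eta> (\<gamma> 0 x) = \<zero>\<^bsub>X\<^esub>" if "x \<in> carrier (Q (Suc 0))" for x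
    using \<gamma>0 imageI[OF that, of "\<gamma> 0"] by (auto simp: mod_ker_def)
  have \<epsilon>d: "\<epsilon> (d 0 x) = \<zero>\<^bsub>E\<^esub>" if "x \<in> carrier (P (Suc 0))" for x
    using \<epsilon>(3) imageI[OF that, of "d 0"] by (auto simp: mod_ker_def)
  have f\<epsilon>: "f (\<epsilon> x) = \<zero>\<^bsub>M\<^esub>" if "x \<in> carrier (P 0)" for x
    using \<epsilon>(2) imageI[OF that, of \<epsilon>] by (auto simp: mod_ker_def)
  have "(\<lambda>x. g (\<eta> x)) ` carrier (Q 0) \<subseteq> f ` carrier E"
    unfolding f(2) using mod_hom_closed[OF mod_hom_comp[OF \<eta>(1) g]] by auto
  from fg_projective_lift[OF Qp E M mod_hom_comp[OF \<eta>(1) g] f(1) this]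
  obtain \<phi> where \<phi>: "\<phi> \<in> mod_hom R (Q 0) E" "\<forall>x\<in>carrier (Q 0). f (\<phi> x) = g (\<eta> x)" by (rule bexE)
  have \<phi>\<gamma>: "(\<lambda>x. \<phi> (\<gamma> 0 x)) \<in> mod_hom R (Q (Suc 0)) E" by (rule mod_hom_comp[OF \<gamma> \<phi>(1)])
  have "(\<lambda>x. \<phi> (\<gamma> 0 x)) ` carrier (Q (Suc 0)) \<subseteq> \<epsilon> ` carrier (P 0)"
  proof (rule image_subsetI)
    fix x assume x: "x \<in> carrier (Q (Suc 0))"
    have "f (\<phi> (\<gamma> 0 x)) = \<zero>\<^bsub>M\<^esub>"
      using bspec[OF \<phi>(2) \<gamma>c[OF x]] \<eta>\<gamma>[OF x] mod_hom_zero[OF X M g] by simp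
    then show "\<phi> (\<gamma> 0 x) \<in> \<epsilon> ` carrier (P 0)"
      unfolding \<epsilon>(2) using mod_hom_closed[OF \<phi>\<gamma> x] by (simp add: mod_ker_def)
  qed
  note im = this
  have shifted: "complex_of R (\<lambda>n. Q (Suc n)) (\<lambda>n. \<gamma> (Suc n))" using cQ by (simp add: complex_of_def)
  have \<phi>\<gamma>0: "\<phi> (\<gamma> 0 (\<gamma> (Suc 0) x)) = \<zero>\<^bsub>E\<^esub>" if "x \<in> carrier (Q (Suc (Suc 0)))" for x
    unfolding \<gamma>\<gamma>[OF that] by (rule mod_hom_zero[OF LQ E \<phi>(1)])
  have "\<exists>c. (\<forall>n. c n \<in> mod_hom R (Q (Suc n)) (P n)) \<and> (\<forall>x\<in>carrier (Q (Suc 0)). \<epsilon> (c 0 x) = \<phi> (\<gamma> 0 x)) \<and>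
    (\<forall>n. \<forall>x\<in>carrier (Q (Suc (Suc n))). d n (c (Suc n) x) = c n (\<gamma> (Suc n) x))"
  proof (rule chain_map_exists[where Q = "\<lambda>n. Q (Suc n)" and \<gamma> = "\<lambda>n. \<gamma> (Suc n)" and g = "\<lambda>x. \<phi> (\<gamma> 0 x)"])
    show "\<phi> (\<gamma> 0 (\<gamma> (Suc 0) x)) = \<zero>\<^bsub>E\<^esub>" if "x \<in> carrier (Q (Suc (Suc 0)))" for x by (rule \<phi>\<gamma>0[OF that])
    show "mod_ker (P 0) E \<epsilon> \<subseteq> d 0 ` carrier (P 1)" by (rule equalityD2[OF \<epsilon>(3)])
    show "complex_of R (\<lambda>n. Q (Suc n)) (\<lambda>n. \<gamma> (Suc n))" by (rule shifted)
    show "(\<lambda>x. \<phi> (\<gamma> 0 x)) ` carrier (Q (Suc 0)) \<subseteq> \<epsilon> ` carrier (P 0)" by (rule im)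
    show "(\<lambda>x. \<phi> (\<gamma> 0 x)) \<in> mod_hom R (Q (Suc 0)) E" by (rule \<phi>\<gamma>)
  qed (rule Qp P(2) E \<epsilon>(1) ex)+
  then obtain c where cc: "(\<forall>n. c n \<in> mod_hom R (Q (Suc n)) (P n)) \<and> (\<forall>x\<in>carrier (Q (Suc 0)). \<epsilon> (c 0 x) = \<phi> (\<gamma> 0 x)) \<and>
    (\<forall>n. \<forall>x\<in>carrier (Q (Suc (Suc n))). d n (c (Suc n) x) = c n (\<gamma> (Suc n) x))" by (rule exE)
  have c: "c n \<in> mod_hom R (Q (Suc n)) (P n)" for n using cc by simp
  have c0: "\<epsilon> (c 0 x) = \<phi> (\<gamma> 0 x)" if "x \<in> carrier (Q (Suc 0))" for x using cc that by simp
  have c\<gamma>: "d n (c (Suc n) x) = c n (\<gamma> (Suc n) x)" if "x \<in> carrier (Q (Suc (Suc n)))" for n x using cc that by simp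
  note ccl = mod_hom_closed[OF c]
  define Pr where "Pr n \<longleftrightarrow> (\<exists>s\<in>mod_hom R (Q (Suc n)) (P (Suc n)). \<forall>x\<in>carrier (Q (Suc (Suc n))).
      d n (s (\<gamma> (Suc n) x)) = c n (\<gamma> (Suc n) x))" for n
  \<comment> \<open>\<open>Pr n\<close> provides a correction \<open>s\<close> that makes \<open>c n - d n \<circ> s\<close> vanish on boundaries; then this
    difference factors through the boundary of \<open>Q\<close>.\<close>
  have correct: "\<exists>s'\<in>mod_hom R (Q n) (P n). \<forall>x\<in>carrier (Q (Suc n)). c n x \<ominus>\<^bsub>P n\<^esub> d n (s x) = s' (\<gamma> n x)"
    if n: "n < Suc r" and s: "s \<in> mod_hom R (Q (Suc n)) (P (Suc n))"
      "\<forall>x\<in>carrier (Q (Suc (Suc n))). d n (s (\<gamma> (Suc n) x)) = c n (\<gamma> (Suc n) x)" for n s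
  proof (rule dual_exact_projective[OF dx[OF n] cQ P(1)])
    show "(\<lambda>x. c n x \<ominus>\<^bsub>P n\<^esub> d n (s x)) \<in> mod_hom R (Q (Suc n)) (P n)"
      by (rule mod_hom_diff[OF LP c mod_hom_comp[OF s(1) d]])
    interpret P: left_module R "P n" by (rule LP)
    fix x assume x: "x \<in> carrier (Q (Suc (Suc n)))"
    show "c n (\<gamma> (Suc n) x) \<ominus>\<^bsub>P n\<^esub> d n (s (\<gamma> (Suc n) x)) = \<zero>\<^bsub>P n\<^esub>"
      unfolding bspec[OF s(2) x] a_minus_def by (rule P.M.r_neg[OF ccl[OF \<gamma>c[OF x]]])
  qed
  have "Pr 0"
  proof (rule inc_induct[of 0 r])
    \<comment> \<open>\<open>P (Suc r)\<close> is zero, so the zero map is the first correction.\<close>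
    have "d r \<zero>\<^bsub>P (Suc r)\<^esub> = c r (\<gamma> (Suc r) x)" if x: "x \<in> carrier (Q (Suc (Suc r)))" for x
      using c\<gamma>[OF x] ccl[OF x] bounded[of "Suc r"] by simp
    then show "Pr r" unfolding Pr_def by (intro bexI[OF _ mod_hom_const_zero[OF LP]] ballI)
  next
    fix n assume n: "n < r" and "Pr (Suc n)"
    then obtain s where s: "s \<in> mod_hom R (Q (Suc (Suc n))) (P (Suc (Suc n)))"
      "\<forall>x\<in>carrier (Q (Suc (Suc (Suc n)))). d (Suc n) (s (\<gamma> (Suc (Suc n)) x)) = c (Suc n) (\<gamma> (Suc (Suc n)) x)"
      unfolding Pr_def by (elim bexE)
    have "Suc n < Suc r" using n by simp
    from correct[OF this s] obtain s' where s': "s' \<in> mod_hom R (Q (Suc n)) (P (Suc n))"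
      "\<forall>x\<in>carrier (Q (Suc (Suc n))). c (Suc n) x \<ominus>\<^bsub>P (Suc n)\<^esub> d (Suc n) (s x) = s' (\<gamma> (Suc n) x)" by (rule bexE)
    interpret P: left_module R "P n" by (rule LP)
    have "d n (s' (\<gamma> (Suc n) x)) = c n (\<gamma> (Suc n) x)" if x: "x \<in> carrier (Q (Suc (Suc n)))" for x
    proof -
      note sx = mod_hom_closed[OF s(1) x]
      have "d n (s' (\<gamma> (Suc n) x)) = d n (c (Suc n) x) \<ominus>\<^bsub>P n\<^esub> d n (d (Suc n) (s x))"
        unfolding bspec[OF s'(2) x, symmetric] by (rule mod_hom_minus[OF LP LP d ccl[OF x] dc[OF sx]])
      then show ?thesis
        unfolding dd[OF sx] c\<gamma>[OF x] using ccl[OF \<gamma>c[OF x]]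
        by simp
    qed
    then show "Pr n" unfolding Pr_def by (intro bexI[OF _ s'(1)] ballI)
  qed simp
  then obtain s where s: "s \<in> mod_hom R (Q (Suc 0)) (P (Suc 0))"
    "\<forall>x\<in>carrier (Q (Suc (Suc 0))). d 0 (s (\<gamma> (Suc 0) x)) = c 0 (\<gamma> (Suc 0) x)"
    unfolding Pr_def by (elim bexE)
  from correct[OF zero_less_Suc s] obtain s' where s': "s' \<in> mod_hom R (Q 0) (P 0)"
    "\<forall>x\<in>carrier (Q (Suc 0)). c 0 x \<ominus>\<^bsub>P 0\<^esub> d 0 (s x) = s' (\<gamma> 0 x)" by (rule bexE)
  let ?\<phi> = "\<lambda>x. \<phi> x \<ominus>\<^bsub>E\<^esub> \<epsilon> (s' x)"
  have \<phi>': "?\<phi> \<in> mod_hom R (Q 0) E" by (rule mod_hom_diff[OF E \<phi>(1) mod_hom_comp[OF s'(1) \<epsilon>(1)]])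
  have \<phi>'0: "?\<phi> x = \<zero>\<^bsub>E\<^esub>" if x: "x \<in> carrier (Q 0)" "\<eta> x = \<zero>\<^bsub>X\<^esub>" for x
  proof -
    have "x \<in> \<gamma> 0 ` carrier (Q 1)" unfolding \<gamma>0 using x by (simp add: mod_ker_def)
    then obtain y where y: "x = \<gamma> 0 y" "y \<in> carrier (Q 1)" by (rule imageE)
    then have y': "y \<in> carrier (Q (Suc 0))" by simp
    have "\<epsilon> (s' x) = \<epsilon> (c 0 y) \<ominus>\<^bsub>E\<^esub> \<epsilon> (d 0 (s y))"
      unfolding y(1) bspec[OF s'(2) y', symmetric]
      by (rule mod_hom_minus[OF LP E \<epsilon>(1) ccl[OF y'] dc[OF mod_hom_closed[OF s(1) y']]])
    also have "\<dots> = \<phi> x"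
      unfolding c0[OF y'] \<epsilon>d[OF mod_hom_closed[OF s(1) y']] y(1) using mod_hom_closed[OF \<phi>\<gamma> y'] by simp
    finally show ?thesis using mod_hom_closed[OF \<phi>(1) x(1)] by (simp add: a_minus_def E.M.r_neg)
  qed
  have "\<exists>h\<in>mod_hom R X E. \<forall>x\<in>carrier (Q 0). h (\<eta> x) = ?\<phi> x"
    by (rule hom_through_surjection[OF LQ X E \<eta> \<phi>']) (rule \<phi>'0)
  then obtain h where h: "h \<in> mod_hom R X E" "\<forall>x\<in>carrier (Q 0). h (\<eta> x) = ?\<phi> x" by (rule bexE)
  have "f (h x) = g x" if "x \<in> carrier X" for x
  proof -
    from that obtain y where y: "x = \<eta> y" "y \<in> carrier (Q 0)" unfolding \<eta>(2)[symmetric] by (rule imageE)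
    note s'y = mod_hom_closed[OF s'(1) y(2)]
    have "f (h x) = f (\<phi> y) \<ominus>\<^bsub>M\<^esub> f (\<epsilon> (s' y))"
      unfolding y(1) bspec[OF h(2) y(2)]
      by (rule mod_hom_minus[OF E M f(1) mod_hom_closed[OF \<phi>(1) y(2)] mod_hom_closed[OF \<epsilon>(1) s'y]])
    also have "\<dots> = g x"
      unfolding f\<epsilon>[OF s'y] bspec[OF \<phi>(2) y(2)] y(1)
      using mod_hom_closed[OF mod_hom_comp[OF \<eta>(1) g] y(2)] by simp
    finally show ?thesis .
  qed
  then show ?thesis using h(1) by blast
qed

section \<open>The presentation\<close>

text \<open>\<open>\<pi>\<close> has a section \<open>\<sigma>\<close>, and \<open>x - \<sigma> (\<pi> x)\<close> retracts \<open>T\<close> onto the kernel.\<close>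

lemma fg_projective_kernel:
  assumes "fg_projective R T" "fg_projective R F" "\<pi> \<in> mod_hom R T F" "\<pi> ` carrier T = carrier F"
  shows "fg_projective R (T\<lparr>carrier := mod_ker T F \<pi>\<rparr>)"
proof -
  note T = fg_projective_left_module[OF assms(1)] and F = fg_projective_left_module[OF assms(2)]
  interpret T: left_module R T by (rule T)
  interpret F: left_module R F by (rule F)
  have sub: "mod_ker T F \<pi> \<subseteq> carrier T" and K: "left_module R (T\<lparr>carrier := mod_ker T F \<pi>\<rparr>)"
    using submodule_mod_ker[OF T F assms(3)] submoduleD(1) left_module_submodule[OF T] by blast+
  have "(\<lambda>x. x) ` carrier F \<subseteq> \<pi> ` carrier T" using assms(4) by simp
  from fg_projective_lift[OF assms(2) T F mod_hom_id assms(3) this]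
  obtain \<sigma> where \<sigma>: "\<sigma> \<in> mod_hom R F T" "\<forall>x\<in>carrier F. \<pi> (\<sigma> x) = x" by (rule bexE)
  let ?r = "\<lambda>x. x \<ominus>\<^bsub>T\<^esub> \<sigma> (\<pi> x)"
  have r: "?r \<in> mod_hom R T T" by (rule mod_hom_diff[OF T mod_hom_id mod_hom_comp[OF assms(3) \<sigma>(1)]])
  have "\<pi> (?r x) = \<zero>\<^bsub>F\<^esub>" if x: "x \<in> carrier T" for x
    using mod_hom_minus[OF T F assms(3) x mod_hom_closed[OF mod_hom_comp[OF assms(3) \<sigma>(1)] x]]
      bspec[OF \<sigma>(2) mod_hom_closed[OF assms(3) x]] mod_hom_closed[OF assms(3) x] by simp
  then have "?r ` carrier T \<subseteq> mod_ker T F \<pi>" using mod_hom_closed[OF r] by (simp add: mod_ker_def image_subset_iff)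
  then have rK: "?r \<in> mod_hom R T (T\<lparr>carrier := mod_ker T F \<pi>\<rparr>)"
    using mod_hom_sub_iff[OF sub] r by blast
  have "?r x = x" if "x \<in> carrier (T\<lparr>carrier := mod_ker T F \<pi>\<rparr>)" for x
    using that mod_hom_zero[OF F T \<sigma>(1)] by (simp add: mod_ker_def)
  note rx = this
  show ?thesis
    by (rule fg_projective_retract[OF assms(1) K mod_hom_restrict_dom[OF mod_hom_id sub] rK]) (rule rx)
qed

text \<open>
  The diagram chase behind the exactness of the kernel of a surjective chain map, for the piece
  \<open>C \<rightarrow> A \<rightarrow> A'\<close> over \<open>D \<rightarrow> B \<rightarrow> B'\<close>: as \<open>\<pi> y\<close> is a cycle, it is the image of some \<open>w \<in> C\<close>, and \<open>y - b w\<close> is the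
  required element.
\<close>

lemma correct_into_kernel:
  assumes L: "left_module R A" "left_module R A'" "left_module R B"
    and b: "b \<in> mod_hom R C A" and a: "a \<in> mod_hom R A A'"
    and \<pi>: "\<pi> \<in> mod_hom R A B" and \<rho>: "\<rho> ` carrier C = carrier D"
    and commute: "\<And>w. w \<in> carrier C \<Longrightarrow> d' (\<rho> w) = \<pi> (b w)" "\<And>y. y \<in> carrier A \<Longrightarrow> d (\<pi> y) = \<tau> (a y)"
    and ab: "\<And>w. w \<in> carrier C \<Longrightarrow> a (b w) = \<zero>\<^bsub>A'\<^esub>"
    and exact: "mod_ker B B' d \<subseteq> d' ` carrier D"
    and y: "y \<in> carrier A" "\<tau> (a y) = \<zero>\<^bsub>B'\<^esub>"
  shows "\<exists>z\<in>mod_ker A B \<pi>. a z = a y"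
proof -
  interpret A: left_module R A by (rule L)
  interpret A': left_module R A' by (rule L)
  interpret B: left_module R B by (rule L)
  note \<pi>y = mod_hom_closed[OF \<pi> y(1)]
  have "\<pi> y \<in> d' ` carrier D"
    using exact commute(2)[OF y(1)] y(2) \<pi>y by (auto simp: mod_ker_def)
  then obtain w where w: "w \<in> carrier C" "\<pi> y = d' (\<rho> w)" unfolding \<rho>[symmetric] by blast
  note bw = mod_hom_closed[OF b w(1)]
  show ?thesis
  proof (rule bexI)
    show "a (y \<ominus>\<^bsub>A\<^esub> b w) = a y"
      using mod_hom_minus[OF L(1,2) a y(1) bw] ab[OF w(1)] mod_hom_closed[OF a y(1)] by simp
    show "y \<ominus>\<^bsub>A\<^esub> b w \<in> mod_ker A B \<pi>"
      using mod_hom_minus[OF L(1,3) \<pi> y(1) bw] \<pi>y y(1) bw by (simp add: mod_ker_def w(2) commute(1)[OF w(1)])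
  qed
qed

text \<open>
  \<open>T\<close> resolves its cokernel \<open>E\<close>, and the kernel \<open>P\<close> of \<open>\<pi>\<close> resolves the kernel \<open>K\<close> of \<open>E \<rightarrow> M\<close> by the long exact
  sequence of \<open>0 \<rightarrow> P \<rightarrow> T \<rightarrow> F \<rightarrow> 0\<close>. As \<open>\<pi>\<close> is the identity from degree \<open>t\<close> on, \<open>P\<close>
  vanishes there, which bounds the projective dimension of \<open>K\<close>.
\<close>

lemma presentation_of_stage:
  fixes R :: "('a, 'c) ring_scheme" and M :: "('a, 'b) module" and F T :: "nat \<Rightarrow> ('a, nat \<Rightarrow> 'a) module"
  assumes noeth: "left_noetherian R" and M: "left_module R M"
    and F: "projective_resolution R M F d e"
    and st: "approximation_stage R F d t T \<delta> \<pi>" and t: "t = Suc r"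
  shows "has_W_approximation_presentation R t M"
proof -
  note S = stage_facts[OF st]
  note FD = F[unfolded projective_resolution_def]
  have LT: "left_module R (T n)" and \<delta>: "\<delta> n \<in> mod_hom R (T (Suc n)) (T n)"
    and \<delta>\<delta>: "x \<in> carrier (T (Suc (Suc n))) \<Longrightarrow> \<delta> n (\<delta> (Suc n) x) = \<zero>\<^bsub>T n\<^esub>" for n x
    using S(2) unfolding complex_of_def by auto
  have Fp: "fg_projective R (F n)" and d: "d n \<in> mod_hom R (F (Suc n)) (F n)" and e: "e \<in> mod_hom R (F 0) M"
    "e ` carrier (F 0) = carrier M" "d 0 ` carrier (F 1) = mod_ker (F 0) M e"
    and dex: "d (Suc n) ` carrier (F (Suc (Suc n))) = mod_ker (F (Suc n)) (F n) (d n)" for n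
    using FD by auto
  note LF = fg_projective_left_module[OF Fp]
  note \<delta>c = mod_hom_closed[OF \<delta>] and \<pi>c = mod_hom_closed[OF S(8)]
  let ?H = "\<delta> 0 ` carrier (T (Suc 0))"
  define E where "E = quot_module (T 0) ?H"
  define q where "q x = ?H +>\<^bsub>T 0\<^esub> x" for x
  have subH: "submodule ?H R (T 0)" by (rule submodule_image[OF LT LT \<delta>])
  have E: "left_module R E" and q: "q \<in> mod_hom R (T 0) E" "q ` carrier (T 0) = carrier E"
    and q0: "\<And>x. x \<in> carrier (T 0) \<Longrightarrow> q x = \<zero>\<^bsub>E\<^esub> \<longleftrightarrow> x \<in> ?H"
    unfolding E_def q_def[abs_def] using quot_module[OF LT subH] by auto
  have Hker: "?H = mod_ker (T 0) E q" using q0 \<delta>c[of _ 0] by (auto simp: mod_ker_def)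
  have Tex: "\<delta> (Suc n) ` carrier (T (Suc (Suc n))) = mod_ker (T (Suc n)) (T n) (\<delta> n)" for n
  proof (rule subset_antisym[OF _ S(3)], rule image_subsetI)
    fix x assume x: "x \<in> carrier (T (Suc (Suc n)))"
    show "\<delta> (Suc n) x \<in> mod_ker (T (Suc n)) (T n) (\<delta> n)"
      unfolding mod_ker_def using \<delta>c[OF x] \<delta>\<delta>[OF x] by simp
  qed
  have resE: "projective_resolution R E T \<delta> q"
    unfolding projective_resolution_def using S(1) q \<delta> Hker Tex by simp
  have fgE: "fg_module R E"
    using finitely_generated_image[OF LT E q] fg_projective_fg_module[OF S(1)[of 0]] E by (simp add: fg_module_def)
  have e\<pi>: "(\<lambda>x. e (\<pi> 0 x)) \<in> mod_hom R (T 0) M" by (rule mod_hom_comp[OF S(8) e(1)])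
  have ed: "e (d 0 x) = \<zero>\<^bsub>M\<^esub>" if "x \<in> carrier (F (Suc 0))" for x
    using e(3) imageI[OF that, of "d 0"] by (auto simp: mod_ker_def)
  have e\<pi>0: "e (\<pi> 0 x) = \<zero>\<^bsub>M\<^esub>" if x: "x \<in> carrier (T 0)" "q x = \<zero>\<^bsub>E\<^esub>" for x
  proof -
    have "x \<in> ?H" using q0 x by blast
    then obtain y where y: "x = \<delta> 0 y" "y \<in> carrier (T (Suc 0))" by (rule imageE)
    show ?thesis unfolding y(1) S(10)[OF y(2), symmetric] by (rule ed[OF \<pi>c[OF y(2)]])
  qed
  have "\<exists>f\<in>mod_hom R E M. \<forall>x\<in>carrier (T 0). f (q x) = e (\<pi> 0 x)"
    by (rule hom_through_surjection[OF LT E M q e\<pi>]) (rule e\<pi>0)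
  then obtain f where f: "f \<in> mod_hom R E M" "\<forall>x\<in>carrier (T 0). f (q x) = e (\<pi> 0 x)" by (rule bexE)
  have fs: "f ` carrier E = carrier M"
  proof -
    have "f ` carrier E = (\<lambda>x. f (q x)) ` carrier (T 0)" unfolding q(2)[symmetric] by (rule image_image)
    also have "\<dots> = (\<lambda>x. e (\<pi> 0 x)) ` carrier (T 0)" by (rule image_cong[OF refl bspec[OF f(2)]])
    also have "\<dots> = e ` \<pi> 0 ` carrier (T 0)" by (rule image_image[symmetric])
    finally show ?thesis unfolding S(9) e(2) .
  qed
  let ?k = "\<lambda>n. mod_ker (T n) (F n) (\<pi> n)"
  define P where "P n = (T n)\<lparr>carrier := ?k n\<rparr>" for n
  have subk: "submodule (?k n) R (T n)" for n by (rule submodule_mod_ker[OF LT LF S(8)])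
  have LPn: "left_module R (P n)" for n unfolding P_def by (rule left_module_submodule[OF LT subk])
  have Pc: "carrier (P n) = ?k n" and Pz: "\<zero>\<^bsub>P n\<^esub> = \<zero>\<^bsub>T n\<^esub>" for n by (simp_all add: P_def)
  have kc: "x \<in> carrier (T n)" "\<pi> n x = \<zero>\<^bsub>F n\<^esub>" if "x \<in> ?k n" for x n using that by (auto simp: mod_ker_def)
  have kI: "x \<in> ?k n" if "x \<in> carrier (T n)" "\<pi> n x = \<zero>\<^bsub>F n\<^esub>" for x n using that by (simp add: mod_ker_def)
  have Pp: "fg_projective R (P n)" for n
    unfolding P_def by (rule fg_projective_kernel[OF S(1) Fp S(8) S(9)])
  have \<delta>k: "\<delta> n x \<in> ?k n" if "x \<in> ?k (Suc n)" for n x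
  proof (rule kI[OF \<delta>c[OF kc(1)[OF that]]])
    show "\<pi> n (\<delta> n x) = \<zero>\<^bsub>F n\<^esub>"
      unfolding S(10)[OF kc(1)[OF that], symmetric] kc(2)[OF that] by (rule mod_hom_zero[OF LF LF d])
  qed
  have \<delta>P: "\<delta> n \<in> mod_hom R (P (Suc n)) (P n)" for n
    unfolding P_def mod_hom_sub_iff[OF submoduleD(1)[OF subk]]
    using mod_hom_restrict_dom[OF \<delta> submoduleD(1)[OF subk]] \<delta>k by auto
  have adjust: "\<exists>z\<in>?k (Suc n). \<delta> n z = \<delta> n y" if y: "y \<in> carrier (T (Suc n))" "\<pi> n (\<delta> n y) = \<zero>\<^bsub>F n\<^esub>" for n y
    by (rule correct_into_kernel[where A = "T (Suc n)" and A' = "T n" and B = "F (Suc n)" and B' = "F n"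
        and C = "T (Suc (Suc n))" and D = "F (Suc (Suc n))" and b = "\<delta> (Suc n)" and d = "d n" and d' = "d (Suc n)"
        and \<rho> = "\<pi> (Suc (Suc n))" and \<tau> = "\<pi> n"],
      (rule LT LF \<delta> S(8) S(9) equalityD2[OF dex] y | erule S(10) \<delta>\<delta>)+)
  have Pex: "\<delta> (Suc n) ` carrier (P (Suc (Suc n))) = mod_ker (P (Suc n)) (P n) (\<delta> n)" for n
  proof (rule subset_antisym)
    show "\<delta> (Suc n) ` carrier (P (Suc (Suc n))) \<subseteq> mod_ker (P (Suc n)) (P n) (\<delta> n)"
    proof (rule image_subsetI)
      fix x assume "x \<in> carrier (P (Suc (Suc n)))"
      then have x: "x \<in> ?k (Suc (Suc n))" by (simp only: Pc)
      show "\<delta> (Suc n) x \<in> mod_ker (P (Suc n)) (P n) (\<delta> n)"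
        unfolding mod_ker_def[of "P (Suc n)"] Pc Pz using \<delta>k[OF x] \<delta>\<delta>[OF kc(1)[OF x]] by simp
    qed
    show "exact_at P \<delta> n"
    proof
      fix x assume "x \<in> mod_ker (P (Suc n)) (P n) (\<delta> n)"
      then have x: "x \<in> ?k (Suc n)" "\<delta> n x = \<zero>\<^bsub>T n\<^esub>" unfolding mod_ker_def[of "P (Suc n)"] Pc Pz by auto
      then have "x \<in> \<delta> (Suc n) ` carrier (T (Suc (Suc n)))" using S(3)[of n] kc(1)[OF x(1)] by (auto simp: mod_ker_def)
      then obtain y where y: "x = \<delta> (Suc n) y" "y \<in> carrier (T (Suc (Suc n)))" by (rule imageE)
      from adjust[OF y(2)] kc(2)[OF x(1)] obtain z where z: "z \<in> ?k (Suc (Suc n))" "\<delta> (Suc n) z = \<delta> (Suc n) y"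
        unfolding y(1) by blast
      show "x \<in> \<delta> (Suc n) ` carrier (P (Suc (Suc n)))"
        unfolding Pc y(1) using z(2)[symmetric] z(1) by (rule image_eqI)
    qed
  qed
  have qP: "q \<in> mod_hom R (P 0) E"
    unfolding P_def by (rule mod_hom_restrict_dom[OF q(1) submoduleD(1)[OF subk]])
  have qk: "q ` carrier (P 0) = mod_ker E M f"
  proof (rule subset_antisym)
    show "q ` carrier (P 0) \<subseteq> mod_ker E M f"
    proof (rule image_subsetI)
      fix x assume "x \<in> carrier (P 0)"
      then have x: "x \<in> ?k 0" by (simp only: Pc)
      show "q x \<in> mod_ker E M f"
        using bspec[OF f(2) kc(1)[OF x]] kc(2)[OF x] mod_hom_zero[OF LF M e(1)] mod_hom_closed[OF q(1) kc(1)[OF x]]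
        by (simp add: mod_ker_def)
    qed
    show "mod_ker E M f \<subseteq> q ` carrier (P 0)"
    proof
      fix y assume "y \<in> mod_ker E M f"
      then have y: "y \<in> carrier E" "f y = \<zero>\<^bsub>M\<^esub>" by (auto simp: mod_ker_def)
      from y(1) obtain x where x: "y = q x" "x \<in> carrier (T 0)" unfolding q(2)[symmetric] by (rule imageE)
      have "\<exists>z\<in>?k 0. q z = q x"
      proof (rule correct_into_kernel[where A = "T 0" and A' = E and B = "F 0" and B' = M and C = "T (Suc 0)"
          and D = "F (Suc 0)" and b = "\<delta> 0" and d = e and d' = "d 0" and \<rho> = "\<pi> (Suc 0)" and \<tau> = f])
        show "e (\<pi> 0 y) = f (q y)" if "y \<in> carrier (T 0)" for y using bspec[OF f(2) that] by simp
        show "q (\<delta> 0 y) = \<zero>\<^bsub>E\<^esub>" if "y \<in> carrier (T (Suc 0))" for y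
          using q0[OF \<delta>c[OF that]] imageI[OF that, of "\<delta> 0"] by blast
        show "mod_ker (F 0) M e \<subseteq> d 0 ` carrier (F (Suc 0))" using e(3) by simp
        show "f (q x) = \<zero>\<^bsub>M\<^esub>" using y(2) x(1) by simp
      qed (rule LT E LF \<delta> q(1) S(8) S(9) x(2) | erule S(10))+
      then show "y \<in> q ` carrier (P 0)" unfolding Pc x(1) by (metis image_eqI)
    qed
  qed
  have q1: "\<delta> 0 ` carrier (P 1) = mod_ker (P 0) E q"
  proof (rule subset_antisym)
    show "\<delta> 0 ` carrier (P 1) \<subseteq> mod_ker (P 0) E q"
    proof (rule image_subsetI)
      fix x assume "x \<in> carrier (P 1)"
      then have x: "x \<in> ?k (Suc 0)" by (simp add: Pc)
      have "q (\<delta> 0 x) = \<zero>\<^bsub>E\<^esub>" using q0[OF \<delta>c[OF kc(1)[OF x]]] imageI[OF kc(1)[OF x], of "\<delta> 0"] by blast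
      then show "\<delta> 0 x \<in> mod_ker (P 0) E q" unfolding mod_ker_def[of "P 0"] Pc using \<delta>k[OF x] by simp
    qed
    show "mod_ker (P 0) E q \<subseteq> \<delta> 0 ` carrier (P 1)"
    proof
      fix x assume "x \<in> mod_ker (P 0) E q"
      then have x: "x \<in> ?k 0" "q x = \<zero>\<^bsub>E\<^esub>" unfolding mod_ker_def[of "P 0"] Pc by auto
      then have "x \<in> ?H" using q0[OF kc(1)[OF x(1)]] by blast
      then obtain y where y: "x = \<delta> 0 y" "y \<in> carrier (T (Suc 0))" by (rule imageE)
      from adjust[OF y(2)] kc(2)[OF x(1)] obtain z where z: "z \<in> ?k (Suc 0)" "\<delta> 0 z = \<delta> 0 y"
        unfolding y(1) by blast
      show "x \<in> \<delta> 0 ` carrier (P 1)"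
        unfolding Pc y(1) One_nat_def using z(2)[symmetric] z(1) by (rule image_eqI)
    qed
  qed
  have bounded: "carrier (P n) = {\<zero>\<^bsub>P n\<^esub>}" if n: "n > r" for n
  proof -
    have n': "t \<le> n" using n t by simp
    interpret F: left_module R "F n" by (rule LF)
    show ?thesis
      unfolding Pc Pz mod_ker_def S(4)[OF n'] using S(5)[OF n'] F.M.zero_closed by auto
  qed
  define K where "K = E\<lparr>carrier := mod_ker E M f\<rparr>"
  have subK: "submodule (mod_ker E M f) R E" by (rule submodule_mod_ker[OF E M f(1)])
  have K: "left_module R K" unfolding K_def by (rule left_module_submodule[OF E subK])
  have Kc: "carrier K = mod_ker E M f" and Kz: "\<zero>\<^bsub>K\<^esub> = \<zero>\<^bsub>E\<^esub>" by (simp_all add: K_def)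
  have qK: "q \<in> mod_hom R (P 0) K"
    unfolding K_def mod_hom_sub_iff[OF submoduleD(1)[OF subK]] using qP qk by simp
  have qKs: "q ` carrier (P 0) = carrier K" unfolding Kc by (rule qk)
  have qK1: "\<delta> 0 ` carrier (P 1) = mod_ker (P 0) K q" unfolding mod_ker_def[of _ K] Kz unfolding mod_ker_def[symmetric] by (rule q1)
  have resK: "projective_resolution R K P \<delta> q"
    unfolding projective_resolution_def using Pp qK \<delta>P qKs qK1 Pex by simp
  have pdK: "proj_dim_le R K (t - 1)"
    unfolding proj_dim_le_def using resK bounded t by auto
  have fgK: "fg_module R K"
    using finitely_generated_image[OF LPn K qK qKs] fg_projective_fg_module[OF Pp[of 0]] K by (simp add: fg_module_def)
  have EW: "E \<in> W_modules R t"
    unfolding W_modules_def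
  proof (intro CollectI conjI allI impI fgE)
    fix n assume n: "1 \<le> n \<and> n \<le> t"
    then obtain m where m: "n = Suc m" "m < t" by (cases n) auto
    show "Ext_vanishes R E n" unfolding Ext_vanishes_iff[OF noeth fgE resE] m(1) by (rule S(7)[OF m(2)])
  qed
  have lift: "\<exists>h\<in>mod_hom R X E. \<forall>x\<in>carrier X. f (h x) = g x"
    if X: "X \<in> W_modules R t" and g: "g \<in> mod_hom R X M" for X :: "'a umodule" and g
  proof -
    have fgX: "fg_module R X" and vX: "\<And>i. 1 \<le> i \<Longrightarrow> i \<le> t \<Longrightarrow> Ext_vanishes R X i"
      using X by (auto simp: W_modules_def)
    obtain Q :: "nat \<Rightarrow> ('a, nat \<Rightarrow> 'a) module" and \<gamma> \<eta> where Q: "projective_resolution R X Q \<gamma> \<eta>"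
      using projective_resolution_exists[OF noeth fgX] by (elim exE)
    have dx: "dual_exact R Q \<gamma> (Suc n)" if "n < Suc r" for n
      using vX[of "Suc n"] that t unfolding Ext_vanishes_iff[OF noeth fgX Q] by simp
    have LX: "left_module R X" using fgX by (simp add: fg_module_def)
    show ?thesis
      by (rule lift_along_epimorphism[OF Q LX dx Pp projective_resolution_complex[OF resK] equalityD2[OF Pex] bounded E M f(1) fs qP qk q1 g])
  qed
  have "right_W_approximation R t E M f"
    unfolding right_W_approximation_def using EW f(1) lift by blast
  moreover have "(\<lambda>x. x) \<in> mod_hom R K E"
    unfolding K_def by (rule mod_hom_restrict_dom[OF mod_hom_id submoduleD(1)[OF subK]])
  ultimately have "W_approximation_presentation R t M K E (\<lambda>x. x) f"
    unfolding W_approximation_presentation_def using fgK fgE f(1) fs pdK by (simp add: Kc)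
  then show ?thesis unfolding has_W_approximation_presentation_def by blast
qed

theorem theorem3p3:
  fixes R :: "'a ring" and M :: "('a, 'b) module" and k :: nat
  assumes "ring R" and "left_noetherian R" and "right_noetherian R"
    and "fg_module R M"
    and "k \<ge> 1"
    and "\<And>t. 1 \<le> t \<Longrightarrow> t \<le> k - 1 \<Longrightarrow> sgrade_ge (op_ring R) (Ext R M (t + 1)) t"
  shows "\<forall>t. 1 \<le> t \<and> t \<le> k \<longrightarrow> has_W_approximation_presentation R t M"
proof (intro allI impI)
  fix t assume t: "1 \<le> t \<and> t \<le> k"
  have M: "left_module R M" using assms(4) by (simp add: fg_module_def)
  obtain F :: "nat \<Rightarrow> ('a, nat \<Rightarrow> 'a) module" and d e where F: "projective_resolution R M F d e"
    and Ext: "\<And>i. Ext R M i = dual_cohomology R F d i"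
    using Ext_resolution[OF assms(2,4)] by blast
  have grade: "grade_ge (op_ring R) (dual_cohomology R F d (Suc s)) s" if s: "1 \<le> s" "s < k" for s
  proof -
    let ?H = "dual_cohomology R F d (Suc s)"
    note C = dual_cohomology_facts[OF projective_resolution_complex[OF F], of "Suc s"]
    have H: "left_module (op_ring R) ?H"
      unfolding dual_cohomology_def by (rule quot_module(1)[OF C(1,3)])
    have "sgrade_ge (op_ring R) ?H s" using assms(6)[of s] s by (simp add: Ext)
    then have "grade_ge (op_ring R) (?H\<lparr>carrier := carrier ?H\<rparr>) s"
      unfolding sgrade_ge_def using submodule_carrier[OF H] by blast
    then show ?thesis by simp
  qed
  have "\<exists>(T :: nat \<Rightarrow> ('a, nat \<Rightarrow> 'a) module) \<delta> \<pi>. approximation_stage R F d t T \<delta> \<pi>"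
    by (rule stage_exists[OF assms(3) F grade conjunct2[OF t]])
  then obtain T :: "nat \<Rightarrow> ('a, nat \<Rightarrow> 'a) module" and \<delta> \<pi> where st: "approximation_stage R F d t T \<delta> \<pi>"
    by (elim exE)
  obtain r where "t = Suc r" using t by (cases t) auto
  then show "has_W_approximation_presentation R t M"
    by (rule presentation_of_stage[OF assms(2) M F st])
qed

end
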